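(* Let $G$ be a Lie group acting properly on a manifold $M$, let $x_0\in M$ have stabilizer $G_{x_0}$, and let $S$ be a slice through $x_0$ in $M$. Let $G_{x_0}$ act on $T_{x_0}S$ by the tangent action. Then, as real vector spaces, $$T_{[x_0]}(M/G)\cong T_{[0]}(T_{x_0}S/G_{x_0}).$$ Thus the determination of the internal tangent space of $M/G$ at $[x_0]$ reduces to the study of the quotient of a vector space by a compact, linear group action.
   Context: Manifolds are smooth, Hausdorff, second-countable and without boundary. Diffeological spaces. A parametrization of a set $X$ is a map $p:U\to X$ with $U\subseteq\mathbb{R}^n$ open, $n\ge 0$. A diffeological space is a nonempty set $X$ with a collection $\mathcal{D}_X$ of parametrizations, called plots (the collection is called a diffeology), such that: (1) all constant parametrizations $\mathbb{R}^n\to X$ are plots; (2) if $p:U\to X$ is a plot, $V\subseteq\mathbb{R}^m$ is open and $F:V\to U$ is smooth, then $p\circ F$ is a plot; (3) a parametrization $p:U\to X$ such that every $u\in U$ has an open neighborhood $V\subseteq U$ with $p|_V$ a plot is itself a plot. A manifold carries the standard diffeology, whose plots are all smooth parametrizations. If $\sim$ is an equivalence relation on $X$ with projection $\pi:X\to X/\sim$, the quotient diffeology on $X/\sim$ consists of the parametrizations which locally have the form $\pi\circ p$ with $p\in\mathcal{D}_X$. Orbit spaces carry the quotient diffeology. Internal tangent space. A plot pointing to $x\in X$, written $p:(U_p,0)\to(X,x)$, is a plot with connected domain $U_p$ containing $0$ and $p(0)=x$. The internal tangent space is $T_x(X)=F/R$, where $F=\bigoplus_p T_0(U_p)$ is indexed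 by all plots pointing to $x$ (with $(p,v)$ denoting $v\in T_0(U_p)$ in the summand indexed by $p$), and $R$ is the span of all vectors $(p,v)-(q,g_*(v))$, where $p,q$ are plots pointing to $x$, $v\in T_0(U_p)$, and $g:(U_p,0)\to(U_q,0)$ is a germ at $0$ of smooth maps with $p=q\circ g$ as germs at $0$. Actions and slices. An action $A:G\times M\to M$, $A(g,x)=g\cdot x$, is a smooth left action of a Lie group. It is proper if $(g,x)\mapsto(g\cdot x,x)$ is a proper map $G\times M\to M\times M$. The stabilizer of $x$ is $G_x=\{g\in G: g\cdot x=x\}$, which is compact when the action is proper. $M/G$ is the set of orbits; $[x]$ is the orbit of $x$. Let $A_x:G\to M$, $A_x(g)=g\cdot x$, and $\mathfrak{g}=T_1G$. A slice through $x_0$ is a submanifold $S\subseteq M$ through $x_0$ such that: (1) $T_{x_0}M=(A_{x_0})_*|_1(\mathfrak{g})\oplus T_{x_0}S$ and $T_xM=(A_x)_*|_1(\mathfrak{g})+T_xS$ for all $x\in S$; (2) $S$ is $G_{x_0}$-invariant; (3) if $g\in G$, $x\in S$ and $g\cdot x\in S$, then $g\in G_{x_0}$. Slices exist through every point for proper actions. The tangent action of $G_{x_0}$ on $T_{x_0}M$ is $k\mapsto$ the differential at $x_0$ of $y\mapsto k\cdot y$; it leaves $T_{x_0}S$ invariant. *)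

theory Defs
  imports "HOL-Analysis.Analysis" "HOL-Algebra.Group_Action" "HOL-Library.Function_Algebras"
begin

section \<open>Real vector spaces\<close>

instantiation "fun" :: (type, real_vector) real_vector
begin

definition scaleR_fun :: "real \<Rightarrow> ('a \<Rightarrow> 'b) \<Rightarrow> 'a \<Rightarrow> 'b"
  where "scaleR_fun c f = (\<lambda>x. c *\<^sub>R f x)"

instance
  by standard (auto simp: scaleR_fun_def plus_fun_def algebra_simps)

end

definition linear_on :: "'v::real_vector set \<Rightarrow> ('v \<Rightarrow> 'w::real_vector) \<Rightarrow> bool"
  where "linear_on V f \<longleftrightarrow>
    (\<forall>a\<in>V. \<forall>b\<in>V. f (a + b) = f a + f b) \<and> (\<forall>c. \<forall>a\<in>V. f (c *\<^sub>R a) = c *\<^sub>R f a)"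

text \<open>Quotient spaces are not types here, so they are given by a carrier together with operations.\<close>

record 'v vec_space =
  vcarrier :: "'v set"
  vadd :: "'v \<Rightarrow> 'v \<Rightarrow> 'v"
  vscale :: "real \<Rightarrow> 'v \<Rightarrow> 'v"

definition quotient_space :: "'v::real_vector set \<Rightarrow> 'v set \<Rightarrow> 'v set vec_space"
  where "quotient_space F R =
    \<lparr>vcarrier = F // {(a, b). a \<in> F \<and> b \<in> F \<and> a - b \<in> R},
     vadd = (\<lambda>A B. {a + b | a b. a \<in> A \<and> b \<in> B}),
     vscale = (\<lambda>c A. {c *\<^sub>R a + r | a r. a \<in> A \<and> r \<in> R})\<rparr>"

definition vec_space_iso :: "'v vec_space \<Rightarrow> 'w vec_space \<Rightarrow> bool"
  where "vec_space_iso V W \<longleftrightarrow>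
    (\<exists>h. bij_betw h (vcarrier V) (vcarrier W) \<and>
      (\<forall>a\<in>vcarrier V. \<forall>b\<in>vcarrier V. h (vadd V a b) = vadd W (h a) (h b)) \<and>
      (\<forall>c. \<forall>a\<in>vcarrier V. h (vscale V c a) = vscale W c (h a)))"


section \<open>Smooth maps between open subsets of Euclidean spaces\<close>

text \<open>The dimensions of the domains of plots vary, so \<open>\<real>\<^sup>n\<close> is the library space
  \<^const>\<open>Euclidean_space\<close> of sequences vanishing from index \<open>n\<close> on. Its topology is the one
  induced by the product topology on \<^typ>\<open>nat \<Rightarrow> real\<close>.\<close>

definition partial :: "nat \<Rightarrow> ((nat \<Rightarrow> real) \<Rightarrow> real) \<Rightarrow> (nat \<Rightarrow> real) \<Rightarrow> real"
  where "partial i f x = deriv (\<lambda>t. f (x(i := t))) (x i)"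

primrec partials :: "nat list \<Rightarrow> ((nat \<Rightarrow> real) \<Rightarrow> real) \<Rightarrow> (nat \<Rightarrow> real) \<Rightarrow> real"
  where
    "partials [] f = f"
  | "partials (i # is) f = partial i (partials is f)"

text \<open>On an open \<open>U \<subseteq> \<real>\<^sup>n\<close>: all iterated partial derivatives exist and are continuous.\<close>

definition smooth_fun :: "nat \<Rightarrow> (nat \<Rightarrow> real) set \<Rightarrow> ((nat \<Rightarrow> real) \<Rightarrow> real) \<Rightarrow> bool"
  where "smooth_fun n U f \<longleftrightarrow>
    (\<forall>is. set is \<subseteq> {..<n} \<longrightarrow>
      continuous_on U (partials is f) \<and>
      (\<forall>i<n. \<forall>x\<in>U. (\<lambda>t. partials is f (x(i := t))) field_differentiable (at (x i))))"

definition smooth_on ::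
    "nat \<Rightarrow> (nat \<Rightarrow> real) set \<Rightarrow> nat \<Rightarrow> ((nat \<Rightarrow> real) \<Rightarrow> nat \<Rightarrow> real) \<Rightarrow> bool"
  where "smooth_on n U m f \<longleftrightarrow>
    f ` U \<subseteq> topspace (Euclidean_space m) \<and> (\<forall>j<m. smooth_fun n U (\<lambda>x. f x j))"

text \<open>The differential at \<open>0\<close> of a germ of maps from \<open>\<real>\<^sup>n\<close>, applied to \<open>v\<close>.\<close>

definition jacobian :: "nat \<Rightarrow> ((nat \<Rightarrow> real) \<Rightarrow> nat \<Rightarrow> real) \<Rightarrow> (nat \<Rightarrow> real) \<Rightarrow> nat \<Rightarrow> real"
  where "jacobian n g v = (\<lambda>j. \<Sum>i<n. partial i (\<lambda>x. g x j) 0 * v i)"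


section \<open>Manifolds\<close>

text \<open>A chart consists of its dimension, its domain and its coordinate map; the values of the
  coordinate map outside the domain are irrelevant. The dimension belongs to the chart, so
  connected components may have different dimensions.\<close>

type_synonym 'a chart = "nat \<times> 'a set \<times> ('a \<Rightarrow> nat \<Rightarrow> real)"

record 'a manifold =
  mtop :: "'a topology"
  atlas :: "'a chart set"

abbreviation mcarrier :: "'a manifold \<Rightarrow> 'a set"
  where "mcarrier M \<equiv> topspace (mtop M)"

definition chart_on :: "'a topology \<Rightarrow> 'a chart \<Rightarrow> bool"
  where "chart_on X = (\<lambda>(n, U, \<phi>).
    openin X U \<and> openin (Euclidean_space n) (\<phi> ` U) \<and>
    homeomorphic_map (subtopology X U) (subtopology (Euclidean_space n) (\<phi> ` U)) \<phi>)"

definition smooth_transition :: "'a chart \<Rightarrow> 'a chart \<Rightarrow> bool"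
  where "smooth_transition = (\<lambda>(n, U, \<phi>) (m, V, \<psi>).
    smooth_on n (\<phi> ` (U \<inter> V)) m (\<psi> \<circ> inv_into U \<phi>))"

definition is_manifold :: "'a manifold \<Rightarrow> bool"
  where "is_manifold M \<longleftrightarrow>
    Hausdorff_space (mtop M) \<and> second_countable (mtop M) \<and>
    (\<forall>c\<in>atlas M. chart_on (mtop M) c) \<and>
    (\<forall>c\<in>atlas M. \<forall>d\<in>atlas M. smooth_transition c d) \<and>
    (\<Union>(n, U, \<phi>)\<in>atlas M. U) = mcarrier M"

text \<open>Membership in the maximal atlas.\<close>

definition smooth_chart :: "'a manifold \<Rightarrow> 'a chart \<Rightarrow> bool"
  where "smooth_chart M c \<longleftrightarrow>
    chart_on (mtop M) c \<and> (\<forall>d\<in>atlas M. smooth_transition c d \<and> smooth_transition d c)"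

definition submanifold :: "'a manifold \<Rightarrow> 'a set \<Rightarrow> bool"
  where "submanifold M S \<longleftrightarrow> S \<subseteq> mcarrier M \<and>
    (\<forall>x\<in>S. \<exists>n U \<phi> k. smooth_chart M (n, U, \<phi>) \<and> x \<in> U \<and> k \<le> n \<and>
      \<phi> ` (U \<inter> S) = \<phi> ` U \<inter> topspace (Euclidean_space k))"

definition product_manifold :: "'a manifold \<Rightarrow> 'b manifold \<Rightarrow> ('a \<times> 'b) manifold"
  where "product_manifold M N =
    \<lparr>mtop = prod_topology (mtop M) (mtop N),
     atlas = {(m + n, U \<times> V, \<lambda>(x, y) i. if i < m then \<phi> x i else \<psi> y (i - m)) | m U \<phi> n V \<psi>.
       (m, U, \<phi>) \<in> atlas M \<and> (n, V, \<psi>) \<in> atlas N}\<rparr>"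

text \<open>A finite-dimensional vector space with its standard smooth structure, whose charts are the
  linear isomorphisms onto \<open>\<real>\<^sup>k\<close>. The product topology on functions induces the standard topology
  on each finite-dimensional subspace.\<close>

definition vector_manifold :: "('i \<Rightarrow> nat \<Rightarrow> real) set \<Rightarrow> ('i \<Rightarrow> nat \<Rightarrow> real) manifold"
  where "vector_manifold V =
    \<lparr>mtop = top_of_set V,
     atlas = {(k, V, L) | k L. linear_on V L \<and> bij_betw L V (topspace (Euclidean_space k))}\<rparr>"


section \<open>Diffeologies\<close>

text \<open>A parametrization \<open>p : U \<rightarrow> X\<close> with \<open>U \<subseteq> \<real>\<^sup>n\<close> is the triple \<open>(n, U, p)\<close>, where \<open>p\<close> is
  extensional on \<open>U\<close>, so that equal parametrizations are equal triples. A diffeology is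
  represented by the set of its plots.\<close>

type_synonym 'x plot = "nat \<times> (nat \<Rightarrow> real) set \<times> ((nat \<Rightarrow> real) \<Rightarrow> 'x)"

definition standard_diffeology :: "'a manifold \<Rightarrow> 'a plot set"
  where "standard_diffeology M =
    {(n, U, p). openin (Euclidean_space n) U \<and> p \<in> U \<rightarrow>\<^sub>E mcarrier M \<and>
      continuous_map (subtopology (Euclidean_space n) U) (mtop M) p \<and>
      (\<forall>(m, W, \<psi>)\<in>atlas M. smooth_on n {u \<in> U. p u \<in> W} m (\<psi> \<circ> p))}"

definition quotient_diffeology :: "'x plot set \<Rightarrow> ('x \<times> 'x) set \<Rightarrow> 'x set plot set"
  where "quotient_diffeology D r =
    {(n, U, p). openin (Euclidean_space n) U \<and> p \<in> extensional U \<and>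
      (\<forall>u\<in>U. \<exists>V q. (n, V, q) \<in> D \<and> u \<in> V \<and> V \<subseteq> U \<and> (\<forall>w\<in>V. p w = r `` {q w}))}"

definition pointed_plots :: "'x plot set \<Rightarrow> 'x \<Rightarrow> 'x plot set"
  where "pointed_plots D x = {(n, U, p). (n, U, p) \<in> D \<and> connected U \<and> 0 \<in> U \<and> p 0 = x}"

text \<open>The direct sum of the spaces \<open>T\<^sub>0(U) = \<real>\<^sup>n\<close> over all pointed plots \<open>(n, U, p)\<close>.\<close>

definition tangent_sum :: "'x plot set \<Rightarrow> 'x \<Rightarrow> ('x plot \<Rightarrow> nat \<Rightarrow> real) set"
  where "tangent_sum D x =
    {\<omega>. finite {P. \<omega> P \<noteq> 0} \<and> (\<forall>P. P \<notin> pointed_plots D x \<longrightarrow> \<omega> P = 0) \<and>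
      (\<forall>P\<in>pointed_plots D x. \<omega> P \<in> topspace (Euclidean_space (fst P)))}"

definition summand :: "'x plot \<Rightarrow> (nat \<Rightarrow> real) \<Rightarrow> 'x plot \<Rightarrow> nat \<Rightarrow> real"
  where "summand P v = (\<lambda>Q. if Q = P then v else 0)"

definition tangent_relations :: "'x plot set \<Rightarrow> 'x \<Rightarrow> ('x plot \<Rightarrow> nat \<Rightarrow> real) set"
  where "tangent_relations D x = span
    {summand (n, U, p) v - summand (m, V, q) (jacobian n g v) | n U p m V q v g W.
      (n, U, p) \<in> pointed_plots D x \<and> (m, V, q) \<in> pointed_plots D x \<and>
      v \<in> topspace (Euclidean_space n) \<and>
      openin (Euclidean_space n) W \<and> 0 \<in> W \<and> W \<subseteq> U \<and>
      smooth_on n W m g \<and> g ` W \<subseteq> V \<and> g 0 = 0 \<and> (\<forall>w\<in>W. p w = q (g w))}"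

definition internal_tangent_space ::
    "'x plot set \<Rightarrow> 'x \<Rightarrow> ('x plot \<Rightarrow> nat \<Rightarrow> real) set vec_space"
  where "internal_tangent_space D x = quotient_space (tangent_sum D x) (tangent_relations D x)"


section \<open>Smooth maps and tangent spaces of manifolds\<close>

definition smooth_map :: "'a manifold \<Rightarrow> 'b manifold \<Rightarrow> ('a \<Rightarrow> 'b) \<Rightarrow> bool"
  where "smooth_map M N f \<longleftrightarrow>
    (\<forall>(n, U, \<phi>)\<in>atlas M.
      (n, \<phi> ` U, restrict (f \<circ> inv_into U \<phi>) (\<phi> ` U)) \<in> standard_diffeology N)"

text \<open>Smooth curves through \<open>x\<close> with values in a subset \<open>S\<close>, parametrized by a neighbourhood of
  \<open>0\<close> in \<open>\<real>\<^sup>1\<close>.\<close>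

definition curves_in :: "'a manifold \<Rightarrow> 'a set \<Rightarrow> 'a \<Rightarrow> ((nat \<Rightarrow> real) \<Rightarrow> 'a) set"
  where "curves_in M S x =
    {\<gamma>. \<exists>U. (1, U, \<gamma>) \<in> standard_diffeology M \<and> 0 \<in> U \<and> \<gamma> 0 = x \<and> \<gamma> ` U \<subseteq> S}"

text \<open>A tangent vector is an equivalence class of curves having the same derivative at \<open>0\<close> in
  every chart. The class is represented by the family of these derivatives, indexed by the
  charts of the atlas around the point (and \<open>0\<close> at the other charts); thus the vector space
  operations are the pointwise ones.\<close>

definition velocity :: "'a manifold \<Rightarrow> ((nat \<Rightarrow> real) \<Rightarrow> 'a) \<Rightarrow> 'a chart \<Rightarrow> nat \<Rightarrow> real"
  where "velocity M \<gamma> = (\<lambda>(n, U, \<phi>) i.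
    if (n, U, \<phi>) \<in> atlas M \<and> \<gamma> 0 \<in> U then partial 0 (\<lambda>t. \<phi> (\<gamma> t) i) 0 else 0)"

text \<open>For an (embedded) submanifold \<open>S\<close> of \<open>M\<close>, the smooth curves in \<open>S\<close> are the smooth curves
  in \<open>M\<close> with values in \<open>S\<close>; \<open>tangent_space M S x\<close> is \<open>T\<^sub>x S\<close> as a subspace of \<open>T\<^sub>x M\<close>.\<close>

definition tangent_space :: "'a manifold \<Rightarrow> 'a set \<Rightarrow> 'a \<Rightarrow> ('a chart \<Rightarrow> nat \<Rightarrow> real) set"
  where "tangent_space M S x = velocity M ` curves_in M S x"

definition differential ::
    "'a manifold \<Rightarrow> 'b manifold \<Rightarrow> ('a \<Rightarrow> 'b) \<Rightarrow> 'a \<Rightarrow> ('a chart \<Rightarrow> nat \<Rightarrow> real) \<Rightarrow> 'b chart \<Rightarrow> nat \<Rightarrow> real"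
  where "differential M N f x v =
    velocity N (f \<circ> (SOME \<gamma>. \<gamma> \<in> curves_in M (mcarrier M) x \<and> velocity M \<gamma> = v))"


section \<open>Lie group actions and slices\<close>

definition lie_group :: "('g, 'c) monoid_scheme \<Rightarrow> 'g manifold \<Rightarrow> bool"
  where "lie_group G \<G> \<longleftrightarrow>
    group G \<and> is_manifold \<G> \<and> mcarrier \<G> = carrier G \<and>
    smooth_map (product_manifold \<G> \<G>) \<G> (\<lambda>(g, h). g \<otimes>\<^bsub>G\<^esub> h) \<and>
    smooth_map \<G> \<G> (\<lambda>g. inv\<^bsub>G\<^esub> g)"

definition smooth_action ::
    "('g, 'c) monoid_scheme \<Rightarrow> 'g manifold \<Rightarrow> 'a manifold \<Rightarrow> ('g \<Rightarrow> 'a \<Rightarrow> 'a) \<Rightarrow> bool"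
  where "smooth_action G \<G> M A \<longleftrightarrow>
    group_action G (mcarrier M) A \<and> smooth_map (product_manifold \<G> M) M (\<lambda>(g, x). A g x)"

definition proper_action :: "'g manifold \<Rightarrow> 'a manifold \<Rightarrow> ('g \<Rightarrow> 'a \<Rightarrow> 'a) \<Rightarrow> bool"
  where "proper_action \<G> M A \<longleftrightarrow>
    proper_map (prod_topology (mtop \<G>) (mtop M)) (prod_topology (mtop M) (mtop M))
      (\<lambda>(g, x). (A g x, x))"

definition orbit_rel :: "('g, 'c) monoid_scheme \<Rightarrow> 'a set \<Rightarrow> ('g \<Rightarrow> 'a \<Rightarrow> 'a) \<Rightarrow> ('a \<times> 'a) set"
  where "orbit_rel G X A = {(x, y). x \<in> X \<and> y \<in> orbit G A x}"

definition stabilizer_group ::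
    "('g, 'c) monoid_scheme \<Rightarrow> ('g \<Rightarrow> 'a \<Rightarrow> 'a) \<Rightarrow> 'a \<Rightarrow> ('g, 'c) monoid_scheme"
  where "stabilizer_group G A x = G\<lparr>carrier := stabilizer G A x\<rparr>"

definition orbit_tangent_space ::
    "('g, 'c) monoid_scheme \<Rightarrow> 'g manifold \<Rightarrow> 'a manifold \<Rightarrow> ('g \<Rightarrow> 'a \<Rightarrow> 'a) \<Rightarrow> 'a \<Rightarrow>
      ('a chart \<Rightarrow> nat \<Rightarrow> real) set"
  where "orbit_tangent_space G \<G> M A x =
    differential \<G> M (\<lambda>g. A g x) \<one>\<^bsub>G\<^esub> ` tangent_space \<G> (mcarrier \<G>) \<one>\<^bsub>G\<^esub>"

definition slice ::
    "('g, 'c) monoid_scheme \<Rightarrow> 'g manifold \<Rightarrow> 'a manifold \<Rightarrow> ('g \<Rightarrow> 'a \<Rightarrow> 'a) \<Rightarrow> 'a \<Rightarrow> 'a set \<Rightarrow> bool"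
  where "slice G \<G> M A x\<^sub>0 S \<longleftrightarrow>
    submanifold M S \<and> x\<^sub>0 \<in> S \<and>
    orbit_tangent_space G \<G> M A x\<^sub>0 \<inter> tangent_space M S x\<^sub>0 = {0} \<and>
    (\<forall>x\<in>S. tangent_space M (mcarrier M) x =
      {a + b | a b. a \<in> orbit_tangent_space G \<G> M A x \<and> b \<in> tangent_space M S x}) \<and>
    (\<forall>k\<in>stabilizer G A x\<^sub>0. \<forall>x\<in>S. A k x \<in> S) \<and>
    (\<forall>g\<in>carrier G. \<forall>x\<in>S. A g x \<in> S \<longrightarrow> g \<in> stabilizer G A x\<^sub>0)"

definition tangent_action ::
    "'a manifold \<Rightarrow> ('g \<Rightarrow> 'a \<Rightarrow> 'a) \<Rightarrow> 'a set \<Rightarrow> 'a \<Rightarrow> 'g \<Rightarrow>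
      ('a chart \<Rightarrow> nat \<Rightarrow> real) \<Rightarrow> 'a chart \<Rightarrow> nat \<Rightarrow> real"
  where "tangent_action M A S x k = restrict (differential M M (A k) x) (tangent_space M S x)"

definition compact_linear_action ::
    "('g, 'c) monoid_scheme \<Rightarrow> 'g topology \<Rightarrow>
      ('i \<Rightarrow> nat \<Rightarrow> real) set \<Rightarrow> ('g \<Rightarrow> ('i \<Rightarrow> nat \<Rightarrow> real) \<Rightarrow> 'i \<Rightarrow> nat \<Rightarrow> real) \<Rightarrow> bool"
  where "compact_linear_action K X V \<rho> \<longleftrightarrow>
    compactin X (carrier K) \<and> subspace V \<and> group_action K V \<rho> \<and>
    (\<forall>k\<in>carrier K. linear_on V (\<rho> k)) \<and>
    continuous_map (prod_topology (subtopology X (carrier K)) (top_of_set V)) (top_of_set V)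
      (\<lambda>(k, v). \<rho> k v)"

end

theory Submission
  imports Defs
begin

text \<open>
  The internal tangent space at \<open>[x]\<close> of a quotient of a manifold is the tangent space at \<open>x\<close> modulo
  the differences \<open>c\<^sub>1'(0) - c\<^sub>2'(0)\<close> of derivatives of smooth germs through \<open>x\<close> that agree in the
  quotient. Let \<open>K\<close> be the stabilizer of \<open>x\<^sub>0\<close> and \<open>V = T\<^sub>x\<^sub>0 S\<close>. In the quotient of \<open>V\<close> by \<open>K\<close> these differences
  span \<open>N = span {k v - v}\<close>, because a \<open>K\<close>-invariant linear functional is constant on orbits. In the orbit
  space of \<open>M\<close> they span the direct sum of the tangent space \<open>T\<close> of the orbit and of \<open>N\<close>. As \<open>T \<oplus> V\<close> is the
  tangent space of \<open>M\<close>, both internal tangent spaces are isomorphic to \<open>V / N\<close>; an equivariant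
  linearization of the slice is not needed.

  The analytic point is that a \<open>K\<close>-invariant functional \<open>f\<close> on \<open>V\<close>, extended by zero on \<open>T\<close>, agrees on
  \<open>c\<^sub>1'(0)\<close> and \<open>c\<^sub>2'(0)\<close> if \<open>c\<^sub>1(t)\<close> and \<open>c\<^sub>2(t)\<close> lie in the same orbit for all \<open>t\<close>. Picard iteration yields
  \<open>c\<^sub>i(t) = g\<^sub>i(t) s\<^sub>i(t)\<close> with \<open>s\<^sub>i(t) \<in> S\<close>, where \<open>g\<^sub>i(t)\<close> and \<open>s\<^sub>i(t)\<close> are \<open>O(t)\<close>-close to \<open>1\<close> and \<open>x\<^sub>0\<close>, without any regularity
  in \<open>t\<close>. The slice property gives \<open>s\<^sub>2(t) = k\<^sub>t s\<^sub>1(t)\<close> with \<open>k\<^sub>t \<in> K\<close>, and by compactness of \<open>K\<close> the functional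
  changes only by \<open>o(t)\<close> under \<open>k\<^sub>t\<close>, uniformly in \<open>k\<^sub>t\<close>.
\<close>

section \<open>Calculus on open subsets of Euclidean spaces\<close>

text \<open>The element of \<open>K\<close> that joins s_1(t) to s_2(t) is unique only up to the
  isotropy of s_1(t) and may jump with t, so the relation between the two curves cannot be
  differentiated. Testing with invariant functionals removes this element before the limit is taken.
  In the quotient of the vector space the removal is exact, because \<open>K\<close> acts linearly;
  in the slice it is exact only to first order. The converse inclusions come from explicit pairs of
  germs: the orbit map against the constant germ gives T, and the action of k against the identity
  gives k v - v. Both internal tangent spaces are compared through linear maps into one space, that
  of functions on the invariant functionals. The kernels of these maps are the relations and their
  images coincide; no map between the two direct sums is constructed. The reduction from all plots
  to a single chart rests on local lifts of plots of a quotient, translated so that they start at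
  the base point.\<close>

abbreviation Rn :: "nat \<Rightarrow> (nat \<Rightarrow> real) set"
  where "Rn n \<equiv> topspace (Euclidean_space n)"

text \<open>Cubes are the neighbourhood basis used throughout. Changing one coordinate at a time
  leads from one point of a cube to another without leaving it, which serves the mean value
  argument, and a cube around 0 is connected, as the domain of a pointed plot must be.\<close>

definition cube :: "nat \<Rightarrow> (nat \<Rightarrow> real) \<Rightarrow> real \<Rightarrow> (nat \<Rightarrow> real) set"
  where "cube n a r = {x \<in> Rn n. \<forall>i<n. \<bar>x i - a i\<bar> < r}"

lemma openin_Rn_iff: "openin (Euclidean_space n) U \<longleftrightarrow> openin (top_of_set (Rn n)) U"
  by (simp add: Euclidean_space_def euclidean_product_topology)

lemma Euclidean_space_top_of_set: "Euclidean_space n = top_of_set (Rn n)"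
  by (simp add: Euclidean_space_def euclidean_product_topology)

lemma Rn_upd: "x \<in> Rn n \<Longrightarrow> i < n \<Longrightarrow> x(i := t) \<in> Rn n"
  by (auto simp: topspace_Euclidean_space)

lemma zero_in_Rn [simp]: "0 \<in> Rn n"
  by (simp add: topspace_Euclidean_space)

lemma Rn_add: "x \<in> Rn n \<Longrightarrow> y \<in> Rn n \<Longrightarrow> x + y \<in> Rn n"
  by (simp add: topspace_Euclidean_space)

lemma Rn_diff: "x \<in> Rn n \<Longrightarrow> y \<in> Rn n \<Longrightarrow> x - y \<in> Rn n"
  by (simp add: topspace_Euclidean_space)

lemma Rn_scaleR: "x \<in> Rn n \<Longrightarrow> c *\<^sub>R x \<in> Rn n"
  by (simp add: topspace_Euclidean_space scaleR_fun_def)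

lemma subspace_Rn: "subspace (Rn n)"
  by (simp add: subspace_def Rn_add Rn_scaleR)

lemma openin_Rn [simp]: "openin (Euclidean_space n) (Rn n)"
  by (rule openin_topspace)

lemma openin_cube: "openin (Euclidean_space n) (cube n a r)"
proof -
  have "open (\<Inter>i<n. {x::nat\<Rightarrow>real. \<bar>x i - a i\<bar> < r})"
    by (intro open_INT) (auto intro!: open_Collect_less continuous_intros)
  moreover have "cube n a r = Rn n \<inter> (\<Inter>i<n. {x. \<bar>x i - a i\<bar> < r})"
    by (auto simp: cube_def)
  ultimately show ?thesis
    by (auto simp: openin_Rn_iff openin_open)
qed

lemma cube_subset_Rn: "cube n a r \<subseteq> Rn n"
  by (auto simp: cube_def)

lemma centre_in_cube: "a \<in> Rn n \<Longrightarrow> 0 < r \<Longrightarrow> a \<in> cube n a r"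
  by (auto simp: cube_def)

lemma cube_mono: "r \<le> s \<Longrightarrow> cube n a r \<subseteq> cube n a s"
  by (force simp: cube_def)

lemma openin_Rn_subset: "openin (Euclidean_space n) U \<Longrightarrow> U \<subseteq> Rn n"
  by (rule openin_subset)

lemma cube_in_open:
  assumes "openin (Euclidean_space n) U" "a \<in> U"
  obtains r where "r > 0" "cube n a r \<subseteq> U"
proof -
  obtain T where T: "open T" "U = Rn n \<inter> T"
    using assms by (auto simp: openin_Rn_iff openin_open)
  have "openin (product_topology (\<lambda>i. euclidean) UNIV) T"
    using T by (simp add: euclidean_product_topology)
  from product_topology_open_contains_basis[OF this, of a] assms T
  obtain X where X: "a \<in> (\<Pi>\<^sub>E i\<in>UNIV. X i)" "\<And>i. open (X i)" "(\<Pi>\<^sub>E i\<in>UNIV. X i) \<subseteq> T"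
    "finite {i. X i \<noteq> (UNIV::real set)}"
    by auto
  have "\<exists>e>0. ball (a i) e \<subseteq> X i" for i
    using X by (meson PiE_mem UNIV_I openE)
  then obtain e where e: "\<And>i. e i > 0" "\<And>i. ball (a i) (e i) \<subseteq> X i"
    by metis
  define I where "I = {i. X i \<noteq> UNIV}"
  \<comment> \<open>A basic open set of the product topology restricts only the coordinates in the
    finite set \<open>I\<close>; the inserted 1 covers an empty \<open>I\<close>.\<close>
  define r where "r = Min (insert 1 (e ` I))"
  have r: "r > 0" "\<And>i. i \<in> I \<Longrightarrow> r \<le> e i"
    using e X(4) by (auto simp: r_def I_def)
  have aR: "a \<in> Rn n"
    using assms openin_Rn_subset by blast
  have "cube n a r \<subseteq> U"
  proof
    fix x assume x: "x \<in> cube n a r"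
    have "x i \<in> X i" for i
    proof (cases "i \<in> I")
      case True
      have "\<bar>x i - a i\<bar> < r"
        using x r(1) aR by (cases "i < n") (auto simp: cube_def topspace_Euclidean_space)
      then have "x i \<in> ball (a i) (e i)"
        using r(2)[OF True] by (simp add: dist_real_def abs_minus_commute)
      then show ?thesis
        using e(2) by blast
    qed (auto simp: I_def)
    then have "x \<in> T"
      using X(3) by (auto simp: PiE_def)
    then show "x \<in> U"
      using x T by (auto simp: cube_def)
  qed
  with r show ?thesis using that by blast
qed

lemma continuous_on_cube:
  fixes f :: "(nat \<Rightarrow> real) \<Rightarrow> real"
  assumes "openin (Euclidean_space n) U" "continuous_on U f" "a \<in> U" "e > 0"
  obtains r where "r > 0" "cube n a r \<subseteq> U" "\<And>x. x \<in> cube n a r \<Longrightarrow> \<bar>f x - f a\<bar> < e"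
proof -
  have "openin (top_of_set U) (U \<inter> f -` ball (f a) e)"
    using assms by (simp add: continuous_openin_preimage_gen)
  then have "openin (Euclidean_space n) (U \<inter> f -` ball (f a) e)"
    using assms(1) openin_Rn_iff openin_trans by blast
  then obtain r where "r > 0" "cube n a r \<subseteq> U \<inter> f -` ball (f a) e"
    using cube_in_open[of n _ a] assms by (metis IntI centre_in_ball vimage_eq)
  then show ?thesis
    by (intro that[of r]) (auto simp: dist_real_def abs_minus_commute)
qed

lemma eventually_in_open:
  fixes c :: "'b \<Rightarrow> nat \<Rightarrow> real"
  assumes "openin (Euclidean_space n) U" "a \<in> U" "\<forall>\<^sub>F s in F. c s \<in> Rn n"
    and lim: "\<And>i. i < n \<Longrightarrow> ((\<lambda>s. c s i) \<longlongrightarrow> a i) F"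
  shows "\<forall>\<^sub>F s in F. c s \<in> U"
proof -
  obtain r where r: "r > 0" "cube n a r \<subseteq> U"
    using cube_in_open assms by blast
  have "\<forall>\<^sub>F s in F. \<forall>i\<in>{..<n}. \<bar>c s i - a i\<bar> < r"
    using tendstoD[OF lim r(1)] by (intro eventually_ball_finite) (auto simp: dist_real_def)
  with assms(3) show ?thesis
    by eventually_elim (use r in \<open>auto simp: cube_def\<close>)
qed

lemma eventually_upd_in_open:
  assumes "openin (Euclidean_space n) U" "x \<in> U" "i < n"
  shows "\<forall>\<^sub>F t in nhds (x i). x(i := t) \<in> U"
proof (rule eventually_in_open[OF assms(1,2)])
  show "\<forall>\<^sub>F t in nhds (x i). x(i := t) \<in> Rn n"
    using Rn_upd[OF subsetD[OF openin_Rn_subset[OF assms(1)] assms(2)] assms(3)] by simp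
next
  fix j assume "j < n"
  show "((\<lambda>t. (x(i := t)) j) \<longlongrightarrow> x j) (nhds (x i))"
    by (cases "j = i") (auto simp: filterlim_ident)
qed

section \<open>Iterated partial derivatives and smooth functions\<close>

lemma partial_cong:
  assumes "openin (Euclidean_space n) U" "x \<in> U" "i < n" "\<And>y. y \<in> U \<Longrightarrow> f y = g y"
  shows "partial i f x = partial i g x"
  unfolding partial_def
  by (rule deriv_cong_ev[OF eventually_mono[OF eventually_upd_in_open[OF assms(1-3)]] refl]) (rule assms(4))

lemma upd_field_differentiable_cong:
  assumes "openin (Euclidean_space n) U" "x \<in> U" "i < n" "\<And>y. y \<in> U \<Longrightarrow> f y = g y"
    and "(\<lambda>t. f (x(i := t))) field_differentiable (at (x i))"
  shows "(\<lambda>t. g (x(i := t))) field_differentiable (at (x i))"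
proof -
  have ev: "\<forall>\<^sub>F t in nhds (x i). f (x(i := t)) = g (x(i := t))"
    by (rule eventually_mono[OF eventually_upd_in_open[OF assms(1-3)]]) (rule assms(4))
  obtain D where D: "((\<lambda>t. f (x(i := t))) has_real_derivative D) (at (x i))"
    using assms(5) by (auto simp: field_differentiable_def)
  have "((\<lambda>t. g (x(i := t))) has_real_derivative D) (at (x i))"
    by (rule iffD1[OF DERIV_cong_ev[OF refl ev refl] D])
  then show ?thesis
    by (auto simp: field_differentiable_def)
qed

lemma has_real_derivative_partial:
  "(\<lambda>t. f (x(i := t))) field_differentiable (at (x i)) \<Longrightarrow>
    ((\<lambda>t. f (x(i := t))) has_real_derivative partial i f x) (at (x i))"
  unfolding partial_def using DERIV_deriv_iff_field_differentiable by blast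

lemma partial_eqI:
  "((\<lambda>t. f (x(i := t))) has_real_derivative D) (at (x i)) \<Longrightarrow> partial i f x = D"
  unfolding partial_def by (rule DERIV_imp_deriv)

lemma partials_append: "partials (is @ js) f = partials is (partials js f)"
  by (induction "is") auto

lemma smooth_fun_continuous: "smooth_fun n U f \<Longrightarrow> continuous_on U f"
  unfolding smooth_fun_def by (metis empty_set empty_subsetI partials.simps(1))

lemma smooth_fun_differentiable:
  "smooth_fun n U f \<Longrightarrow> i < n \<Longrightarrow> x \<in> U \<Longrightarrow> (\<lambda>t. f (x(i := t))) field_differentiable (at (x i))"
  unfolding smooth_fun_def by (metis empty_set empty_subsetI partials.simps(1))

lemma smooth_fun_partial: "smooth_fun n U f \<Longrightarrow> i < n \<Longrightarrow> smooth_fun n U (partial i f)"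
proof -
  assume f: "smooth_fun n U f" and i: "i < n"
  have "partials is (partial i f) = partials (is @ [i]) f" for "is"
    by (simp add: partials_append)
  moreover have "set is \<subseteq> {..<n} \<Longrightarrow> set (is @ [i]) \<subseteq> {..<n}" for "is"
    using i by auto
  ultimately show ?thesis
    using f unfolding smooth_fun_def by metis
qed

lemma smooth_fun_subset: "smooth_fun n U f \<Longrightarrow> V \<subseteq> U \<Longrightarrow> smooth_fun n V f"
  unfolding smooth_fun_def by (meson continuous_on_subset subset_iff)

text \<open>Smooth functions form the largest class of continuous functions that have all first
  partial derivatives, these lying in the class again. Membership is tested on a function
  \<open>h\<close> that agrees with the partial derivative on \<open>U\<close>, because nothing is
  known about values outside \<open>U\<close>.\<close>

lemma smooth_fun_coinduct:
  assumes "openin (Euclidean_space n) U" "P f"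
    and step: "\<And>f. P f \<Longrightarrow> continuous_on U f \<and> (\<forall>i<n.
        (\<forall>x\<in>U. (\<lambda>t. f (x(i := t))) field_differentiable (at (x i))) \<and>
        (\<exists>h. P h \<and> (\<forall>x\<in>U. partial i f x = h x)))"
  shows "smooth_fun n U f"
  unfolding smooth_fun_def
proof (intro allI impI)
  fix "is" :: "nat list" assume "set is \<subseteq> {..<n}"
  then have "\<exists>h. P h \<and> (\<forall>x\<in>U. partials is f x = h x)"
  proof (induction "is")
    case Nil then show ?case using assms(2) by auto
  next
    case (Cons i "is")
    then obtain h where h: "P h" "\<forall>x\<in>U. partials is f x = h x" by auto
    obtain h' where "P h'" "\<forall>x\<in>U. partial i h x = h' x"
      using step[OF h(1)] Cons.prems by auto
    moreover have "partial i (partials is f) x = partial i h x" if "x \<in> U" for x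
      by (rule partial_cong[OF assms(1) that]) (use Cons.prems h in auto)
    ultimately show ?case by auto
  qed
  then obtain h where h: "P h" "\<forall>x\<in>U. partials is f x = h x" by blast
  show "continuous_on U (partials is f) \<and>
    (\<forall>i<n. \<forall>x\<in>U. (\<lambda>t. partials is f (x(i := t))) field_differentiable (at (x i)))"
  proof (intro conjI allI impI ballI)
    show "continuous_on U (partials is f)"
      using continuous_on_cong[OF refl, of U "partials is f" h] step[OF h(1)] h(2) by blast
    fix i x assume ix: "i < n" "x \<in> U"
    then have "(\<lambda>t. h (x(i := t))) field_differentiable (at (x i))"
      using step[OF h(1)] by blast
    moreover have "h y = partials is f y" if "y \<in> U" for y
      using h(2) that by simp
    ultimately show "(\<lambda>t. partials is f (x(i := t))) field_differentiable (at (x i))"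
      using upd_field_differentiable_cong[OF assms(1) ix(2,1)] by blast
  qed
qed

lemma smooth_fun_cong:
  assumes "openin (Euclidean_space n) U" "smooth_fun n U f" "\<And>x. x \<in> U \<Longrightarrow> f x = g x"
  shows "smooth_fun n U g"
proof (rule smooth_fun_coinduct[OF assms(1), where P = "\<lambda>g. \<exists>f. smooth_fun n U f \<and> (\<forall>x\<in>U. f x = g x)"])
  fix g assume "\<exists>f. smooth_fun n U f \<and> (\<forall>x\<in>U. f x = g x)"
  then obtain f where f: "smooth_fun n U f" "\<And>x. x \<in> U \<Longrightarrow> f x = g x" by auto
  have c: "continuous_on U g"
    using continuous_on_cong[OF refl, of U f g] smooth_fun_continuous[OF f(1)] f(2) by blast
  have d: "(\<lambda>t. g (x(i := t))) field_differentiable (at (x i))" if "x \<in> U" "i < n" for x i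
    by (rule upd_field_differentiable_cong[OF assms(1) that f(2) smooth_fun_differentiable[OF f(1) that(2,1)]])
  have p: "partial i f x = partial i g x" if "x \<in> U" "i < n" for x i
    by (rule partial_cong[OF assms(1) that f(2)])
  show "continuous_on U g \<and> (\<forall>i<n.
      (\<forall>x\<in>U. (\<lambda>t. g (x(i := t))) field_differentiable at (x i)) \<and>
      (\<exists>h. (\<exists>f. smooth_fun n U f \<and> (\<forall>x\<in>U. f x = h x)) \<and> (\<forall>x\<in>U. partial i g x = h x)))"
  proof (intro conjI allI impI ballI c)
    fix i assume "i < n"
    with p have "\<forall>x\<in>U. partial i f x = partial i g x" by blast
    with smooth_fun_partial[OF f(1) \<open>i < n\<close>]
    show "\<exists>h. (\<exists>f. smooth_fun n U f \<and> (\<forall>x\<in>U. f x = h x)) \<and> (\<forall>x\<in>U. partial i g x = h x)"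
      by blast
  qed (rule d)
qed (use assms in blast)

lemma continuous_on_locally:
  fixes f :: "'a::metric_space \<Rightarrow> 'b::metric_space"
  assumes "\<And>x. x \<in> U \<Longrightarrow> \<exists>V. openin (top_of_set X) V \<and> x \<in> V \<and> continuous_on V f" "U \<subseteq> X"
  shows "continuous_on U f"
  unfolding continuous_on_eq_continuous_within
proof
  fix x assume "x \<in> U"
  then obtain V where V: "openin (top_of_set X) V" "x \<in> V" "continuous_on V f"
    using assms by blast
  then obtain T where T: "open T" "V = X \<inter> T"
    by (auto simp: openin_open)
  have "continuous (at x within V) f"
    using V by (simp add: continuous_on_eq_continuous_within)
  moreover have "at x within V = at x within X"
    by (rule at_within_nhd[of x T]) (use V T in auto)
  ultimately show "continuous (at x within U) f"
    using continuous_within_subset assms(2) by metis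
qed

text \<open>The value of \<open>partials\<close> at a point does not refer to the domain, so both
  requirements of smoothness are local.\<close>

lemma smooth_fun_locally:
  assumes "\<And>x. x \<in> U \<Longrightarrow> \<exists>V. openin (Euclidean_space n) V \<and> x \<in> V \<and> smooth_fun n V f" "U \<subseteq> Rn n"
  shows "smooth_fun n U f"
  unfolding smooth_fun_def
proof (intro allI impI conjI ballI)
  fix "is" assume is': "set is \<subseteq> {..<n}"
  show "continuous_on U (partials is f)"
  proof (rule continuous_on_locally[OF _ assms(2)])
    fix x assume "x \<in> U"
    from assms(1)[OF this] show "\<exists>V. openin (top_of_set (Rn n)) V \<and> x \<in> V \<and> continuous_on V (partials is f)"
      using is' unfolding smooth_fun_def openin_Rn_iff by blast
  qed
  fix i x assume "i < n" "x \<in> U"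
  with assms(1)[OF this(2)] show "(\<lambda>t. partials is f (x(i := t))) field_differentiable (at (x i))"
    using is' unfolding smooth_fun_def by blast
qed

lemma smooth_fun_const: "smooth_fun n U (\<lambda>x. c)" if "openin (Euclidean_space n) U"
proof (rule smooth_fun_coinduct[OF that, where P = "\<lambda>f. \<exists>c. f = (\<lambda>x. c)"])
  fix f :: "(nat \<Rightarrow> real) \<Rightarrow> real" assume "\<exists>c. f = (\<lambda>x. c)"
  then obtain c where f: "f = (\<lambda>x. c)" by auto
  have "partial i f x = 0" for i x
    by (rule partial_eqI) (simp add: f)
  then show "continuous_on U f \<and> (\<forall>i<n.
      (\<forall>x\<in>U. (\<lambda>t. f (x(i := t))) field_differentiable at (x i)) \<and>
      (\<exists>h. (\<exists>c. h = (\<lambda>x. c)) \<and> (\<forall>x\<in>U. partial i f x = h x)))"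
    by (auto simp: f)
qed auto

lemma smooth_fun_coordinate: "smooth_fun n U (\<lambda>x. x j)" if "openin (Euclidean_space n) U"
\<comment> \<open>After one derivative a coordinate becomes a constant, so the class consists of the
  coordinate and of functions already known to be smooth.\<close>
proof (rule smooth_fun_coinduct[OF that, where P = "\<lambda>f. f = (\<lambda>x. x j) \<or> smooth_fun n U f"])
  fix f :: "(nat \<Rightarrow> real) \<Rightarrow> real" assume "f = (\<lambda>x. x j) \<or> smooth_fun n U f"
  then show "continuous_on U f \<and> (\<forall>i<n.
      (\<forall>x\<in>U. (\<lambda>t. f (x(i := t))) field_differentiable at (x i)) \<and>
      (\<exists>h. (h = (\<lambda>x. x j) \<or> smooth_fun n U h) \<and> (\<forall>x\<in>U. partial i f x = h x)))"
  proof
    assume f: "f = (\<lambda>x. x j)"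
    have d: "((\<lambda>t. f (x(i := t))) has_real_derivative (if i = j then 1 else 0)) (at (x i))" for i x
      by (auto simp: f)
    have p: "partial i f x = (if i = j then 1 else 0)" for i x
      by (rule partial_eqI[OF d])
    have c: "continuous_on U f"
      unfolding f by (rule continuous_on_subset[OF continuous_on_product_coordinates]) auto
    show ?thesis
    proof (intro conjI allI impI ballI c)
      fix i x
      show "(\<lambda>t. f (x(i := t))) field_differentiable at (x i)"
        using d field_differentiable_def by blast
      show "\<exists>h. (h = (\<lambda>x. x j) \<or> smooth_fun n U h) \<and> (\<forall>x\<in>U. partial i f x = h x)"
        using smooth_fun_const[OF that, of "if i = j then 1 else 0"] p by blast
    qed
  next
    assume f: "smooth_fun n U f"
    then show ?thesis
      using smooth_fun_continuous[OF f] smooth_fun_differentiable[OF f] smooth_fun_partial[OF f] by blast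
  qed
qed auto

text \<open>Telescoping over the path that replaces the coordinates of \<open>x\<close> by those of
  \<open>y\<close> one after the other. Each step is the mean value theorem in one variable, hence a
  separate point \<open>\<xi> i\<close> for each coordinate.\<close>

lemma mean_value_cube:
  fixes f :: "(nat \<Rightarrow> real) \<Rightarrow> real"
  assumes diff: "\<And>x i. x \<in> cube n a r \<Longrightarrow> i < n \<Longrightarrow> (\<lambda>t. f (x(i := t))) field_differentiable (at (x i))"
    and x: "x \<in> cube n a r" and y: "y \<in> cube n a r"
  shows "\<exists>\<xi>. (\<forall>i<n. \<xi> i \<in> cube n a r) \<and> f y - f x = (\<Sum>i<n. partial i f (\<xi> i) * (y i - x i))"
proof -
  define z where "z j = (\<lambda>i. if i < j then y i else x i)" for j
  have z0: "z 0 = x" and zn: "z n = y"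
    using x y by (auto simp: z_def cube_def topspace_Euclidean_space fun_eq_iff)
  have zS: "z (Suc j) = (z j)(j := y j)" for j
    by (auto simp: z_def fun_eq_iff)
  have "\<exists>\<zeta>\<in>cube n a r. f (z (Suc j)) - f (z j) = partial j f \<zeta> * (y j - x j)" if j: "j < n" for j
  proof -
    have seg: "(z j)(j := t) \<in> cube n a r" if "min (x j) (y j) \<le> t" "t \<le> max (x j) (y j)" for t
    proof -
      have "\<bar>t - a j\<bar> < r"
        using x y j that unfolding cube_def by (smt (verit, best) mem_Collect_eq)
      then show ?thesis
        using x y j by (auto simp: cube_def z_def topspace_Euclidean_space)
    qed
    define h where "h t = f ((z j)(j := t))" for t
    have D: "(h has_real_derivative partial j f ((z j)(j := t))) (at t)"
      if "min (x j) (y j) \<le> t" "t \<le> max (x j) (y j)" for t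
      using has_real_derivative_partial[OF diff[OF seg[OF that] j]]
      unfolding h_def[abs_def] by (simp only: fun_upd_upd fun_upd_same)
    have zj: "z j = (z j)(j := x j)"
      by (auto simp: z_def fun_eq_iff)
    have e: "f (z (Suc j)) - f (z j) = h (y j) - h (x j)"
      unfolding h_def zS using zj by metis
    consider "x j < y j" | "y j < x j" | "x j = y j" by linarith
    then show ?thesis
    proof cases
      case 1
      then obtain t where "x j < t" "t < y j" "h (y j) - h (x j) = (y j - x j) * partial j f ((z j)(j := t))"
        using MVT2[of "x j" "y j" h "\<lambda>t. partial j f ((z j)(j := t))"] D by auto
      then show ?thesis using e seg 1 by (intro bexI[of _ "(z j)(j := t)"]) (auto simp: algebra_simps)
    next
      case 2
      then obtain t where "y j < t" "t < x j" "h (x j) - h (y j) = (x j - y j) * partial j f ((z j)(j := t))"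
        using MVT2[of "y j" "x j" h "\<lambda>t. partial j f ((z j)(j := t))"] D by auto
      then show ?thesis using e seg 2 by (intro bexI[of _ "(z j)(j := t)"]) (auto simp: algebra_simps)
    next
      case 3
      then show ?thesis using e x by (intro bexI[of _ x]) auto
    qed
  qed
  then obtain \<xi> where \<xi>: "\<And>j. j < n \<Longrightarrow> \<xi> j \<in> cube n a r"
    "\<And>j. j < n \<Longrightarrow> f (z (Suc j)) - f (z j) = partial j f (\<xi> j) * (y j - x j)"
    by metis
  have "f y - f x = (\<Sum>j<n. f (z (Suc j)) - f (z j))"
    using sum_lessThan_telescope[of "\<lambda>j. f (z j)" n] by (simp add: z0 zn)
  then show ?thesis
    using \<xi> by (auto intro!: exI[of _ \<xi>])
qed

text \<open>By continuity the partial derivatives are within \<open>e\<close> of their values at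
  \<open>a\<close> on a small cube, and the mean value formula does the rest. Both \<open>x\<close>
  and \<open>y\<close> vary: this makes the Picard map a contraction and makes estimates uniform in
  further variables, neither of which follows from differentiability at \<open>a\<close>
  alone.\<close>

lemma strict_differentiability:
  assumes U: "openin (Euclidean_space n) U" and f: "smooth_fun n U f" and a: "a \<in> U" and e: "e > 0"
  shows "\<exists>r>0. cube n a r \<subseteq> U \<and> (\<forall>x\<in>cube n a r. \<forall>y\<in>cube n a r.
      \<bar>f y - f x - (\<Sum>i<n. partial i f a * (y i - x i))\<bar> \<le> e * (\<Sum>i<n. \<bar>y i - x i\<bar>))"
proof -
  have "\<exists>r>0. cube n a r \<subseteq> U \<and> (\<forall>x\<in>cube n a r. \<bar>partial i f x - partial i f a\<bar> < e)" if "i < n" for i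
    using continuous_on_cube[OF U smooth_fun_continuous[OF smooth_fun_partial[OF f that]] a e] by metis
  then obtain \<rho> where \<rho>: "\<And>i. i < n \<Longrightarrow> \<rho> i > 0"
    "\<And>i x. i < n \<Longrightarrow> x \<in> cube n a (\<rho> i) \<Longrightarrow> \<bar>partial i f x - partial i f a\<bar> < e"
    by metis
  obtain r0 where r0: "r0 > 0" "cube n a r0 \<subseteq> U"
    using cube_in_open[OF U a] by blast
  define r where "r = Min (insert r0 (\<rho> ` {..<n}))"
  have r: "r > 0" "r \<le> r0" "\<And>i. i < n \<Longrightarrow> r \<le> \<rho> i"
    using \<rho> r0 by (auto simp: r_def)
  have cU: "cube n a r \<subseteq> U"
    using r0 cube_mono[OF r(2)] by blast
  show ?thesis
  proof (intro exI[of _ r] conjI ballI r(1) cU)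
    fix x y assume xy: "x \<in> cube n a r" "y \<in> cube n a r"
    obtain \<xi> where \<xi>: "\<And>i. i < n \<Longrightarrow> \<xi> i \<in> cube n a r"
      "f y - f x = (\<Sum>i<n. partial i f (\<xi> i) * (y i - x i))"
      using mean_value_cube[of n a r f x y] xy smooth_fun_differentiable[OF f] cU by blast
    have "\<bar>f y - f x - (\<Sum>i<n. partial i f a * (y i - x i))\<bar>
        = \<bar>\<Sum>i<n. (partial i f (\<xi> i) - partial i f a) * (y i - x i)\<bar>"
      by (simp add: \<xi> sum_subtractf left_diff_distrib)
    also have "\<dots> \<le> (\<Sum>i<n. \<bar>(partial i f (\<xi> i) - partial i f a) * (y i - x i)\<bar>)"
      by (rule sum_abs)
    also have "\<dots> \<le> (\<Sum>i<n. e * \<bar>y i - x i\<bar>)"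
    proof (rule sum_mono)
      fix i assume "i \<in> {..<n}"
      then have "\<bar>partial i f (\<xi> i) - partial i f a\<bar> \<le> e"
        using \<xi>(1) \<rho>(2) r(3) cube_mono by (metis lessThan_iff less_imp_le subsetD)
      then show "\<bar>(partial i f (\<xi> i) - partial i f a) * (y i - x i)\<bar> \<le> e * \<bar>y i - x i\<bar>"
        by (simp add: abs_mult mult_right_mono)
    qed
    finally show "\<bar>f y - f x - (\<Sum>i<n. partial i f a * (y i - x i))\<bar> \<le> e * (\<Sum>i<n. \<bar>y i - x i\<bar>)"
      by (simp add: sum_distrib_left)
  qed
qed

lemma chain_rule_curve:
  assumes U: "openin (Euclidean_space n) U" and f: "smooth_fun n U f" and c0: "c s0 \<in> U"
    and cR: "\<forall>\<^sub>F s in at s0. c s \<in> Rn n"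
    and w: "\<And>i. i < n \<Longrightarrow> ((\<lambda>s. c s i) has_real_derivative w i) (at s0)"
  shows "((\<lambda>s. f (c s)) has_real_derivative (\<Sum>i<n. partial i f (c s0) * w i)) (at s0)"
proof -
  define q where "q i s = (c s i - c s0 i) / (s - s0)" for i s
  have q: "(q i \<longlongrightarrow> w i) (at s0)" if "i < n" for i
    using w[OF that] by (simp add: has_field_derivative_iff q_def[abs_def])
  \<comment> \<open>\<open>B\<close> bounds the difference quotients of \<open>c\<close> near
    \<open>s0\<close>, so accuracy \<open>e / B\<close> for \<open>f\<close> yields accuracy
    \<open>e\<close> for the quotient of the composition; the 1 makes \<open>B\<close> positive and
    the bound strict.\<close>
  define B where "B = (\<Sum>i<n. \<bar>w i\<bar>) + 1"
  have B: "B > 0"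
    by (simp add: B_def sum_nonneg add_nonneg_pos)
  have qB: "\<forall>\<^sub>F s in at s0. (\<Sum>i<n. \<bar>q i s\<bar>) < B"
  proof (rule order_tendstoD(2))
    show "((\<lambda>s. \<Sum>i<n. \<bar>q i s\<bar>) \<longlongrightarrow> (\<Sum>i<n. \<bar>w i\<bar>)) (at s0)"
      by (intro tendsto_sum tendsto_rabs q) auto
  qed (simp add: B_def)
  have diff0: "((\<lambda>s. (f (c s) - f (c s0)) / (s - s0) - (\<Sum>i<n. partial i f (c s0) * q i s)) \<longlongrightarrow> 0) (at s0)"
  proof (rule tendstoI)
    fix e :: real assume e: "e > 0"
    obtain r where r: "r > 0" "cube n (c s0) r \<subseteq> U"
      "\<And>x y. x \<in> cube n (c s0) r \<Longrightarrow> y \<in> cube n (c s0) r \<Longrightarrow>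
      \<bar>f y - f x - (\<Sum>i<n. partial i f (c s0) * (y i - x i))\<bar> \<le> e / B * (\<Sum>i<n. \<bar>y i - x i\<bar>)"
      using strict_differentiability[OF U f c0 divide_pos_pos[OF e B]] by blast
    have c0R: "c s0 \<in> cube n (c s0) r"
      using c0 openin_Rn_subset[OF U] centre_in_cube r by blast
    have "\<forall>\<^sub>F s in at s0. c s \<in> cube n (c s0) r"
    proof (rule eventually_in_open[OF openin_cube c0R cR])
      fix i assume "i < n"
      show "((\<lambda>s. c s i) \<longlongrightarrow> c s0 i) (at s0)"
        using DERIV_isCont[OF w[OF \<open>i < n\<close>]] by (simp add: isCont_def)
    qed
    moreover have "\<forall>\<^sub>F s in at s0. s \<noteq> s0"
      by (simp add: eventually_at_filter)
    ultimately show "\<forall>\<^sub>F s in at s0. dist ((f (c s) - f (c s0)) / (s - s0) - (\<Sum>i<n. partial i f (c s0) * q i s)) 0 < e"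
      using qB
    proof eventually_elim
      case (elim s)
      have "\<bar>(f (c s) - f (c s0)) / (s - s0) - (\<Sum>i<n. partial i f (c s0) * q i s)\<bar>
        = \<bar>f (c s) - f (c s0) - (\<Sum>i<n. partial i f (c s0) * (c s i - c s0 i))\<bar> / \<bar>s - s0\<bar>"
      proof -
        have "(\<Sum>i<n. partial i f (c s0) * q i s) = (\<Sum>i<n. partial i f (c s0) * (c s i - c s0 i)) / (s - s0)"
          by (simp add: q_def sum_divide_distrib)
        then show ?thesis
          by (simp only: abs_divide[symmetric] diff_divide_distrib[symmetric])
      qed
      also have "\<dots> \<le> (e / B * (\<Sum>i<n. \<bar>c s i - c s0 i\<bar>)) / \<bar>s - s0\<bar>"
        using r(3)[OF c0R elim(1)] by (rule divide_right_mono) simp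
      also have "\<dots> = e / B * (\<Sum>i<n. \<bar>q i s\<bar>)"
        by (simp add: q_def flip: sum_divide_distrib)
      also have "\<dots> < e / B * B"
        using elim e B by (intro mult_strict_left_mono) auto
      finally show ?case using B by simp
    qed
  qed
  have lim: "((\<lambda>s. \<Sum>i<n. partial i f (c s0) * q i s) \<longlongrightarrow> (\<Sum>i<n. partial i f (c s0) * w i)) (at s0)"
    by (intro tendsto_sum tendsto_mult tendsto_const q) auto
  show ?thesis
    unfolding has_field_derivative_iff using tendsto_add[OF diff0 lim] by simp
qed

lemma smooth_on_in_Rn: "smooth_on n U m g \<Longrightarrow> x \<in> U \<Longrightarrow> g x \<in> Rn m"
  by (auto simp: smooth_on_def)

lemma smooth_on_component: "smooth_on n U m g \<Longrightarrow> j < m \<Longrightarrow> smooth_fun n U (\<lambda>x. g x j)"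
  by (auto simp: smooth_on_def)

lemma smooth_on_subset: "smooth_on n U m g \<Longrightarrow> V \<subseteq> U \<Longrightarrow> smooth_on n V m g"
  unfolding smooth_on_def using smooth_fun_subset by blast

lemma smooth_on_cong:
  assumes "openin (Euclidean_space n) U" "smooth_on n U m f" "\<And>x. x \<in> U \<Longrightarrow> f x = g x"
  shows "smooth_on n U m g"
  using assms smooth_fun_cong[OF assms(1), of "\<lambda>x. f x j" "\<lambda>x. g x j" for j]
  unfolding smooth_on_def by (auto simp: image_subset_iff)

lemma smooth_on_locally:
  assumes "\<And>x. x \<in> U \<Longrightarrow> \<exists>V. openin (Euclidean_space n) V \<and> x \<in> V \<and> smooth_on n V m f" "U \<subseteq> Rn n"
  shows "smooth_on n U m f"
  unfolding smooth_on_def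
proof (intro conjI allI impI)
  show "f ` U \<subseteq> Rn m"
  proof (rule image_subsetI)
    fix x assume "x \<in> U"
    from assms(1)[OF this] show "f x \<in> Rn m"
      by (auto dest: smooth_on_in_Rn)
  qed
  fix j assume j: "j < m"
  show "smooth_fun n U (\<lambda>x. f x j)"
  proof (rule smooth_fun_locally[OF _ assms(2)])
    fix x assume "x \<in> U"
    from assms(1)[OF this] smooth_on_component[OF _ j]
    show "\<exists>V. openin (Euclidean_space n) V \<and> x \<in> V \<and> smooth_fun n V (\<lambda>x. f x j)"
      by metis
  qed
qed

lemma has_real_derivative_comp:
  assumes U: "openin (Euclidean_space n) U" and g: "smooth_on n U m g" and gV: "g ` U \<subseteq> V"
    and V: "openin (Euclidean_space m) V" and f: "smooth_fun m V f" and x: "x \<in> U" and i: "i < n"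
  shows "((\<lambda>t. f (g (x(i := t)))) has_real_derivative
      (\<Sum>j<m. partial j f (g x) * partial i (\<lambda>y. g y j) x)) (at (x i))"
proof -
  have ev: "\<forall>\<^sub>F t in at (x i). x(i := t) \<in> U"
    using eventually_upd_in_open[OF U x i] by (simp add: eventually_nhds_conv_at)
  have "((\<lambda>s. f (g (x(i := s)))) has_real_derivative
      (\<Sum>j<m. partial j f (g (x(i := x i))) * partial i (\<lambda>y. g y j) x)) (at (x i))"
  proof (rule chain_rule_curve[OF V f])
    show "\<forall>\<^sub>F s in at (x i). g (x(i := s)) \<in> Rn m"
      using ev by eventually_elim (use smooth_on_in_Rn[OF g] in auto)
    fix j assume "j < m"
    then show "((\<lambda>s. g (x(i := s)) j) has_real_derivative partial i (\<lambda>y. g y j) x) (at (x i))"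
      using smooth_fun_differentiable[OF smooth_on_component[OF g] i x] has_real_derivative_partial[of "\<lambda>y. g y j"] by simp
  qed (use gV x in auto)
  then show ?thesis by simp
qed

text \<open>The chain, sum and product rules show that the partial derivatives of members are members again;
  so all members are smooth by coinduction.\<close>

inductive smooth_algebra for n U m V g where
  base: "smooth_fun n U f \<Longrightarrow> smooth_algebra n U m V g f"
| comp: "smooth_fun m V a \<Longrightarrow> smooth_algebra n U m V g (\<lambda>x. a (g x))"
| add: "smooth_algebra n U m V g f \<Longrightarrow> smooth_algebra n U m V g h \<Longrightarrow> smooth_algebra n U m V g (\<lambda>x. f x + h x)"
| mult: "smooth_algebra n U m V g f \<Longrightarrow> smooth_algebra n U m V g h \<Longrightarrow> smooth_algebra n U m V g (\<lambda>x. f x * h x)"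

lemma smooth_algebra_sum:
  assumes "openin (Euclidean_space n) U" "\<And>j. j < (k::nat) \<Longrightarrow> smooth_algebra n U m V g (f j)"
  shows "smooth_algebra n U m V g (\<lambda>x. \<Sum>j<k. f j x)"
  using assms(2)
proof (induction k)
  case 0
  then show ?case by (simp add: smooth_algebra.base smooth_fun_const assms(1))
next
  case (Suc k)
  then show ?case by (simp add: smooth_algebra.add)
qed

lemma continuous_on_smooth_on: "smooth_on n U m g \<Longrightarrow> continuous_on U g"
proof (rule continuous_on_coordinatewise_then_product)
  fix i assume g: "smooth_on n U m g"
  show "continuous_on U (\<lambda>x. g x i)"
  proof (cases "i < m")
    case True
    then show ?thesis using g smooth_on_component smooth_fun_continuous by blast
  next
    case False
    then have "g x i = 0" if "x \<in> U" for x
      using smooth_on_in_Rn[OF g that] by (auto simp: topspace_Euclidean_space)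
    then show ?thesis by (metis (no_types, lifting) continuous_on_cong continuous_on_const)
  qed
qed

lemma smooth_algebra_smooth:
  assumes U: "openin (Euclidean_space n) U" and V: "openin (Euclidean_space m) V"
    and g: "smooth_on n U m g" and gV: "g ` U \<subseteq> V"
    and f: "smooth_algebra n U m V g f"
  shows "smooth_fun n U f"
proof (rule smooth_fun_coinduct[OF U, where P = "smooth_algebra n U m V g", OF f])
  fix f assume "smooth_algebra n U m V g f"
  then show "continuous_on U f \<and> (\<forall>i<n.
        (\<forall>x\<in>U. (\<lambda>t. f (x(i := t))) field_differentiable (at (x i))) \<and>
        (\<exists>h. smooth_algebra n U m V g h \<and> (\<forall>x\<in>U. partial i f x = h x)))"
  proof induction
    case (base f)
    then show ?case
      using smooth_fun_continuous[OF base] smooth_fun_differentiable[OF base]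
        smooth_algebra.base[OF smooth_fun_partial[OF base]] by blast
  next
    case (comp a)
    have "continuous_on U (\<lambda>x. a (g x))"
      using continuous_on_compose2[OF smooth_fun_continuous[OF comp] continuous_on_smooth_on[OF g] gV] .
    moreover have "smooth_algebra n U m V g (\<lambda>x. \<Sum>j<m. partial j a (g x) * partial i (\<lambda>y. g y j) x)" if "i < n" for i
    proof (rule smooth_algebra_sum[OF U])
      fix j assume "j < m"
      then show "smooth_algebra n U m V g (\<lambda>x. partial j a (g x) * partial i (\<lambda>y. g y j) x)"
        using smooth_fun_partial[OF comp] smooth_fun_partial[OF smooth_on_component[OF g]] that
        by (intro smooth_algebra.mult) (auto intro: smooth_algebra.intros)
    qed
    moreover have D: "((\<lambda>t. a (g (x(i := t)))) has_real_derivative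
        (\<Sum>j<m. partial j a (g x) * partial i (\<lambda>y. g y j) x)) (at (x i))" if "x \<in> U" "i < n" for x i
      by (rule has_real_derivative_comp[OF U g gV V comp that])
    moreover have "partial i (\<lambda>x. a (g x)) x = (\<Sum>j<m. partial j a (g x) * partial i (\<lambda>y. g y j) x)"
      if "x \<in> U" "i < n" for x i
      by (rule partial_eqI[OF D[OF that]])
    ultimately show ?case
      unfolding field_differentiable_def by fast
  next
    case (add f h)
    show ?case
    proof (intro conjI allI impI)
      show "continuous_on U (\<lambda>x. f x + h x)" using add by (intro continuous_intros) auto
      fix i assume i: "i < n"
      obtain f' h' where fh: "smooth_algebra n U m V g f'" "\<And>x. x \<in> U \<Longrightarrow> partial i f x = f' x"
        "smooth_algebra n U m V g h'" "\<And>x. x \<in> U \<Longrightarrow> partial i h x = h' x"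
        using add.IH i by blast
      have D: "((\<lambda>t. f (x(i := t)) + h (x(i := t))) has_real_derivative f' x + h' x) (at (x i))" if "x \<in> U" for x
        using has_real_derivative_partial[of f x i] has_real_derivative_partial[of h x i] add i that fh
        by (intro DERIV_add) auto
      then show "\<forall>x\<in>U. (\<lambda>t. f (x(i := t)) + h (x(i := t))) field_differentiable (at (x i))"
        using field_differentiable_def by blast
      show "\<exists>k. smooth_algebra n U m V g k \<and> (\<forall>x\<in>U. partial i (\<lambda>x. f x + h x) x = k x)"
        using partial_eqI[of "\<lambda>x. f x + h x", OF D] smooth_algebra.add[OF fh(1,3)] by blast
    qed
  next
    case (mult f h)
    show ?case
    proof (intro conjI allI impI)
      show "continuous_on U (\<lambda>x. f x * h x)" using mult by (intro continuous_intros) auto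
      fix i assume i: "i < n"
      obtain f' h' where fh: "smooth_algebra n U m V g f'" "\<And>x. x \<in> U \<Longrightarrow> partial i f x = f' x"
        "smooth_algebra n U m V g h'" "\<And>x. x \<in> U \<Longrightarrow> partial i h x = h' x"
        using mult.IH i by blast
      have D: "((\<lambda>t. f (x(i := t)) * h (x(i := t))) has_real_derivative f' x * h x + h' x * f x) (at (x i))" if "x \<in> U" for x
        using DERIV_mult[OF has_real_derivative_partial[of f x i] has_real_derivative_partial[of h x i]] mult i that fh
        by simp
      then show "\<forall>x\<in>U. (\<lambda>t. f (x(i := t)) * h (x(i := t))) field_differentiable (at (x i))"
        using field_differentiable_def by blast
      have "smooth_algebra n U m V g (\<lambda>x. f' x * h x + h' x * f x)"
        using fh mult by (intro smooth_algebra.add smooth_algebra.mult) auto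
      then show "\<exists>k. smooth_algebra n U m V g k \<and> (\<forall>x\<in>U. partial i (\<lambda>x. f x * h x) x = k x)"
        using partial_eqI[of "\<lambda>x. f x * h x", OF D] by blast
    qed
  qed
qed

lemma smooth_fun_comp:
  assumes "openin (Euclidean_space n) U" "openin (Euclidean_space m) V"
    "smooth_on n U m g" "g ` U \<subseteq> V" "smooth_fun m V f"
  shows "smooth_fun n U (\<lambda>x. f (g x))"
  using smooth_algebra_smooth[OF assms(1-4) smooth_algebra.comp] assms(5) .

lemma smooth_on_comp:
  assumes "openin (Euclidean_space n) U" "openin (Euclidean_space m) V"
    "smooth_on n U m g" "g ` U \<subseteq> V" "smooth_on m V k f"
  shows "smooth_on n U k (f \<circ> g)"
  unfolding smooth_on_def
proof (intro conjI allI impI)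
  show "(f \<circ> g) ` U \<subseteq> Rn k"
    using assms(4,5) by (auto simp: smooth_on_def)
  fix j assume "j < k"
  then show "smooth_fun n U (\<lambda>x. (f \<circ> g) x j)"
    using smooth_fun_comp[OF assms(1-4) smooth_on_component[OF assms(5)]] by simp
qed

lemma smooth_on_id: "openin (Euclidean_space n) U \<Longrightarrow> smooth_on n U n (\<lambda>x. x)"
  by (auto simp: smooth_on_def smooth_fun_coordinate dest: openin_Rn_subset)

text \<open>Sums and products of smooth functions come from \<open>smooth_algebra\<close> with the
  identity as inner map.\<close>

lemma smooth_fun_add:
  assumes "openin (Euclidean_space n) U" "smooth_fun n U f" "smooth_fun n U h"
  shows "smooth_fun n U (\<lambda>x. f x + h x)"
  by (rule smooth_algebra_smooth[OF assms(1) assms(1) smooth_on_id[OF assms(1)]])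
    (auto intro: smooth_algebra.intros assms)

lemma smooth_fun_mult:
  assumes "openin (Euclidean_space n) U" "smooth_fun n U f" "smooth_fun n U h"
  shows "smooth_fun n U (\<lambda>x. f x * h x)"
  by (rule smooth_algebra_smooth[OF assms(1) assms(1) smooth_on_id[OF assms(1)]])
    (auto intro: smooth_algebra.intros assms)

lemma smooth_fun_sum:
  assumes "openin (Euclidean_space n) U" "\<And>j. j < (k::nat) \<Longrightarrow> smooth_fun n U (f j)"
  shows "smooth_fun n U (\<lambda>x. \<Sum>j<k. f j x)"
  using assms(2) by (induction k) (auto simp: smooth_fun_const smooth_fun_add assms(1))

lemma smooth_on_translate:
  assumes "openin (Euclidean_space n) U" "b \<in> Rn n"
  shows "smooth_on n U n (\<lambda>x. x + b)"
  using assms smooth_fun_add[OF assms(1) smooth_fun_coordinate[OF assms(1)] smooth_fun_const[OF assms(1)]]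
  by (auto simp: smooth_on_def intro: Rn_add dest: openin_Rn_subset)

lemma smooth_on_scale_vec:
  assumes "openin (Euclidean_space (Suc 0)) U" "b \<in> Rn n"
  shows "smooth_on (Suc 0) U n (\<lambda>x. x 0 *\<^sub>R b)"
  using assms smooth_fun_mult[OF assms(1) smooth_fun_coordinate[OF assms(1)] smooth_fun_const[OF assms(1)]]
  by (auto simp: smooth_on_def scaleR_fun_def topspace_Euclidean_space)

section \<open>Linear maps on R^n and differentials at 0\<close>

definition unit_vec :: "nat \<Rightarrow> nat \<Rightarrow> real"
  where "unit_vec i = (\<lambda>k. if k = i then 1 else 0)"

lemma unit_vec_Rn: "i < n \<Longrightarrow> unit_vec i \<in> Rn n"
  by (auto simp: unit_vec_def topspace_Euclidean_space)

lemma sum_fun_apply: "(\<Sum>i\<in>I. f i) x = (\<Sum>i\<in>I. f i x)"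
  by (induction I rule: infinite_finite_induct) auto

lemma scaleR_fun_apply: "(c *\<^sub>R f) x = c *\<^sub>R f x"
  by (simp only: scaleR_fun_def)

lemma Rn_decompose: "x \<in> Rn n \<Longrightarrow> x = (\<Sum>i<n. x i *\<^sub>R unit_vec i)"
proof
  fix k assume "x \<in> Rn n"
  then show "x k = (\<Sum>i<n. x i *\<^sub>R unit_vec i) k"
    by (cases "k < n") (auto simp: sum_fun_apply scaleR_fun_def unit_vec_def topspace_Euclidean_space
        if_distrib cong: if_cong)
qed

lemma Rn_sum: "(\<And>i. i \<in> I \<Longrightarrow> f i \<in> Rn n) \<Longrightarrow> (\<Sum>i\<in>I. f i) \<in> Rn n"
  by (rule subspace_sum[OF subspace_Rn])

lemma linear_on_zero: "linear_on V f \<Longrightarrow> 0 \<in> V \<Longrightarrow> f 0 = 0"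
  unfolding linear_on_def by (metis scaleR_zero_left)

lemma linear_on_sum:
  assumes "linear_on V f" "subspace V" "finite I" "\<And>i. i \<in> I \<Longrightarrow> g i \<in> V"
  shows "f (\<Sum>i\<in>I. g i) = (\<Sum>i\<in>I. f (g i))"
  using assms(3,4)
proof (induction I rule: finite_induct)
  case empty
  then show ?case using linear_on_zero assms subspace_0 by auto
next
  case (insert i I)
  then show ?case
    using assms(1) subspace_sum[OF assms(2), of I g] by (simp add: linear_on_def)
qed

lemma linear_on_diff:
  assumes "linear_on V f" "subspace V" "a \<in> V" "b \<in> V"
  shows "f (a - b) = f a - f b"
proof -
  have "f (a + (-1) *\<^sub>R b) = f a + (-1) *\<^sub>R f b"
    using assms subspace_scale[OF assms(2,4), of "-1"] unfolding linear_on_def by metis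
  then show ?thesis by simp
qed

lemma linear_on_Rn_expand:
  assumes "linear_on (Rn n) f" "x \<in> Rn n"
  shows "f x = (\<Sum>i<n. x i *\<^sub>R f (unit_vec i))"
proof -
  have "f x = f (\<Sum>i<n. x i *\<^sub>R unit_vec i)"
    using Rn_decompose[OF assms(2)] by simp
  also have "\<dots> = (\<Sum>i<n. f (x i *\<^sub>R unit_vec i))"
    by (rule linear_on_sum[OF assms(1) subspace_Rn]) (auto intro: Rn_scaleR unit_vec_Rn)
  also have "\<dots> = (\<Sum>i<n. x i *\<^sub>R f (unit_vec i))"
    using assms(1) unit_vec_Rn by (intro sum.cong) (auto simp: linear_on_def)
  finally show ?thesis .
qed

lemma linear_linear_on: "linear f \<Longrightarrow> linear_on V f"
  by (simp add: linear_on_def linear_add linear_scale)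

lemma linear_on_comp: "linear_on V f \<Longrightarrow> f ` V \<subseteq> U \<Longrightarrow> linear_on U g \<Longrightarrow> linear_on V (\<lambda>x. g (f x))"
  unfolding linear_on_def by (simp add: image_subset_iff)

lemma jacobian_add: "jacobian n g (v + w) = jacobian n g v + jacobian n g w"
  by (simp add: jacobian_def fun_eq_iff distrib_left sum.distrib)

lemma jacobian_scaleR: "jacobian n g (c *\<^sub>R v) = c *\<^sub>R jacobian n g v"
  by (simp add: jacobian_def fun_eq_iff scaleR_fun_def sum_distrib_left algebra_simps)

lemma linear_jacobian: "linear (jacobian n g)"
  by (simp add: linear_iff jacobian_add jacobian_scaleR)

lemma jacobian_zero [simp]: "jacobian n g 0 = 0"
  by (simp add: jacobian_def fun_eq_iff)

lemma partial_const: "openin (Euclidean_space n) U \<Longrightarrow> x \<in> U \<Longrightarrow> i < n \<Longrightarrow> (\<And>y. y \<in> U \<Longrightarrow> f y = c) \<Longrightarrow> partial i f x = 0"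
  using partial_cong[of n U x i f "\<lambda>y. c"] partial_eqI[of "\<lambda>y. c" x i 0] by simp

lemma jacobian_Rn:
  assumes "openin (Euclidean_space n) U" "0 \<in> U" "\<And>x. x \<in> U \<Longrightarrow> g x \<in> Rn m"
  shows "jacobian n g v \<in> Rn m"
proof -
  have "partial i (\<lambda>x. g x j) 0 = 0" if "i < n" "j \<ge> m" for i j
    by (rule partial_const[OF assms(1,2) that(1), of _ 0]) (use assms(3) that in \<open>auto simp: topspace_Euclidean_space\<close>)
  then show ?thesis
    by (auto simp: jacobian_def topspace_Euclidean_space)
qed

lemma jacobian_cong:
  assumes "openin (Euclidean_space n) U" "0 \<in> U" "\<And>x. x \<in> U \<Longrightarrow> g x = h x"
  shows "jacobian n g v = jacobian n h v"
proof -
  have "partial i (\<lambda>x. g x j) 0 = partial i (\<lambda>x. h x j) 0" if "i < n" for i j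
    by (rule partial_cong[OF assms(1,2) that]) (use assms(3) in auto)
  then show ?thesis by (simp add: jacobian_def)
qed

lemma jacobian_comp:
  assumes U: "openin (Euclidean_space n) U" and g: "smooth_on n U m g" and gV: "g ` U \<subseteq> V"
    and V: "openin (Euclidean_space m) V" and f: "smooth_on m V k f" and z: "0 \<in> U" "g 0 = 0"
  shows "jacobian n (f \<circ> g) v = jacobian m f (jacobian n g v)"
proof
  fix j
  have z': "0 \<in> V" using z gV by force
  show "jacobian n (f \<circ> g) v j = jacobian m f (jacobian n g v) j"
  proof (cases "j < k")
    case True
    have "partial i (\<lambda>x. (f \<circ> g) x j) 0 = (\<Sum>l<m. partial l (\<lambda>y. f y j) 0 * partial i (\<lambda>x. g x l) 0)" if "i < n" for i
      using partial_eqI[of "\<lambda>x. f (g x) j", OF has_real_derivative_comp[OF U g gV V smooth_on_component[OF f True] z(1) that]]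
      by (simp only: o_def z(2))
    then have "jacobian n (f \<circ> g) v j = (\<Sum>i<n. \<Sum>l<m. partial l (\<lambda>y. f y j) 0 * partial i (\<lambda>x. g x l) 0 * v i)"
      by (simp add: jacobian_def sum_distrib_right)
    also have "\<dots> = jacobian m f (jacobian n g v) j"
      by (subst sum.swap) (simp add: jacobian_def sum_distrib_left mult.assoc)
    finally show ?thesis .
  next
    case False
    have "jacobian n (f \<circ> g) v \<in> Rn k"
      by (rule jacobian_Rn[OF U z(1)]) (use smooth_on_in_Rn[OF f] gV in auto)
    moreover have "jacobian m f (jacobian n g v) \<in> Rn k"
      by (rule jacobian_Rn[OF V z' smooth_on_in_Rn[OF f]])
    ultimately show ?thesis using False by (auto simp: topspace_Euclidean_space)
  qed
qed

lemma jacobian_linear: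
  assumes "linear_on (Rn n) g" "openin (Euclidean_space n) U" "0 \<in> U" "v \<in> Rn n"
  shows "jacobian n g v = g v"
proof
  fix j
  have "partial i (\<lambda>x. g x j) 0 = g (unit_vec i) j" if "i < n" for i
  proof (rule partial_eqI)
    have "(\<lambda>t. g (0(i := t)) j) = (\<lambda>t. t * g (unit_vec i) j)"
    proof
      fix t
      have "0(i := t) = t *\<^sub>R unit_vec i"
        by (auto simp: fun_eq_iff scaleR_fun_def unit_vec_def)
      then show "g (0(i := t)) j = t * g (unit_vec i) j"
        using assms(1) unit_vec_Rn[OF that] by (simp add: linear_on_def scaleR_fun_def)
    qed
    then show "((\<lambda>t. g (0(i := t)) j) has_real_derivative g (unit_vec i) j) (at (0 i))"
      by (auto intro!: derivative_eq_intros)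
  qed
  then have "jacobian n g v j = (\<Sum>i<n. g (unit_vec i) j * v i)"
    by (simp add: jacobian_def)
  also have "\<dots> = g v j"
    by (subst linear_on_Rn_expand[OF assms(1,4)]) (simp add: sum_fun_apply scaleR_fun_def mult.commute)
  finally show "jacobian n g v j = g v j" .
qed

lemma jacobian_id: "v \<in> Rn n \<Longrightarrow> jacobian n (\<lambda>x. x) v = v"
  using jacobian_linear[of n "\<lambda>x. x" "Rn n" v] by (simp add: linear_on_def)

lemma smooth_on_linear:
  assumes "linear_on (Rn n) g" "g ` U \<subseteq> Rn m" "openin (Euclidean_space n) U"
  shows "smooth_on n U m g"
  unfolding smooth_on_def
proof (intro conjI allI impI assms(2))
  fix j assume "j < m"
  have "smooth_fun n U (\<lambda>x. \<Sum>i<n. x i * g (unit_vec i) j)"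
    by (intro smooth_fun_sum smooth_fun_mult smooth_fun_coordinate smooth_fun_const assms(3))
  then show "smooth_fun n U (\<lambda>x. g x j)"
  proof (rule smooth_fun_cong[OF assms(3)])
    fix x assume "x \<in> U"
    then show "(\<Sum>i<n. x i * g (unit_vec i) j) = g x j"
      using linear_on_Rn_expand[OF assms(1), of x] openin_Rn_subset[OF assms(3)]
      by (auto simp: sum_fun_apply scaleR_fun_def)
  qed
qed

lemma jacobian_curve:
  assumes U: "openin (Euclidean_space n) U" and z: "0 \<in> U" and g: "smooth_on n U m g"
    and c0: "c 0 = 0" and c: "\<forall>\<^sub>F s in at 0. c s \<in> Rn n"
    and w: "\<And>i. i < n \<Longrightarrow> ((\<lambda>s. c s i) has_real_derivative w i) (at 0)"
    and j: "j < m"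
  shows "((\<lambda>s. g (c s) j) has_real_derivative jacobian n g w j) (at (0::real))"
  using chain_rule_curve[where c = c, OF U smooth_on_component[OF g j], of 0] z c0 c w by (simp add: jacobian_def)

lemma has_real_derivative_scaleR_fun:
  "((\<lambda>s. (s *\<^sub>R v) i) has_real_derivative v i) (at (0::real))"
proof -
  have 1: "((\<lambda>s. s * v i) has_real_derivative v i) (at (0::real))"
    using DERIV_cmult_right[OF DERIV_ident, of "v i" 0 UNIV] by (simp only: mult_1_left)
  have "(\<lambda>s. s * v i) = (\<lambda>s. (s *\<^sub>R v) i)"
    by (rule ext) (simp only: scaleR_fun_def real_scaleR_def)
  then show ?thesis using 1 by metis
qed

lemma jacobian_line:
  assumes "openin (Euclidean_space n) U" "0 \<in> U" "smooth_on n U m g" "v \<in> Rn n" "j < m"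
  shows "((\<lambda>t. g (t *\<^sub>R v) j) has_real_derivative jacobian n g v j) (at (0::real))"
proof (rule jacobian_curve[where c = "\<lambda>t. t *\<^sub>R v", OF assms(1-3) _ _ _ assms(5)])
  show "0 *\<^sub>R v = 0"
    by (rule scaleR_zero_left)
  show "\<forall>\<^sub>F s in at 0. s *\<^sub>R v \<in> Rn n"
    by (rule always_eventually) (intro allI Rn_scaleR assms(4))
  show "((\<lambda>s. (s *\<^sub>R v) i) has_real_derivative v i) (at 0)" for i
    by (rule has_real_derivative_scaleR_fun)
qed


section \<open>Plots of manifolds\<close>

lemma subtopology_Rn: "U \<subseteq> Rn n \<Longrightarrow> subtopology (Euclidean_space n) U = top_of_set U"
  by (subst Euclidean_space_top_of_set) (simp add: subtopology_subtopology inf.absorb2)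

lemma continuous_map_Euclidean_space:
  "continuous_map X (Euclidean_space n) f \<longleftrightarrow> continuous_map X euclidean f \<and> f ` topspace X \<subseteq> Rn n"
  by (subst Euclidean_space_top_of_set) (auto simp: continuous_map_in_subtopology)

lemma openin_smooth_preimage:
  assumes "openin (Euclidean_space n) U" "smooth_on n U m g" "openin (Euclidean_space m) T"
  shows "openin (Euclidean_space n) {u \<in> U. g u \<in> T}"
proof -
  have "continuous_map (top_of_set U) (Euclidean_space m) g"
    using continuous_on_smooth_on[OF assms(2)] smooth_on_in_Rn[OF assms(2)]
    by (auto simp: continuous_map_Euclidean_space)
  from openin_continuous_map_preimage[OF this assms(3)]
  have "openin (top_of_set U) {u \<in> U. g u \<in> T}" by simp
  then show ?thesis
    using assms(1) openin_trans unfolding openin_Rn_iff by blast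
qed

lemma continuous_map_locally:
  assumes "\<And>x. x \<in> topspace X \<Longrightarrow> \<exists>N. openin X N \<and> x \<in> N \<and> continuous_map (subtopology X N) Y f"
  shows "continuous_map X Y f"
proof -
  obtain N where N: "\<And>x. x \<in> topspace X \<Longrightarrow> openin X (N x)" "\<And>x. x \<in> topspace X \<Longrightarrow> x \<in> N x"
    "\<And>x. x \<in> topspace X \<Longrightarrow> continuous_map (subtopology X (N x)) Y f"
    using assms by metis
  show ?thesis
    by (rule pasting_lemma[where I = "topspace X" and T = N and f = "\<lambda>x. f"]) (use N in auto)
qed

lemma standard_diffeologyD:
  assumes "(n, U, p) \<in> standard_diffeology M"
  shows "openin (Euclidean_space n) U" "p \<in> U \<rightarrow>\<^sub>E mcarrier M" "U \<subseteq> Rn n"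
    "continuous_map (top_of_set U) (mtop M) p"
    "\<And>m W \<psi>. (m, W, \<psi>) \<in> atlas M \<Longrightarrow> smooth_on n {u \<in> U. p u \<in> W} m (\<psi> \<circ> p)"
  using assms by (auto simp: standard_diffeology_def subtopology_Rn dest: openin_Rn_subset)

lemma standard_diffeologyI:
  assumes "openin (Euclidean_space n) U" "p \<in> U \<rightarrow>\<^sub>E mcarrier M"
    "continuous_map (top_of_set U) (mtop M) p"
    "\<And>m W \<psi>. (m, W, \<psi>) \<in> atlas M \<Longrightarrow> smooth_on n {u \<in> U. p u \<in> W} m (\<psi> \<circ> p)"
  shows "(n, U, p) \<in> standard_diffeology M"
  using assms by (auto simp: standard_diffeology_def subtopology_Rn dest: openin_Rn_subset)

lemma openin_plot_preimage:
  assumes "(n, U, p) \<in> standard_diffeology M" "openin (mtop M) T"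
  shows "openin (Euclidean_space n) {u \<in> U. p u \<in> T}"
proof -
  have "openin (top_of_set U) {u \<in> U. p u \<in> T}"
    using openin_continuous_map_preimage[OF standard_diffeologyD(4)[OF assms(1)] assms(2)] by simp
  then show ?thesis
    using standard_diffeologyD(1)[OF assms(1)] openin_trans unfolding openin_Rn_iff by blast
qed

text \<open>The part of \<open>is_manifold\<close> on which the arguments about plots rely. It
  passes to products and is easily checked for a vector space with linear coordinates, so that the
  other manifold axioms do not have to be established for these.\<close>

definition charted :: "'a manifold \<Rightarrow> bool"
  where "charted M \<longleftrightarrow> (\<forall>(m, W, \<psi>)\<in>atlas M. openin (mtop M) W \<and> inj_on \<psi> W \<and> \<psi> ` W \<subseteq> Rn m) \<and>
    (\<Union>(n, U, \<phi>)\<in>atlas M. U) = mcarrier M"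

lemma chartedD:
  assumes "charted M"
  shows "(m, W, \<psi>) \<in> atlas M \<Longrightarrow> openin (mtop M) W"
    "(m, W, \<psi>) \<in> atlas M \<Longrightarrow> inj_on \<psi> W"
    "x \<in> mcarrier M \<Longrightarrow> \<exists>m W \<psi>. (m, W, \<psi>) \<in> atlas M \<and> x \<in> W"
    "(m, W, \<psi>) \<in> atlas M \<Longrightarrow> \<psi> ` W \<subseteq> Rn m"
proof -
  show "x \<in> mcarrier M \<Longrightarrow> \<exists>m W \<psi>. (m, W, \<psi>) \<in> atlas M \<and> x \<in> W"
  proof -
    assume "x \<in> mcarrier M"
    then have "x \<in> (\<Union>(n, U, \<phi>)\<in>atlas M. U)"
      using assms by (simp add: charted_def)
    then show ?thesis by auto
  qed
qed (use assms in \<open>fastforce simp: charted_def\<close>)+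

lemma chart_onD:
  assumes "chart_on X (n, U, \<phi>)"
  shows "openin X U" "openin (Euclidean_space n) (\<phi> ` U)" "inj_on \<phi> U"
    "homeomorphic_map (subtopology X U) (top_of_set (\<phi> ` U)) \<phi>"
proof -
  show 1: "openin X U" "openin (Euclidean_space n) (\<phi> ` U)"
    using assms by (auto simp: chart_on_def)
  show 2: "homeomorphic_map (subtopology X U) (top_of_set (\<phi> ` U)) \<phi>"
    using assms openin_Rn_subset[OF 1(2)] by (auto simp: chart_on_def subtopology_Rn)
  show "inj_on \<phi> U"
    using homeomorphic_imp_injective_map[OF 2] openin_subset[OF 1(1)] by (simp add: inf.absorb2)
qed

lemma is_manifold_charted: "is_manifold M \<Longrightarrow> charted M"
  unfolding is_manifold_def charted_def using chart_onD(1,3) openin_Rn_subset[OF chart_onD(2)] by fast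

text \<open>The reparametrization axiom of a diffeology; over a chart domain it is the chain rule
  for \<open>\<psi> \<circ> p\<close> and \<open>F\<close>.\<close>

lemma plot_precompose:
  assumes M: "charted M" and p: "(n, U, p) \<in> standard_diffeology M"
    and V: "openin (Euclidean_space m) V" and F: "smooth_on m V n F" and FU: "F ` V \<subseteq> U"
  shows "(m, V, restrict (p \<circ> F) V) \<in> standard_diffeology M"
proof (rule standard_diffeologyI[OF V])
  note p' = standard_diffeologyD[OF p]
  show "restrict (p \<circ> F) V \<in> V \<rightarrow>\<^sub>E mcarrier M"
    using FU p'(2) by (auto simp: PiE_def Pi_def)
  have "continuous_map (top_of_set V) (top_of_set U) F"
    using continuous_on_smooth_on[OF F] FU by (auto simp: continuous_map_in_subtopology)
  then have "continuous_map (top_of_set V) (mtop M) (p \<circ> F)"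
    using p'(4) continuous_map_compose by blast
  then show "continuous_map (top_of_set V) (mtop M) (restrict (p \<circ> F) V)"
    by (rule continuous_map_eq) auto
  fix k W \<psi> assume c: "(k, W, \<psi>) \<in> atlas M"
  have W: "openin (mtop M) W" using chartedD(1)[OF M c] .
  have UW: "openin (Euclidean_space n) {u \<in> U. p u \<in> W}"
    by (rule openin_plot_preimage[OF p W])
  have eq: "{u \<in> V. restrict (p \<circ> F) V u \<in> W} = {v \<in> V. F v \<in> {u \<in> U. p u \<in> W}}"
    using FU by auto
  have VW: "openin (Euclidean_space m) {v \<in> V. F v \<in> {u \<in> U. p u \<in> W}}"
    by (rule openin_smooth_preimage[OF V F UW])
  have "smooth_on m {v \<in> V. F v \<in> {u \<in> U. p u \<in> W}} k ((\<psi> \<circ> p) \<circ> F)"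
    by (rule smooth_on_comp[OF VW UW _ _ p'(5)[OF c]]) (auto intro: smooth_on_subset[OF F])
  then show "smooth_on m {u \<in> V. restrict (p \<circ> F) V u \<in> W} k (\<psi> \<circ> restrict (p \<circ> F) V)"
    unfolding eq by (rule smooth_on_cong[OF VW]) auto
qed

text \<open>The locality axiom of a diffeology. It reduces the test for a plot to one chart of the
  source at a time.\<close>

lemma plot_locally:
  assumes M: "charted M" and U: "openin (Euclidean_space n) U" and p: "p \<in> extensional U"
    and loc: "\<And>u. u \<in> U \<Longrightarrow> \<exists>V. u \<in> V \<and> V \<subseteq> U \<and> (n, V, restrict p V) \<in> standard_diffeology M"
  shows "(n, U, p) \<in> standard_diffeology M"
proof (rule standard_diffeologyI[OF U])
  have "p u \<in> mcarrier M" if "u \<in> U" for u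
    using loc[OF that] standard_diffeologyD(2) by fastforce
  then show pM: "p \<in> U \<rightarrow>\<^sub>E mcarrier M"
    using p by (auto simp: PiE_def)
  show "continuous_map (top_of_set U) (mtop M) p"
    unfolding continuous_map_def
  proof (intro conjI allI impI)
    fix T assume T: "openin (mtop M) T"
    have "openin (Euclidean_space n) {u \<in> U. p u \<in> T}"
    proof (subst openin_subopen, intro ballI)
      fix u assume u: "u \<in> {u \<in> U. p u \<in> T}"
      then obtain V where V: "u \<in> V" "V \<subseteq> U" "(n, V, restrict p V) \<in> standard_diffeology M"
        using loc by blast
      have "openin (Euclidean_space n) {v \<in> V. restrict p V v \<in> T}"
        by (rule openin_plot_preimage[OF V(3) T])
      then show "\<exists>T'. openin (Euclidean_space n) T' \<and> u \<in> T' \<and> T' \<subseteq> {u \<in> U. p u \<in> T}"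
        using u V by (intro exI[of _ "{v \<in> V. restrict p V v \<in> T}"]) auto
    qed
    then show "openin (top_of_set U) {u \<in> topspace (top_of_set U). p u \<in> T}"
      using openin_Rn_subset[OF U] by (auto simp: openin_Rn_iff intro: openin_subset_trans)
  qed (use pM in auto)
  fix m W \<psi> assume c: "(m, W, \<psi>) \<in> atlas M"
  show "smooth_on n {u \<in> U. p u \<in> W} m (\<psi> \<circ> p)"
  proof (rule smooth_on_locally)
    fix u assume u: "u \<in> {u \<in> U. p u \<in> W}"
    then obtain V where V: "u \<in> V" "V \<subseteq> U" "(n, V, restrict p V) \<in> standard_diffeology M"
      using loc by blast
    have o: "openin (Euclidean_space n) {v \<in> V. restrict p V v \<in> W}"
      by (rule openin_plot_preimage[OF V(3) chartedD(1)[OF M c]])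
    have "smooth_on n {v \<in> V. restrict p V v \<in> W} m (\<psi> \<circ> p)"
      by (rule smooth_on_cong[OF o standard_diffeologyD(5)[OF V(3) c]]) auto
    with o show "\<exists>V. openin (Euclidean_space n) V \<and> u \<in> V \<and> smooth_on n V m (\<psi> \<circ> p)"
      using u V by (intro exI[of _ "{v \<in> V. restrict p V v \<in> W}"]) auto
  qed (use openin_Rn_subset[OF U] in auto)
qed

lemma plot_const:
  assumes "charted M" "openin (Euclidean_space n) U" "x \<in> mcarrier M"
  shows "(n, U, restrict (\<lambda>u. x) U) \<in> standard_diffeology M"
proof (rule standard_diffeologyI[OF assms(2)])
  show "continuous_map (top_of_set U) (mtop M) (restrict (\<lambda>u. x) U)"
    by (rule continuous_map_eq[of _ _ "\<lambda>u. x"]) (use assms(3) in auto)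
  fix m W \<psi> assume c: "(m, W, \<psi>) \<in> atlas M"
  have o: "openin (Euclidean_space n) {u \<in> U. (restrict (\<lambda>u. x) U) u \<in> W}"
    using assms(2) by (cases "x \<in> W") (auto cong: conj_cong)
  show "smooth_on n {u \<in> U. (restrict (\<lambda>u. x) U) u \<in> W} m (\<psi> \<circ> restrict (\<lambda>u. x) U)"
  proof (rule smooth_on_cong[OF o, of m "\<lambda>u. \<psi> x"])
    show "smooth_on n {u \<in> U. (restrict (\<lambda>u. x) U) u \<in> W} m (\<lambda>u. \<psi> x)"
      using chartedD(4)[OF assms(1) c] smooth_fun_const[OF o] by (auto simp: smooth_on_def)
  qed auto
qed (use assms in auto)

text \<open>Near each point the plot is an inverse chart after \<open>\<psi> \<circ> p\<close>, and
  \<open>smooth_map\<close> says that \<open>f\<close> after an inverse chart of the atlas is a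
  plot.\<close>

lemma plot_smooth_map:
  assumes M: "charted M" and N: "charted N" and f: "smooth_map M N f"
    and p: "(n, U, p) \<in> standard_diffeology M"
  shows "(n, U, restrict (f \<circ> p) U) \<in> standard_diffeology N"
proof (rule plot_locally[OF N])
  note p' = standard_diffeologyD[OF p]
  show "openin (Euclidean_space n) U" by (rule p')
  fix u assume u: "u \<in> U"
  then have "p u \<in> mcarrier M" using p' by auto
  then obtain m W \<psi> where c: "(m, W, \<psi>) \<in> atlas M" "p u \<in> W"
    using chartedD(3)[OF M] by blast
  define V where "V = {u \<in> U. p u \<in> W}"
  have V: "openin (Euclidean_space n) V"
    unfolding V_def by (rule openin_plot_preimage[OF p chartedD(1)[OF M c(1)]])
  have "(m, \<psi> ` W, restrict (f \<circ> inv_into W \<psi>) (\<psi> ` W)) \<in> standard_diffeology N"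
    using f c unfolding smooth_map_def by fast
  from plot_precompose[OF N this V, of "\<psi> \<circ> p"] p'(5)[OF c(1)]
  have "(n, V, restrict (restrict (f \<circ> inv_into W \<psi>) (\<psi> ` W) \<circ> (\<psi> \<circ> p)) V) \<in> standard_diffeology N"
    by (auto simp: V_def)
  moreover have "restrict (restrict (f \<circ> inv_into W \<psi>) (\<psi> ` W) \<circ> (\<psi> \<circ> p)) V = restrict (restrict (f \<circ> p) U) V"
    using chartedD(2)[OF M c(1)] by (auto simp: V_def fun_eq_iff restrict_def)
  ultimately show "\<exists>V. u \<in> V \<and> V \<subseteq> U \<and> (n, V, restrict (restrict (f \<circ> p) U) V) \<in> standard_diffeology N"
    using u c by (intro exI[of _ V]) (auto simp: V_def)
qed auto

lemma product_atlasI: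
  "(m, U, \<phi>) \<in> atlas M \<Longrightarrow> (n, V, \<psi>) \<in> atlas N \<Longrightarrow>
    (m + n, U \<times> V, \<lambda>(x, y) i. if i < m then \<phi> x i else \<psi> y (i - m)) \<in> atlas (product_manifold M N)"
  unfolding product_manifold_def by simp blast

lemma charted_product:
  assumes M: "charted M" and N: "charted N"
  shows "charted (product_manifold M N)"
proof -
  have c: "openin (prod_topology (mtop M) (mtop N)) (U \<times> V) \<and>
      inj_on (\<lambda>(x, y) i. if i < m then \<phi> x i else \<psi> y (i - m)) (U \<times> V) \<and>
      (\<lambda>(x, y) i. if i < m then \<phi> x i else \<psi> y (i - m)) ` (U \<times> V) \<subseteq> Rn (m + n)"
    if "(m, U, \<phi>) \<in> atlas M" "(n, V, \<psi>) \<in> atlas N" for m U \<phi> n V \<psi>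
  proof (intro conjI)
    note U = chartedD(1,2,4)[OF M that(1)] and V = chartedD(1,2,4)[OF N that(2)]
    show "openin (prod_topology (mtop M) (mtop N)) (U \<times> V)"
      using U V by (simp add: openin_prod_Times_iff)
    show "inj_on (\<lambda>(x, y) i. if i < m then \<phi> x i else \<psi> y (i - m)) (U \<times> V)"
    proof (rule inj_onI, clarify)
      fix x y x' y' assume xy: "x \<in> U" "y \<in> V" "x' \<in> U" "y' \<in> V"
        and eq: "(\<lambda>i. if i < m then \<phi> x i else \<psi> y (i - m)) = (\<lambda>i. if i < m then \<phi> x' i else \<psi> y' (i - m))"
      have "\<phi> x i = \<phi> x' i" for i
      proof (cases "i < m")
        case True
        then show ?thesis using fun_cong[OF eq, of i] by simp
      next
        \<comment> \<open>The combined coordinates forget \<open>\<phi> x i\<close> for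
          \<open>i \<ge> m\<close>; these values vanish because \<open>\<phi>\<close> maps into
          R^m.\<close>
        case False
        then show ?thesis using U(3) xy by (auto simp: topspace_Euclidean_space image_subset_iff)
      qed
      moreover have "\<psi> y i = \<psi> y' i" for i
        using fun_cong[OF eq, of "i + m"] by simp
      ultimately show "x = x' \<and> y = y'"
        using U(2) V(2) xy by (meson ext inj_onD)
    qed
    show "(\<lambda>(x, y) i. if i < m then \<phi> x i else \<psi> y (i - m)) ` (U \<times> V) \<subseteq> Rn (m + n)"
      using V(3) by (auto simp: topspace_Euclidean_space image_subset_iff)
  qed
  have u: "(\<Union>(n, U, \<phi>)\<in>atlas (product_manifold M N). U) = mcarrier M \<times> mcarrier N"
  proof
    show "(\<Union>(n, U, \<phi>)\<in>atlas (product_manifold M N). U) \<subseteq> mcarrier M \<times> mcarrier N"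
      using chartedD(1)[OF M, THEN openin_subset] chartedD(1)[OF N, THEN openin_subset]
      by (fastforce simp: product_manifold_def)
    show "mcarrier M \<times> mcarrier N \<subseteq> (\<Union>(n, U, \<phi>)\<in>atlas (product_manifold M N). U)"
    proof clarify
      fix x y assume "x \<in> mcarrier M" "y \<in> mcarrier N"
      then obtain m U \<phi> n V \<psi> where "(m, U, \<phi>) \<in> atlas M" "(n, V, \<psi>) \<in> atlas N" "x \<in> U" "y \<in> V"
        using chartedD(3)[OF M] chartedD(3)[OF N] by metis
      then show "(x, y) \<in> (\<Union>(n, U, \<phi>)\<in>atlas (product_manifold M N). U)"
        by (intro UN_I[OF product_atlasI]) auto
    qed
  qed
  show ?thesis
    unfolding charted_def u
  proof (intro conjI ballI)
    fix e assume "e \<in> atlas (product_manifold M N)"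
    then obtain m U \<phi> n V \<psi> where e: "(m, U, \<phi>) \<in> atlas M" "(n, V, \<psi>) \<in> atlas N"
      "e = (m + n, U \<times> V, \<lambda>(x, y) i. if i < m then \<phi> x i else \<psi> y (i - m))"
      unfolding product_manifold_def by auto
    show "case e of (m, W, \<psi>) \<Rightarrow> openin (mtop (product_manifold M N)) W \<and> inj_on \<psi> W \<and> \<psi> ` W \<subseteq> Rn m"
      using c[OF e(1,2)] by (simp only: e(3) prod.case product_manifold_def manifold.simps)
  qed (simp add: product_manifold_def)
qed

lemma plot_pair:
  assumes M: "charted M" and N: "charted N" and p: "(n, U, p) \<in> standard_diffeology M"
    and q: "(n, U, q) \<in> standard_diffeology N"
  shows "(n, U, restrict (\<lambda>u. (p u, q u)) U) \<in> standard_diffeology (product_manifold M N)"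
proof (rule standard_diffeologyI)
  note p' = standard_diffeologyD[OF p] and q' = standard_diffeologyD[OF q]
  show "openin (Euclidean_space n) U" by (rule p')
  show "restrict (\<lambda>u. (p u, q u)) U \<in> U \<rightarrow>\<^sub>E mcarrier (product_manifold M N)"
    using p'(2) q'(2) by (auto simp: product_manifold_def)
  have "continuous_map (top_of_set U) (prod_topology (mtop M) (mtop N)) (\<lambda>u. (p u, q u))"
    using p'(4) q'(4) by (simp add: continuous_map_paired)
  then show "continuous_map (top_of_set U) (mtop (product_manifold M N)) (restrict (\<lambda>u. (p u, q u)) U)"
    by (auto simp: product_manifold_def elim: continuous_map_eq)
  fix k W \<kappa> assume "(k, W, \<kappa>) \<in> atlas (product_manifold M N)"
  then obtain m W1 \<phi> m' W2 \<psi> where c: "k = m + m'" "W = W1 \<times> W2"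
    "\<kappa> = (\<lambda>(x, y) i. if i < m then \<phi> x i else \<psi> y (i - m))"
    "(m, W1, \<phi>) \<in> atlas M" "(m', W2, \<psi>) \<in> atlas N"
    by (auto simp: product_manifold_def)
  define Z where "Z = {u \<in> U. p u \<in> W1} \<inter> {u \<in> U. q u \<in> W2}"
  have Z: "openin (Euclidean_space n) Z"
    unfolding Z_def using openin_plot_preimage[OF p chartedD(1)[OF M c(4)]]
      openin_plot_preimage[OF q chartedD(1)[OF N c(5)]] by (rule openin_Int)
  have eq: "{u \<in> U. restrict (\<lambda>u. (p u, q u)) U u \<in> W} = Z"
    by (auto simp: Z_def c)
  have 1: "smooth_on n Z m (\<phi> \<circ> p)" and 2: "smooth_on n Z m' (\<psi> \<circ> q)"
    using p'(5)[OF c(4)] q'(5)[OF c(5)] by (auto simp: Z_def elim: smooth_on_subset)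
  show "smooth_on n {u \<in> U. restrict (\<lambda>u. (p u, q u)) U u \<in> W} k (\<kappa> \<circ> restrict (\<lambda>u. (p u, q u)) U)"
    unfolding eq smooth_on_def
  proof (intro conjI allI impI)
    show "(\<kappa> \<circ> restrict (\<lambda>u. (p u, q u)) U) ` Z \<subseteq> Rn k"
      using smooth_on_in_Rn[OF 2] by (auto simp: Z_def c topspace_Euclidean_space)
    fix j assume j: "j < k"
    show "smooth_fun n Z (\<lambda>x. (\<kappa> \<circ> restrict (\<lambda>u. (p u, q u)) U) x j)"
    proof (cases "j < m")
      case True
      then show ?thesis
        by (intro smooth_fun_cong[OF Z smooth_on_component[OF 1 True]]) (auto simp: Z_def c)
    next
      case False
      then have "j - m < m'" using j c by auto
      from smooth_on_component[OF 2 this] show ?thesis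
        by (rule smooth_fun_cong[OF Z]) (use False in \<open>auto simp: Z_def c\<close>)
    qed
  qed
qed


section \<open>Centred charts\<close>

text \<open>The conditions on \<open>p\<close> and \<open>\<phi>\<close> only refer to plots, so that charts of the maximal atlas and
  linear coordinates of a vector space can be treated alike.\<close>

locale centred_chart =
  fixes M :: "'a manifold" and x :: 'a and n :: nat and W :: "(nat \<Rightarrow> real) set"
    and p :: "(nat \<Rightarrow> real) \<Rightarrow> 'a" and \<phi> :: "'a \<Rightarrow> nat \<Rightarrow> real"
  assumes charted: "charted M"
    and connected_W: "connected W" and zero_W: "0 \<in> W"
    and plot_p: "(n, W, p) \<in> standard_diffeology M" and p_zero: "p 0 = x"
    and open_image: "openin (mtop M) (p ` W)"
    and inverse: "\<And>w. w \<in> W \<Longrightarrow> \<phi> (p w) = w"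
    and smooth_coordinates: "\<And>d Z q. (d, Z, q) \<in> standard_diffeology M \<Longrightarrow>
      smooth_on d {z \<in> Z. q z \<in> p ` W} n (\<phi> \<circ> q)"
    and continuous_coordinates: "continuous_map (subtopology (mtop M) (p ` W)) (Euclidean_space n) \<phi>"
begin

lemma open_W: "openin (Euclidean_space n) W" and W_Rn: "W \<subseteq> Rn n"
  using standard_diffeologyD[OF plot_p] by auto

lemma p_carrier: "w \<in> W \<Longrightarrow> p w \<in> mcarrier M"
  using standard_diffeologyD(2)[OF plot_p] by auto

lemma x_carrier: "x \<in> mcarrier M"
  using p_carrier[OF zero_W] p_zero by simp

lemma phi_x: "\<phi> x = 0"
  using inverse[OF zero_W] p_zero by simp

lemma inverse': "y \<in> p ` W \<Longrightarrow> \<phi> y \<in> W" "y \<in> p ` W \<Longrightarrow> p (\<phi> y) = y"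
  using inverse by auto

lemma x_image: "x \<in> p ` W"
  using zero_W p_zero by auto

lemma open_preimage: "(d, Z, q) \<in> standard_diffeology M \<Longrightarrow> openin (Euclidean_space d) {z \<in> Z. q z \<in> p ` W}"
  by (rule openin_plot_preimage[OF _ open_image])

end

section \<open>Connected neighbourhoods and existence of centred charts\<close>

lemma starlike_connected:
  fixes U :: "(nat \<Rightarrow> real) set"
  assumes "\<And>x t. x \<in> U \<Longrightarrow> 0 \<le> t \<Longrightarrow> t \<le> 1 \<Longrightarrow> t *\<^sub>R x \<in> U"
  shows "connected U"
proof -
  define seg where "seg x = (\<lambda>t. t *\<^sub>R x) ` {0..1::real}" for x :: "nat \<Rightarrow> real"
  have "connected (seg x)" for x
    unfolding seg_def scaleR_fun_def
    by (intro connected_continuous_image continuous_intros) auto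
  moreover have "0 \<in> seg x" "x \<in> seg x" for x
    unfolding seg_def by (force intro: image_eqI[of _ _ 0] image_eqI[of _ _ 1])+
  moreover have "(\<Union>x\<in>U. seg x) = U"
    using \<open>\<And>x. x \<in> seg x\<close> assms by (auto simp: seg_def)
  ultimately show ?thesis
    using connected_Union[of "seg ` U"] by (metis (no_types, lifting) INT_I empty_iff imageE)
qed

lemma connected_cube: "connected (cube n 0 r)"
proof (rule starlike_connected)
  fix x and t :: real assume x: "x \<in> cube n 0 r" and t: "0 \<le> t" "t \<le> 1"
  have "\<bar>t * x i\<bar> \<le> \<bar>x i\<bar>" for i
    using t by (simp add: abs_mult mult_left_le_one_le)
  then show "t *\<^sub>R x \<in> cube n 0 r"
    using x unfolding cube_def by (auto simp: scaleR_fun_def topspace_Euclidean_space intro: le_less_trans)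
qed

lemma connected_Rn: "connected (Rn n)"
  by (rule starlike_connected) (rule Rn_scaleR)

lemma smooth_chartD:
  assumes "smooth_chart M (n, U, \<phi>)"
  shows "chart_on (mtop M) (n, U, \<phi>)"
    "(m, V, \<psi>) \<in> atlas M \<Longrightarrow> smooth_on n (\<phi> ` (U \<inter> V)) m (\<psi> \<circ> inv_into U \<phi>)"
    "(m, V, \<psi>) \<in> atlas M \<Longrightarrow> smooth_on m (\<psi> ` (V \<inter> U)) n (\<phi> \<circ> inv_into V \<psi>)"
  using assms by (auto simp: smooth_chart_def smooth_transition_def)

lemma atlas_smooth_chart: "is_manifold M \<Longrightarrow> c \<in> atlas M \<Longrightarrow> smooth_chart M c"
  by (auto simp: is_manifold_def smooth_chart_def)

lemma chart_image_open:
  assumes "chart_on X (n, U, \<phi>)" "openin X T"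
  shows "openin (Euclidean_space n) (\<phi> ` (U \<inter> T))"
proof -
  have "openin (subtopology X U) (U \<inter> T)"
    using assms(2) by (simp add: openin_subtopology_Int2)
  then have "openin (top_of_set (\<phi> ` U)) (\<phi> ` (U \<inter> T))"
    using homeomorphic_imp_open_map[OF chart_onD(4)[OF assms(1)]] by (simp add: open_map_def)
  then show ?thesis
    using chart_onD(2)[OF assms(1)] openin_trans unfolding openin_Rn_iff by blast
qed

lemma plot_chart_inverse:
  assumes M: "is_manifold M" and c: "smooth_chart M (n, U, \<phi>)"
  shows "(n, \<phi> ` U, restrict (inv_into U \<phi>) (\<phi> ` U)) \<in> standard_diffeology M"
proof (rule standard_diffeologyI)
  note c1 = smooth_chartD[OF c] and c2 = chart_onD[OF smooth_chartD(1)[OF c]]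
  have UM: "U \<subseteq> mcarrier M" using openin_subset[OF c2(1)] .
  show "openin (Euclidean_space n) (\<phi> ` U)" by (rule c2)
  show "restrict (inv_into U \<phi>) (\<phi> ` U) \<in> \<phi> ` U \<rightarrow>\<^sub>E mcarrier M"
    using UM c2(3) by auto
  obtain g where g: "homeomorphic_maps (subtopology (mtop M) U) (top_of_set (\<phi> ` U)) \<phi> g"
    using c2(4) unfolding homeomorphic_map_maps by blast
  have "continuous_map (top_of_set (\<phi> ` U)) (mtop M) g"
    using g by (auto simp: homeomorphic_maps_def continuous_map_in_subtopology)
  then show "continuous_map (top_of_set (\<phi> ` U)) (mtop M) (restrict (inv_into U \<phi>) (\<phi> ` U))"
    by (rule continuous_map_eq) (use g c2(3) UM in \<open>auto simp: homeomorphic_maps_def\<close>)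
  fix m V \<psi> assume d: "(m, V, \<psi>) \<in> atlas M"
  have eq: "{u \<in> \<phi> ` U. restrict (inv_into U \<phi>) (\<phi> ` U) u \<in> V} = \<phi> ` (U \<inter> V)" (is "?L = ?R")
  proof
    show "?L \<subseteq> ?R"
    proof
      fix u assume "u \<in> ?L"
      then have "u = \<phi> (inv_into U \<phi> u)" "inv_into U \<phi> u \<in> U \<inter> V"
        by (auto simp: f_inv_into_f inv_into_into)
      then show "u \<in> ?R" by blast
    qed
    show "?R \<subseteq> ?L"
    proof
      fix u assume "u \<in> ?R"
      then obtain y where "y \<in> U" "y \<in> V" "u = \<phi> y" by blast
      moreover from this have "inv_into U \<phi> u = y" "u \<in> \<phi> ` U" using c2(3) by simp_all
      ultimately show "u \<in> ?L" by simp
    qed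
  qed
  show "smooth_on n {u \<in> \<phi> ` U. restrict (inv_into U \<phi>) (\<phi> ` U) u \<in> V} m (\<psi> \<circ> restrict (inv_into U \<phi>) (\<phi> ` U))"
    unfolding eq
  proof (rule smooth_on_cong[OF chart_image_open[OF c1(1)] c1(2)[OF d]])
    show "openin (mtop M) V"
      by (rule chartedD(1)[OF is_manifold_charted[OF M] d])
  qed auto
qed

text \<open>By definition a plot is tested only on charts of the atlas. A chart of the maximal atlas
  is reached locally through an atlas chart and the transition map.\<close>

lemma smooth_chart_plot:
  assumes M: "is_manifold M" and c: "smooth_chart M (n, U, \<phi>)" and q: "(d, Z, q) \<in> standard_diffeology M"
  shows "smooth_on d {z \<in> Z. q z \<in> U} n (\<phi> \<circ> q)"
proof (rule smooth_on_locally)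
  note M' = chartedD[OF is_manifold_charted[OF M]]
  note U = chart_onD(1)[OF smooth_chartD(1)[OF c]]
  fix z assume z: "z \<in> {z \<in> Z. q z \<in> U}"
  then have "q z \<in> mcarrier M" using openin_subset[OF U] by auto
  then obtain m V \<psi> where e: "(m, V, \<psi>) \<in> atlas M" "q z \<in> V"
    using M'(3) by blast
  define T where "T = {z \<in> Z. q z \<in> U \<inter> V}"
  have T: "openin (Euclidean_space d) T"
    unfolding T_def by (rule openin_plot_preimage[OF q openin_Int[OF U M'(1)[OF e(1)]]])
  have VU: "openin (Euclidean_space m) (\<psi> ` (V \<inter> U))"
    using chart_image_open[OF smooth_chartD(1)[OF atlas_smooth_chart[OF M e(1)]] U] .
  have "smooth_on d T n ((\<phi> \<circ> inv_into V \<psi>) \<circ> (\<psi> \<circ> q))"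
    by (rule smooth_on_comp[OF T VU _ _ smooth_chartD(3)[OF c e(1)]])
      (auto simp: T_def intro: smooth_on_subset[OF standard_diffeologyD(5)[OF q e(1)]])
  then have "smooth_on d T n (\<phi> \<circ> q)"
    by (rule smooth_on_cong[OF T]) (use M'(2)[OF e(1)] in \<open>auto simp: T_def\<close>)
  then show "\<exists>T. openin (Euclidean_space d) T \<and> z \<in> T \<and> smooth_on d T n (\<phi> \<circ> q)"
    using T z e by (intro exI[of _ T]) (auto simp: T_def)
qed (use standard_diffeologyD(3)[OF q] in auto)

text \<open>Restricting to a cube around \<open>\<phi> x\<close> makes the parameter domain
  connected, so that the inverse chart is a pointed plot. The last two conclusions keep the original
  chart visible, which is needed to recognize a submanifold in the centred chart.\<close>

lemma centred_chart_exists: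
  assumes M: "is_manifold M" and c: "smooth_chart M (n, U, \<phi>)" and x: "x \<in> U"
  obtains r p where "r > 0" "centred_chart M x n (cube n 0 r) p (\<lambda>y. \<phi> y - \<phi> x)"
    "\<And>w. w \<in> cube n 0 r \<Longrightarrow> p w \<in> U" "\<And>w. w \<in> cube n 0 r \<Longrightarrow> \<phi> (p w) = w + \<phi> x"
proof -
  note c2 = chart_onD[OF smooth_chartD(1)[OF c]]
  have aR: "\<phi> x \<in> Rn n" and aU: "\<phi> x \<in> \<phi> ` U"
    using openin_Rn_subset[OF c2(2)] x by auto
  obtain r where r: "r > 0" "cube n (\<phi> x) r \<subseteq> \<phi> ` U"
    using cube_in_open[OF c2(2) aU] .
  have cube_shift: "w \<in> cube n 0 r \<longleftrightarrow> w + \<phi> x \<in> cube n (\<phi> x) r" for w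
    using aR by (auto simp: cube_def topspace_Euclidean_space)
  define W where "W = cube n 0 r"
  define p where "p = restrict (restrict (inv_into U \<phi>) (\<phi> ` U) \<circ> (\<lambda>w. w + \<phi> x)) W"
  have shiftU: "w + \<phi> x \<in> \<phi> ` U" if "w \<in> W" for w
    using that cube_shift r by (auto simp: W_def)
  have p: "p w = inv_into U \<phi> (w + \<phi> x)" if "w \<in> W" for w
    using that shiftU[OF that] by (simp add: p_def)
  have pU: "p w \<in> U" and \<phi>p: "\<phi> (p w) = w + \<phi> x" if "w \<in> W" for w
    using shiftU[OF that] p[OF that] by (auto intro: inv_into_into f_inv_into_f)
  have oW: "openin (Euclidean_space n) W"
    by (simp add: W_def openin_cube)
  have plot: "(n, W, p) \<in> standard_diffeology M"
    unfolding p_def using shiftU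
    by (intro plot_precompose[OF is_manifold_charted[OF M] plot_chart_inverse[OF M c] oW smooth_on_translate[OF oW aR]]) auto
  have cont: "continuous_map (subtopology (mtop M) U) (Euclidean_space n) \<phi>"
    using homeomorphic_imp_continuous_map[OF c2(4)] openin_Rn_subset[OF c2(2)]
    by (auto simp: continuous_map_Euclidean_space continuous_map_in_subtopology)
  have img: "p ` W = {u \<in> U. \<phi> u \<in> cube n (\<phi> x) r}"
  proof (intro equalityI subsetI)
    fix y assume "y \<in> p ` W"
    then show "y \<in> {u \<in> U. \<phi> u \<in> cube n (\<phi> x) r}"
      using pU \<phi>p cube_shift by (auto simp: W_def)
  next
    fix y assume y: "y \<in> {u \<in> U. \<phi> u \<in> cube n (\<phi> x) r}"
    then have w: "\<phi> y - \<phi> x \<in> W" using cube_shift[of "\<phi> y - \<phi> x"] by (simp add: W_def)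
    have "p (\<phi> y - \<phi> x) = y" using p[OF w] y c2(3) by simp
    then show "y \<in> p ` W" using w by force
  qed
  have pWU: "p ` W \<subseteq> U" using pU by auto
  have "centred_chart M x n W p (\<lambda>y. \<phi> y - \<phi> x)"
  proof
    show "charted M" by (rule is_manifold_charted[OF M])
    show "connected W" "0 \<in> W" using r by (auto simp: W_def connected_cube centre_in_cube)
    then show "p 0 = x" using p c2(3) x by simp
    show "(n, W, p) \<in> standard_diffeology M" by (rule plot)
    have "openin (subtopology (mtop M) U) {u \<in> topspace (subtopology (mtop M) U). \<phi> u \<in> cube n (\<phi> x) r}"
      by (rule openin_continuous_map_preimage[OF cont openin_cube])
    moreover have "{u \<in> topspace (subtopology (mtop M) U). \<phi> u \<in> cube n (\<phi> x) r} = p ` W"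
      using openin_subset[OF c2(1)] img by auto
    ultimately show "openin (mtop M) (p ` W)"
      using openin_trans_full[OF _ c2(1)] by metis
    show "\<phi> (p w) - \<phi> x = w" if "w \<in> W" for w
      using \<phi>p[OF that] by simp
    show "smooth_on d {z \<in> Z. q z \<in> p ` W} n ((\<lambda>y. \<phi> y - \<phi> x) \<circ> q)"
      if q: "(d, Z, q) \<in> standard_diffeology M" for d Z q
    proof -
      have o: "openin (Euclidean_space d) {z \<in> Z. q z \<in> p ` W}"
        by (rule openin_plot_preimage[OF q \<open>openin (mtop M) (p ` W)\<close>])
      have s: "smooth_on d {z \<in> Z. q z \<in> p ` W} n (\<phi> \<circ> q)"
        by (rule smooth_on_subset[OF smooth_chart_plot[OF M c q]]) (use pWU in auto)
      have "- \<phi> x \<in> Rn n" using aR by (simp add: topspace_Euclidean_space)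
      from smooth_on_comp[OF o openin_Rn s _ smooth_on_translate[OF openin_Rn this]]
      have "smooth_on d {z \<in> Z. q z \<in> p ` W} n ((\<lambda>w. w + - \<phi> x) \<circ> (\<phi> \<circ> q))"
        using smooth_on_in_Rn[OF s] by auto
      then show ?thesis by (simp add: comp_def)
    qed
    show "continuous_map (subtopology (mtop M) (p ` W)) (Euclidean_space n) (\<lambda>y. \<phi> y - \<phi> x)"
    proof -
      have "continuous_map (subtopology (mtop M) (p ` W)) (Euclidean_space n) \<phi>"
        using cont pWU continuous_map_from_subtopology_mono by blast
      moreover have "continuous_map (subtopology (mtop M) (p ` W)) (Euclidean_space n) (\<lambda>y. \<phi> x)"
        using aR by simp
      ultimately have "continuous_map (subtopology (mtop M) (p ` W)) (Euclidean_space n) (\<lambda>y i. \<phi> y i - \<phi> x i)"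
        by (rule continuous_map_Euclidean_space_diff)
      then show ?thesis by (simp add: fun_diff_def)
    qed
  qed
  then show ?thesis
    using that[of r p] r pU \<phi>p by (simp add: W_def)
qed

section \<open>Quotient vector spaces\<close>

definition fibre :: "'v set \<Rightarrow> ('v \<Rightarrow> 'w) \<Rightarrow> 'w \<Rightarrow> 'v set"
  where "fibre F L y = {a \<in> F. L a = y}"

text \<open>Congruence modulo the kernel of \<open>L\<close> means equal values of \<open>L\<close>,
  so the classes are the fibres, indexed by the image. The operations on sets of representatives
  become those of the image.\<close>

lemma quotient_space_as_fibres:
  assumes L: "linear_on F L" and F: "subspace F" and R: "R = {a \<in> F. L a = 0}"
  defines "C \<equiv> fibre F L"
  shows "vcarrier (quotient_space F R) = C ` L ` F" "inj_on C (L ` F)"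
    "y \<in> L ` F \<Longrightarrow> z \<in> L ` F \<Longrightarrow> vadd (quotient_space F R) (C y) (C z) = C (y + z)"
    "y \<in> L ` F \<Longrightarrow> vscale (quotient_space F R) c (C y) = C (c *\<^sub>R y)"
proof -
  have diff: "L (a - b) = L a - L b" if "a \<in> F" "b \<in> F" for a b
    by (rule linear_on_diff[OF L F that])
  have add: "L (a + b) = L a + L b" if "a \<in> F" "b \<in> F" for a b
    using L that by (simp add: linear_on_def)
  have scale: "L (c *\<^sub>R a) = c *\<^sub>R L a" if "a \<in> F" for c a
    using L that by (simp add: linear_on_def)
  have rel: "{(a, b). a \<in> F \<and> b \<in> F \<and> a - b \<in> R} = {(a, b). a \<in> F \<and> b \<in> F \<and> L b = L a}"
    using diff subspace_diff[OF F] by (auto simp: R)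
  have cls: "{(a, b). a \<in> F \<and> b \<in> F \<and> a - b \<in> R} `` {a} = C (L a)" if "a \<in> F" for a
    unfolding rel using that by (auto simp: C_def fibre_def)
  show "vcarrier (quotient_space F R) = C ` L ` F"
    unfolding quotient_space_def quotient_def using cls by (auto simp: image_iff)
  show "inj_on C (L ` F)"
    by (rule inj_onI) (auto simp: C_def fibre_def)
  show "vadd (quotient_space F R) (C y) (C z) = C (y + z)" if yz: "y \<in> L ` F" "z \<in> L ` F"
  proof -
    obtain a where a: "a \<in> F" "y = L a" using yz by blast
    have "\<exists>u v. c = u + v \<and> u \<in> C y \<and> v \<in> C z" if "c \<in> C (y + z)" for c
    proof (intro exI conjI)
      show "c = a + (c - a)" by simp
      show "a \<in> C y" using a by (simp add: C_def fibre_def)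
      show "c - a \<in> C z" using that a diff subspace_diff[OF F] by (simp add: C_def fibre_def)
    qed
    then show ?thesis
      using add subspace_add[OF F] by (auto simp: quotient_space_def C_def fibre_def)
  qed
  show "vscale (quotient_space F R) c (C y) = C (c *\<^sub>R y)" if y: "y \<in> L ` F"
  proof -
    obtain a where a: "a \<in> F" "y = L a" using y by blast
    have "\<exists>u v. d = c *\<^sub>R u + v \<and> u \<in> C y \<and> v \<in> R" if "d \<in> C (c *\<^sub>R y)" for d
    proof (intro exI conjI)
      show "d = c *\<^sub>R a + (d - c *\<^sub>R a)" by simp
      show "a \<in> C y" using a by (simp add: C_def fibre_def)
      show "d - c *\<^sub>R a \<in> R"
        using that a diff scale subspace_diff[OF F] subspace_scale[OF F] by (simp add: C_def fibre_def R)
    qed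
    moreover have "c *\<^sub>R u + v \<in> C (c *\<^sub>R y)" if "u \<in> C y" "v \<in> R" for u v
      using that add scale subspace_add[OF F] subspace_scale[OF F] by (simp add: C_def fibre_def R)
    ultimately show ?thesis
      by (auto simp: quotient_space_def)
  qed
qed

lemma subspace_linear_on_image:
  assumes "linear_on F L" "subspace F"
  shows "subspace (L ` F)"
  unfolding subspace_def
proof (intro conjI ballI allI)
  show "0 \<in> L ` F"
    using linear_on_zero[OF assms(1) subspace_0[OF assms(2)]] subspace_0[OF assms(2)] by force
next
  fix y z assume "y \<in> L ` F" "z \<in> L ` F"
  then obtain a b where ab: "a \<in> F" "b \<in> F" "y = L a" "z = L b" by blast
  then have "y + z = L (a + b)" using assms(1) by (simp add: linear_on_def)
  then show "y + z \<in> L ` F" using subspace_add[OF assms(2) ab(1,2)] by blast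
next
  fix c y assume "y \<in> L ` F"
  then obtain a where a: "a \<in> F" "y = L a" by blast
  then have "c *\<^sub>R y = L (c *\<^sub>R a)" using assms(1) by (simp add: linear_on_def)
  then show "c *\<^sub>R y \<in> L ` F" using subspace_scale[OF assms(2) a(1)] by blast
qed

text \<open>Both quotients are in bijection with the same image. A common target of \<open>L\<close>
  and \<open>L'\<close> takes the place of a map from \<open>F\<close> to \<open>F'\<close>.\<close>

lemma quotient_space_iso:
  assumes L: "linear_on F L" "subspace F" "R = {a \<in> F. L a = 0}"
    and L': "linear_on F' L'" "subspace F'" "R' = {a \<in> F'. L' a = 0}"
    and image: "L ` F = L' ` F'"
  shows "vec_space_iso (quotient_space F R) (quotient_space F' R')"
proof -
  define C where "C = fibre F L"
  define C' where "C' = fibre F' L'"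
  define Y where "Y = L ` F"
  note q = quotient_space_as_fibres[OF L, folded C_def Y_def]
  note q' = quotient_space_as_fibres[OF L', folded C'_def image, folded Y_def]
  have Y: "subspace Y"
    unfolding Y_def by (rule subspace_linear_on_image[OF L(1,2)])
  define h where "h = C' \<circ> inv_into Y C"
  have h: "h (C y) = C' y" if "y \<in> Y" for y
    using that q(2) by (simp add: h_def)
  have "bij_betw h (C ` Y) (C' ` Y)"
    unfolding h_def by (intro bij_betw_trans[of _ _ Y] bij_betw_inv_into) (use q(2) q'(2) in \<open>auto simp: bij_betw_def\<close>)
  moreover have "h (vadd (quotient_space F R) a b) = vadd (quotient_space F' R') (h a) (h b)"
    if "a \<in> C ` Y" "b \<in> C ` Y" for a b
    using that q(3) q'(3) h subspace_add[OF Y] by auto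
  moreover have "h (vscale (quotient_space F R) c a) = vscale (quotient_space F' R') c (h a)"
    if "a \<in> C ` Y" for c a
    using that q(4) q'(4) h subspace_scale[OF Y] by auto
  ultimately show ?thesis
    unfolding vec_space_iso_def q(1) q'(1) by blast
qed


section \<open>Internal tangent spaces through a covering plot\<close>

lemma subspace_tangent_sum: "subspace (tangent_sum D x)"
  unfolding subspace_def
proof (intro conjI ballI allI)
  show "0 \<in> tangent_sum D x" by (simp add: tangent_sum_def)
next
  fix a b assume a: "a \<in> tangent_sum D x" and b: "b \<in> tangent_sum D x"
  have "{P. (a + b) P \<noteq> 0} \<subseteq> {P. a P \<noteq> 0} \<union> {P. b P \<noteq> 0}" by auto
  then have "finite {P. (a + b) P \<noteq> 0}"
    by (rule finite_subset) (use a b in \<open>auto simp: tangent_sum_def\<close>)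
  then show "a + b \<in> tangent_sum D x"
    using a b by (auto simp: tangent_sum_def intro: Rn_add)
next
  fix c :: real and a assume a: "a \<in> tangent_sum D x"
  note eq = scaleR_fun_apply[of c a]
  have "{P. (c *\<^sub>R a) P \<noteq> 0} \<subseteq> {P. a P \<noteq> 0}" unfolding eq by auto
  then have "finite {P. (c *\<^sub>R a) P \<noteq> 0}"
    by (rule finite_subset) (use a in \<open>auto simp: tangent_sum_def\<close>)
  then show "c *\<^sub>R a \<in> tangent_sum D x"
    using a unfolding tangent_sum_def mem_Collect_eq eq by (auto intro: Rn_scaleR)
qed

lemma summand_tangent_sum:
  assumes "P \<in> pointed_plots D x" "v \<in> Rn (fst P)"
  shows "summand P v \<in> tangent_sum D x"
proof -
  have "{Q. summand P v Q \<noteq> 0} \<subseteq> {P}" by (auto simp: summand_def)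
  then have "finite {Q. summand P v Q \<noteq> 0}" by (rule finite_subset) simp
  then show ?thesis using assms by (auto simp: tangent_sum_def summand_def)
qed

lemma linear_summand: "linear (summand P)"
proof (rule linearI)
  show "summand P (v + w) = summand P v + summand P w" for v w
    by (simp add: summand_def fun_eq_iff)
  show "summand P (c *\<^sub>R v) = c *\<^sub>R summand P v" for c v
  proof
    fix Q show "summand P (c *\<^sub>R v) Q = (c *\<^sub>R summand P v) Q"
      by (simp add: summand_def scaleR_fun_apply)
  qed
qed

lemma tangent_sum_expand:
  assumes "\<omega> \<in> tangent_sum D x"
  shows "\<omega> = (\<Sum>P | \<omega> P \<noteq> 0. summand P (\<omega> P))"
proof
  fix Q
  have fin: "finite {P. \<omega> P \<noteq> 0}" using assms by (simp add: tangent_sum_def)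
  have "(\<Sum>P | \<omega> P \<noteq> 0. summand P (\<omega> P)) Q = (\<Sum>P | \<omega> P \<noteq> 0. if Q = P then \<omega> P else 0)"
    by (simp only: sum_fun_apply summand_def)
  also have "\<dots> = \<omega> Q"
    using fin by (simp add: sum.delta)
  finally show "\<omega> Q = (\<Sum>P | \<omega> P \<noteq> 0. summand P (\<omega> P)) Q" by simp
qed

text \<open>A representative of a germ of smooth maps into \<open>W\<close> that preserve the
  origin. Its domain \<open>Z\<close> stays explicit, since identities between germs are tested
  pointwise on it.\<close>

definition germ :: "nat \<Rightarrow> (nat \<Rightarrow> real) set \<Rightarrow> nat \<Rightarrow> (nat \<Rightarrow> real) set \<Rightarrow> ((nat \<Rightarrow> real) \<Rightarrow> nat \<Rightarrow> real) \<Rightarrow> bool"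
  where "germ m Z n W g \<longleftrightarrow>
    openin (Euclidean_space m) Z \<and> 0 \<in> Z \<and> smooth_on m Z n g \<and> g ` Z \<subseteq> W \<and> g 0 = 0"

lemma germ_subset: "germ m Z n W g \<Longrightarrow> openin (Euclidean_space m) Z' \<Longrightarrow> 0 \<in> Z' \<Longrightarrow> Z' \<subseteq> Z \<Longrightarrow> germ m Z' n W g"
  unfolding germ_def using smooth_on_subset by blast

lemma germ_jacobian_Rn: "germ m Z n W g \<Longrightarrow> jacobian m g v \<in> Rn n"
  unfolding germ_def using jacobian_Rn smooth_on_in_Rn by metis

text \<open>What the relations identify within one chart: derivatives of germs that become equal in
  the quotient. The parameter \<open>E\<close> is equality after projection in
  \<open>covering_plot\<close> and an equivalence relation before projection in the
  applications.\<close>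

definition germ_pair_differences ::
    "((nat \<Rightarrow> real) \<Rightarrow> (nat \<Rightarrow> real) \<Rightarrow> bool) \<Rightarrow> nat \<Rightarrow> (nat \<Rightarrow> real) set \<Rightarrow> (nat \<Rightarrow> real) set"
  where "germ_pair_differences E n W = {jacobian m g v - jacobian m h v | m Z g h v.
    germ m Z n W g \<and> germ m Z n W h \<and> v \<in> Rn m \<and> (\<forall>z\<in>Z. E (g z) (h z))}"

text \<open>One plot controls the whole direct sum if every pointed plot factors through it near 0.
  The map \<open>\<beta>\<close> models the answer: by \<open>\<beta>_invariant\<close> and
  \<open>\<beta>_kernel\<close> its kernel on R^n is the span of the differences, so the internal
  tangent space is a copy of the image of \<open>\<beta>\<close>. Precomposition is demanded on
  cubes because pointed plots have connected domains.\<close>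

locale covering_plot =
  fixes D :: "'x plot set" and x :: 'x and n :: nat and W :: "(nat \<Rightarrow> real) set"
    and p :: "(nat \<Rightarrow> real) \<Rightarrow> 'x" and \<beta> :: "(nat \<Rightarrow> real) \<Rightarrow> 'e::real_vector"
  assumes open_W: "openin (Euclidean_space n) W"
    and pointed: "(n, W, p) \<in> pointed_plots D x"
    and precompose: "\<And>m r g. r > 0 \<Longrightarrow> germ m (cube m 0 r) n W g \<Longrightarrow>
      (m, cube m 0 r, restrict (p \<circ> g) (cube m 0 r)) \<in> D"
    and factor: "\<And>m U q. (m, U, q) \<in> pointed_plots D x \<Longrightarrow>
      \<exists>Z g. germ m Z n W g \<and> Z \<subseteq> U \<and> (\<forall>z\<in>Z. q z = p (g z))"
    and linear_\<beta>: "linear_on (Rn n) \<beta>"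
    and \<beta>_invariant: "\<And>m Z g h v. germ m Z n W g \<Longrightarrow> germ m Z n W h \<Longrightarrow> v \<in> Rn m \<Longrightarrow>
      (\<And>z. z \<in> Z \<Longrightarrow> p (g z) = p (h z)) \<Longrightarrow> \<beta> (jacobian m g v) = \<beta> (jacobian m h v)"
    and \<beta>_kernel: "\<And>w. w \<in> Rn n \<Longrightarrow> \<beta> w = 0 \<Longrightarrow> w \<in> span (germ_pair_differences (\<lambda>a b. p a = p b) n W)"
begin

abbreviation "P0 \<equiv> (n, W, p)"

lemma zero_W: "0 \<in> W" and p_zero: "p 0 = x"
  using pointed by (auto simp: pointed_plots_def)

text \<open>An arbitrary factorization through \<open>p\<close>. Its derivative matters only under
  \<open>\<beta>\<close>, where the choice disappears by \<open>tangent_value_eq\<close>.\<close>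

definition lift_germ :: "'x plot \<Rightarrow> (nat \<Rightarrow> real) \<Rightarrow> nat \<Rightarrow> real"
  where "lift_germ P = (SOME g. \<exists>Z. germ (fst P) Z n W g \<and> Z \<subseteq> fst (snd P) \<and> (\<forall>z\<in>Z. snd (snd P) z = p (g z)))"

lemma lift_germ:
  assumes "(m, U, q) \<in> pointed_plots D x"
  obtains Z where "germ m Z n W (lift_germ (m, U, q))" "Z \<subseteq> U" "\<And>z. z \<in> Z \<Longrightarrow> q z = p (lift_germ (m, U, q) z)"
proof -
  have "\<exists>g Z. germ m Z n W g \<and> Z \<subseteq> U \<and> (\<forall>z\<in>Z. q z = p (g z))"
    using factor[OF assms] by blast
  from someI_ex[OF this] show ?thesis
    using that unfolding lift_germ_def by auto
qed

definition tangent_value :: "'x plot \<Rightarrow> (nat \<Rightarrow> real) \<Rightarrow> 'e"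
  where "tangent_value P v = \<beta> (jacobian (fst P) (lift_germ P) v)"

lemma tangent_value_Rn: "P \<in> pointed_plots D x \<Longrightarrow> jacobian (fst P) (lift_germ P) v \<in> Rn n"
  by (metis germ_jacobian_Rn lift_germ prod.collapse)

lemma tangent_value_add:
  "P \<in> pointed_plots D x \<Longrightarrow> tangent_value P (v + w) = tangent_value P v + tangent_value P w"
  using linear_\<beta> tangent_value_Rn unfolding linear_on_def tangent_value_def by (simp add: jacobian_add)

lemma tangent_value_scaleR:
  "P \<in> pointed_plots D x \<Longrightarrow> tangent_value P (c *\<^sub>R v) = c *\<^sub>R tangent_value P v"
  using linear_\<beta> tangent_value_Rn unfolding linear_on_def tangent_value_def by (simp add: jacobian_scaleR)

lemma tangent_value_zero [simp]: "tangent_value P 0 = 0"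
  unfolding tangent_value_def using linear_on_zero[OF linear_\<beta>] by simp

definition tangent_map :: "('x plot \<Rightarrow> nat \<Rightarrow> real) \<Rightarrow> 'e"
  where "tangent_map \<omega> = (\<Sum>P | \<omega> P \<noteq> 0. tangent_value P (\<omega> P))"

lemma tangent_map_superset:
  assumes "finite I" "{P. \<omega> P \<noteq> 0} \<subseteq> I"
  shows "tangent_map \<omega> = (\<Sum>P\<in>I. tangent_value P (\<omega> P))"
  unfolding tangent_map_def by (rule sum.mono_neutral_left[OF assms]) auto

lemma tangent_map_linear: "linear_on (tangent_sum D x) tangent_map"
  unfolding linear_on_def
proof (intro conjI ballI allI)
  fix a b assume a: "a \<in> tangent_sum D x" and b: "b \<in> tangent_sum D x"
  define I where "I = {P. a P \<noteq> 0} \<union> {P. b P \<noteq> 0}"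
  have I: "finite I" "I \<subseteq> pointed_plots D x"
    using a b unfolding I_def tangent_sum_def by auto
  have "tangent_map (a + b) = (\<Sum>P\<in>I. tangent_value P (a P + b P))"
  proof -
    have "{P. (a + b) P \<noteq> 0} \<subseteq> I" by (auto simp: I_def)
    from tangent_map_superset[where \<omega> = "a + b", OF I(1) this] show ?thesis by (simp only: plus_fun_apply)
  qed
  also have "\<dots> = (\<Sum>P\<in>I. tangent_value P (a P) + tangent_value P (b P))"
    by (rule sum.cong) (use I tangent_value_add in auto)
  also have "\<dots> = tangent_map a + tangent_map b"
    unfolding sum.distrib using tangent_map_superset[OF I(1), of a] tangent_map_superset[OF I(1), of b]
    by (simp add: I_def)
  finally show "tangent_map (a + b) = tangent_map a + tangent_map b" .
next
  fix c :: real and a assume a: "a \<in> tangent_sum D x"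
  define I where "I = {P. a P \<noteq> 0}"
  have I: "finite I" "I \<subseteq> pointed_plots D x"
    using a unfolding I_def tangent_sum_def by auto
  note eq = scaleR_fun_apply[of c a]
  have "tangent_map (c *\<^sub>R a) = (\<Sum>P\<in>I. tangent_value P (c *\<^sub>R a P))"
  proof -
    have "{P. (c *\<^sub>R a) P \<noteq> 0} \<subseteq> I" unfolding eq by (auto simp: I_def)
    from tangent_map_superset[where \<omega> = "c *\<^sub>R a", OF I(1) this] show ?thesis unfolding eq .
  qed
  also have "\<dots> = (\<Sum>P\<in>I. c *\<^sub>R tangent_value P (a P))"
    by (rule sum.cong) (use I tangent_value_scaleR in auto)
  also have "\<dots> = c *\<^sub>R tangent_map a"
    by (simp add: tangent_map_def I_def scaleR_sum_right)
  finally show "tangent_map (c *\<^sub>R a) = c *\<^sub>R tangent_map a" .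
qed

lemma tangent_map_summand: "tangent_map (summand P v) = tangent_value P v"
proof -
  have "tangent_map (summand P v) = (\<Sum>Q\<in>{P}. tangent_value Q (summand P v Q))"
    by (rule tangent_map_superset) (auto simp: summand_def)
  then show ?thesis by (simp add: summand_def)
qed

lemma germ_id: "germ n W n W (\<lambda>w. w)"
  using open_W zero_W smooth_on_id[OF open_W] by (auto simp: germ_def)

text \<open>Two lifts of one plot agree after \<open>p\<close> on their common domain, which is the
  situation of \<open>\<beta>_invariant\<close>.\<close>

lemma tangent_value_eq:
  assumes P: "(m, U, q) \<in> pointed_plots D x" and g: "germ m Z n W g" "\<And>z. z \<in> Z \<Longrightarrow> q z = p (g z)"
    and v: "v \<in> Rn m"
  shows "tangent_value (m, U, q) v = \<beta> (jacobian m g v)"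
proof -
  obtain Z' where Z': "germ m Z' n W (lift_germ (m, U, q))" "\<And>z. z \<in> Z' \<Longrightarrow> q z = p (lift_germ (m, U, q) z)"
    using lift_germ[OF P] by metis
  have o: "openin (Euclidean_space m) (Z \<inter> Z')" "0 \<in> Z \<inter> Z'"
    using g Z' by (auto simp: germ_def)
  have "\<beta> (jacobian m (lift_germ (m, U, q)) v) = \<beta> (jacobian m g v)"
  proof (rule \<beta>_invariant[OF germ_subset[OF Z'(1) o] germ_subset[OF g(1) o] v])
    fix z assume "z \<in> Z \<inter> Z'"
    then show "p (lift_germ (m, U, q) z) = p (g z)"
      using Z'(2)[of z] g(2)[of z] by simp
  qed auto
  then show ?thesis by (simp add: tangent_value_def)
qed

lemma tangent_value_P0: "w \<in> Rn n \<Longrightarrow> tangent_value P0 w = \<beta> w"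
  using tangent_value_eq[OF pointed germ_id] by (simp add: jacobian_id)

text \<open>The generators of \<open>tangent_relations\<close>; the bound names \<open>n\<close>,
  \<open>W\<close> and \<open>p\<close> shadow the parameters of the locale.\<close>

definition relators :: "('x plot \<Rightarrow> nat \<Rightarrow> real) set"
  where "relators = {summand (n, U, p) v - summand (m, V, q) (jacobian n g v) | n U p m V q v g W.
      (n, U, p) \<in> pointed_plots D x \<and> (m, V, q) \<in> pointed_plots D x \<and>
      v \<in> topspace (Euclidean_space n) \<and>
      openin (Euclidean_space n) W \<and> 0 \<in> W \<and> W \<subseteq> U \<and>
      smooth_on n W m g \<and> g ` W \<subseteq> V \<and> g 0 = 0 \<and> (\<forall>w\<in>W. p w = q (g w))}"

lemma relations_eq: "tangent_relations D x = span relators"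
  unfolding tangent_relations_def relators_def ..

lemma relatorI:
  assumes "(m, U, q) \<in> pointed_plots D x" "v \<in> Rn m" "germ m Z n W g" "Z \<subseteq> U"
    "\<And>z. z \<in> Z \<Longrightarrow> q z = p (g z)"
  shows "summand (m, U, q) v - summand P0 (jacobian m g v) \<in> tangent_relations D x"
  unfolding relations_eq
proof (rule span_base)
  show "summand (m, U, q) v - summand P0 (jacobian m g v) \<in> relators"
    unfolding relators_def mem_Collect_eq
    by (rule exI[of _ m], rule exI[of _ U], rule exI[of _ q], rule exI[of _ n], rule exI[of _ W], rule exI[of _ p],
        rule exI[of _ v], rule exI[of _ g], rule exI[of _ Z]) (use assms pointed in \<open>simp add: germ_def\<close>)
qed

text \<open>If \<open>q = s \<circ> g\<close> near 0, then a lift of \<open>s\<close> composed with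
  \<open>g\<close> is a lift of \<open>q\<close>; by the chain rule the two terms of a generator
  have the same value.\<close>

lemma relators_kernel: "relators \<subseteq> {\<omega> \<in> tangent_sum D x. tangent_map \<omega> = 0}"
proof
  fix \<omega> assume "\<omega> \<in> relators"
  then show "\<omega> \<in> {\<omega> \<in> tangent_sum D x. tangent_map \<omega> = 0}"
    unfolding relators_def mem_Collect_eq
  proof (elim exE conjE)
  fix m U q k V s v g T assume r: "\<omega> = summand (m, U, q) v - summand (k, V, s) (jacobian m g v)"
    "(m, U, q) \<in> pointed_plots D x" "(k, V, s) \<in> pointed_plots D x" "v \<in> Rn m"
    "openin (Euclidean_space m) T" "0 \<in> T" "T \<subseteq> U" "smooth_on m T k g" "g ` T \<subseteq> V" "g 0 = 0"
    "\<forall>w\<in>T. q w = s (g w)"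
  have jk: "jacobian m g v \<in> Rn k"
    by (rule jacobian_Rn[OF r(5,6) smooth_on_in_Rn[OF r(8)]])
  have t1: "summand (m, U, q) v \<in> tangent_sum D x" and t2: "summand (k, V, s) (jacobian m g v) \<in> tangent_sum D x"
    by (rule summand_tangent_sum; use r jk in simp)+
  obtain Z where Z: "germ k Z n W (lift_germ (k, V, s))" "\<And>z. z \<in> Z \<Longrightarrow> s z = p (lift_germ (k, V, s) z)"
    using lift_germ[OF r(3)] by metis
  define T' where "T' = {w \<in> T. g w \<in> Z}"
  have T': "openin (Euclidean_space m) T'"
    unfolding T'_def by (rule openin_smooth_preimage[OF r(5,8)]) (use Z(1) in \<open>simp add: germ_def\<close>)
  have 0: "0 \<in> T'" using r Z by (simp add: T'_def germ_def)
  have sg: "smooth_on m T' k g" by (rule smooth_on_subset[OF r(8)]) (auto simp: T'_def)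
  have gZ: "g ` T' \<subseteq> Z" by (auto simp: T'_def)
  have "germ m T' n W (lift_germ (k, V, s) \<circ> g)"
    unfolding germ_def
  proof (intro conjI T' 0)
    show "smooth_on m T' n (lift_germ (k, V, s) \<circ> g)"
      by (rule smooth_on_comp[OF T' _ sg gZ]) (use Z in \<open>auto simp: germ_def\<close>)
  qed (use Z gZ r(10) in \<open>auto simp: germ_def\<close>)
  then have "tangent_value (m, U, q) v = \<beta> (jacobian m (lift_germ (k, V, s) \<circ> g) v)"
    by (rule tangent_value_eq[OF r(2) _ _ r(4)]) (use r(11) Z(2) in \<open>simp_all add: T'_def\<close>)
  also have "jacobian m (lift_germ (k, V, s) \<circ> g) v = jacobian k (lift_germ (k, V, s)) (jacobian m g v)"
    by (rule jacobian_comp[OF T' sg gZ _ _ 0 r(10)]) (use Z in \<open>auto simp: germ_def\<close>)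
  finally have "tangent_value (m, U, q) v = tangent_value (k, V, s) (jacobian m g v)"
    by (simp add: tangent_value_def)
  then show "\<omega> \<in> tangent_sum D x \<and> tangent_map \<omega> = 0"
    using linear_on_diff[OF tangent_map_linear subspace_tangent_sum t1 t2] subspace_diff[OF subspace_tangent_sum t1 t2]
    by (simp add: r(1) tangent_map_summand)
  qed
qed

lemma tangent_relations_kernel: "tangent_relations D x \<subseteq> {\<omega> \<in> tangent_sum D x. tangent_map \<omega> = 0}"
  unfolding relations_eq
proof (rule span_minimal[OF relators_kernel])
  show "subspace {\<omega> \<in> tangent_sum D x. tangent_map \<omega> = 0}"
    using subspace_tangent_sum[of D x] tangent_map_linear linear_on_zero[OF tangent_map_linear]
    unfolding subspace_def linear_on_def by simp
qed

text \<open>The plot \<open>p \<circ> g = p \<circ> h\<close>, on a small cube, is related to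
  \<open>P0\<close> through \<open>g\<close> and also through \<open>h\<close>; subtracting the two
  generators cancels the plot.\<close>

lemma germ_difference_relation:
  assumes g: "germ m Z n W g" and h: "germ m Z n W h" and v: "v \<in> Rn m"
    and gh: "\<And>z. z \<in> Z \<Longrightarrow> p (g z) = p (h z)"
  shows "summand P0 (jacobian m g v - jacobian m h v) \<in> tangent_relations D x"
proof -
  obtain r where r: "r > 0" "cube m 0 r \<subseteq> Z"
    using g cube_in_open[of m Z 0] unfolding germ_def by blast
  define C where "C = cube m 0 r"
  have C: "openin (Euclidean_space m) C" "0 \<in> C" "C \<subseteq> Z"
    using r by (auto simp: C_def openin_cube centre_in_cube)
  have gC: "germ m C n W g" and hC: "germ m C n W h"
    using germ_subset[OF g C] germ_subset[OF h C] .
  define q where "q = restrict (p \<circ> g) C"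
  have q: "(m, C, q) \<in> pointed_plots D x"
    using precompose[OF r(1) gC[unfolded C_def]] gC p_zero
    by (auto simp: pointed_plots_def q_def C_def connected_cube germ_def)
  have 1: "summand (m, C, q) v - summand P0 (jacobian m g v) \<in> tangent_relations D x"
    by (rule relatorI[OF q v gC]) (auto simp: q_def)
  have 2: "summand (m, C, q) v - summand P0 (jacobian m h v) \<in> tangent_relations D x"
    by (rule relatorI[OF q v hC]) (use gh C in \<open>auto simp: q_def\<close>)
  have "(summand (m, C, q) v - summand P0 (jacobian m h v)) - (summand (m, C, q) v - summand P0 (jacobian m g v))
      \<in> tangent_relations D x"
    unfolding relations_eq by (rule span_diff[OF 2[unfolded relations_eq] 1[unfolded relations_eq]])
  then show ?thesis
    by (simp add: linear_diff[OF linear_summand])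
qed

text \<open>Each summand can be moved to \<open>P0\<close> along its lift, so modulo the relations
  \<open>\<omega>\<close> is a single vector \<open>w\<close> at \<open>P0\<close>. Then
  \<open>\<beta> w = 0\<close>, hence \<open>w\<close> is a combination of differences, and these
  are relations by \<open>germ_difference_relation\<close>.\<close>

lemma kernel_tangent_relations:
  assumes \<omega>: "\<omega> \<in> tangent_sum D x" and z: "tangent_map \<omega> = 0"
  shows "\<omega> \<in> tangent_relations D x"
proof -
  define I where "I = {P. \<omega> P \<noteq> 0}"
  have I: "finite I" "I \<subseteq> pointed_plots D x" and \<omega>R: "\<And>P. P \<in> I \<Longrightarrow> \<omega> P \<in> Rn (fst P)"
    using \<omega> unfolding I_def tangent_sum_def by auto
  define J where "J P = jacobian (fst P) (lift_germ P) (\<omega> P)" for P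
  define w where "w = (\<Sum>P\<in>I. J P)"
  have JR: "J P \<in> Rn n" if "P \<in> I" for P
    unfolding J_def using tangent_value_Rn I that by blast
  then have wR: "w \<in> Rn n" unfolding w_def by (rule Rn_sum)
  have "summand P (\<omega> P) - summand P0 (J P) \<in> tangent_relations D x" if P: "P \<in> I" for P
  proof -
    obtain m U q where e: "P = (m, U, q)" by (metis prod.collapse)
    have P': "(m, U, q) \<in> pointed_plots D x" using P I e by blast
    obtain Z where "germ m Z n W (lift_germ (m, U, q))" "Z \<subseteq> U" "\<And>z. z \<in> Z \<Longrightarrow> q z = p (lift_germ (m, U, q) z)"
      using lift_germ[OF P'] by metis
    from relatorI[OF P' _ this] \<omega>R[OF P] show ?thesis by (simp add: e J_def)
  qed
  then have "(\<Sum>P\<in>I. summand P (\<omega> P) - summand P0 (J P)) \<in> tangent_relations D x"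
    unfolding relations_eq by (rule span_sum)
  moreover have "(\<Sum>P\<in>I. summand P (\<omega> P) - summand P0 (J P)) = \<omega> - summand P0 w"
    using tangent_sum_expand[OF \<omega>] unfolding sum_subtractf w_def I_def linear_sum[OF linear_summand] by simp
  ultimately have 1: "\<omega> - summand P0 w \<in> tangent_relations D x" by simp
  have "0 = (\<Sum>P\<in>I. \<beta> (J P))"
    using z by (simp add: tangent_map_def I_def J_def tangent_value_def)
  also have "\<dots> = \<beta> w"
    unfolding w_def by (rule linear_on_sum[OF linear_\<beta> subspace_Rn I(1) JR, symmetric])
  finally have "w \<in> span (germ_pair_differences (\<lambda>a b. p a = p b) n W)"
    using \<beta>_kernel[OF wR] by simp
  then have "summand P0 w \<in> span (summand P0 ` germ_pair_differences (\<lambda>a b. p a = p b) n W)"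
    using linear_span_image[OF linear_summand] by blast
  moreover have "span (summand P0 ` germ_pair_differences (\<lambda>a b. p a = p b) n W) \<subseteq> tangent_relations D x"
    unfolding relations_eq
  proof (rule span_minimal)
    show "summand P0 ` germ_pair_differences (\<lambda>a b. p a = p b) n W \<subseteq> span relators"
      using germ_difference_relation unfolding germ_pair_differences_def relations_eq by blast
  qed (rule subspace_span)
  ultimately have 2: "summand P0 w \<in> tangent_relations D x" by blast
  have "(\<omega> - summand P0 w) + summand P0 w \<in> tangent_relations D x"
    unfolding relations_eq by (rule span_add[OF 1[unfolded relations_eq] 2[unfolded relations_eq]])
  then show ?thesis by simp
qed

lemma tangent_relations_eq_kernel: "tangent_relations D x = {\<omega> \<in> tangent_sum D x. tangent_map \<omega> = 0}"
  using tangent_relations_kernel kernel_tangent_relations by blast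

lemma tangent_map_image: "tangent_map ` tangent_sum D x = \<beta> ` Rn n"
proof
  show "tangent_map ` tangent_sum D x \<subseteq> \<beta> ` Rn n"
  proof
    fix y assume "y \<in> tangent_map ` tangent_sum D x"
    then obtain \<omega> where \<omega>: "\<omega> \<in> tangent_sum D x" "y = tangent_map \<omega>" by blast
    have "tangent_value P (\<omega> P) \<in> \<beta> ` Rn n" if "\<omega> P \<noteq> 0" for P
    proof -
      have "P \<in> pointed_plots D x"
        using \<omega>(1) that unfolding tangent_sum_def by blast
      then show ?thesis
        unfolding tangent_value_def by (rule imageI[OF tangent_value_Rn])
    qed
    then show "y \<in> \<beta> ` Rn n"
      unfolding \<omega>(2) tangent_map_def
      by (intro subspace_sum[OF subspace_linear_on_image[OF linear_\<beta> subspace_Rn]]) auto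
  qed
  show "\<beta> ` Rn n \<subseteq> tangent_map ` tangent_sum D x"
  proof
    fix y assume "y \<in> \<beta> ` Rn n"
    then obtain w where w: "w \<in> Rn n" "y = \<beta> w" by blast
    then have "y = tangent_map (summand P0 w)"
      by (simp add: tangent_map_summand tangent_value_P0)
    moreover have "summand P0 w \<in> tangent_sum D x"
      using summand_tangent_sum[OF pointed] w by simp
    ultimately show "y \<in> tangent_map ` tangent_sum D x" by blast
  qed
qed

end

lemma internal_tangent_space_iso:
  assumes "covering_plot D x n W p \<beta>" "covering_plot D' x' n' W' p' \<beta>'"
    and "\<beta> ` Rn n = \<beta>' ` Rn n'"
  shows "vec_space_iso (internal_tangent_space D x) (internal_tangent_space D' x')"
proof -
  interpret A: covering_plot D x n W p \<beta> by fact
  interpret B: covering_plot D' x' n' W' p' \<beta>' by fact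
  show ?thesis
    unfolding internal_tangent_space_def
    by (rule quotient_space_iso[OF A.tangent_map_linear subspace_tangent_sum A.tangent_relations_eq_kernel
          B.tangent_map_linear subspace_tangent_sum B.tangent_relations_eq_kernel])
      (simp add: A.tangent_map_image B.tangent_map_image assms(3))
qed

text \<open>A pointed plot of the quotient lifts near 0 to a plot of \<open>M\<close>, but the value
  of the lift at 0 is only equivalent to \<open>x\<close>. The hypothesis \<open>move\<close>
  exchanges the lift for an equivalent one through \<open>x\<close>, whose coordinates are the
  required factor.\<close>

lemma (in centred_chart) covering_plot_quotient:
  fixes \<beta> :: "(nat \<Rightarrow> real) \<Rightarrow> 'e::real_vector"
  assumes r: "equiv (mcarrier M) r"
    and move: "\<And>d Z q. (d, Z, q) \<in> standard_diffeology M \<Longrightarrow> 0 \<in> Z \<Longrightarrow> (q 0, x) \<in> r \<Longrightarrow>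
      \<exists>q'. (d, Z, q') \<in> standard_diffeology M \<and> q' 0 = x \<and> (\<forall>z\<in>Z. (q' z, q z) \<in> r)"
    and lin: "linear_on (Rn n) \<beta>"
    and inv: "\<And>m Z g h v. germ m Z n W g \<Longrightarrow> germ m Z n W h \<Longrightarrow> v \<in> Rn m \<Longrightarrow>
      (\<And>z. z \<in> Z \<Longrightarrow> (p (g z), p (h z)) \<in> r) \<Longrightarrow> \<beta> (jacobian m g v) = \<beta> (jacobian m h v)"
    and ker: "\<And>w. w \<in> Rn n \<Longrightarrow> \<beta> w = 0 \<Longrightarrow> w \<in> span (germ_pair_differences (\<lambda>a b. (p a, p b) \<in> r) n W)"
  shows "covering_plot (quotient_diffeology (standard_diffeology M) r) (r `` {x}) n W
    (restrict (\<lambda>w. r `` {p w}) W) \<beta>"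
proof
  define D where "D = quotient_diffeology (standard_diffeology M) r"
  define p' where "p' = restrict (\<lambda>w. r `` {p w}) W"
  have cls: "p' a = p' b \<longleftrightarrow> (p a, p b) \<in> r" if "a \<in> W" "b \<in> W" for a b
    using that eq_equiv_class_iff[OF r p_carrier p_carrier] by (simp add: p'_def)
  have qI: "(m, Z, restrict (\<lambda>z. r `` {q z}) Z) \<in> D" if q: "(m, Z, q) \<in> standard_diffeology M" for m Z q
    unfolding D_def quotient_diffeology_def using q standard_diffeologyD(1)[OF q] by fastforce
  show "openin (Euclidean_space n) W" by (rule open_W)
  show "linear_on (Rn n) \<beta>" by (rule lin)
  show "(n, W, restrict (\<lambda>w. r `` {p w}) W) \<in> pointed_plots (quotient_diffeology (standard_diffeology M) r) (r `` {x})"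
    using qI[OF plot_p] connected_W zero_W p_zero by (simp add: pointed_plots_def D_def)
  show "(m, cube m 0 s, restrict (restrict (\<lambda>w. r `` {p w}) W \<circ> g) (cube m 0 s))
      \<in> quotient_diffeology (standard_diffeology M) r"
    if "s > 0" and g: "germ m (cube m 0 s) n W g" for m s g
  proof -
    have gW: "g ` cube m 0 s \<subseteq> W" using g by (simp add: germ_def)
    have "(m, cube m 0 s, restrict (p \<circ> g) (cube m 0 s)) \<in> standard_diffeology M"
      using plot_precompose[OF charted plot_p] g by (auto simp: germ_def)
    from qI[OF this] have "(m, cube m 0 s, restrict (\<lambda>z. r `` {restrict (p \<circ> g) (cube m 0 s) z}) (cube m 0 s)) \<in> D" .
    moreover have "restrict (\<lambda>z. r `` {restrict (p \<circ> g) (cube m 0 s) z}) (cube m 0 s)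
        = restrict (restrict (\<lambda>w. r `` {p w}) W \<circ> g) (cube m 0 s)"
      using gW by (auto simp: restrict_def fun_eq_iff)
    ultimately show ?thesis by (simp add: D_def)
  qed
  show "\<exists>Z g. germ m Z n W g \<and> Z \<subseteq> U \<and> (\<forall>z\<in>Z. q z = restrict (\<lambda>w. r `` {p w}) W (g z))"
    if q: "(m, U, q) \<in> pointed_plots (quotient_diffeology (standard_diffeology M) r) (r `` {x})" for m U q
  proof -
    have "0 \<in> U" "q 0 = r `` {x}" "\<And>u. u \<in> U \<Longrightarrow> \<exists>V s. (m, V, s) \<in> standard_diffeology M \<and> u \<in> V \<and> V \<subseteq> U \<and>
        (\<forall>w\<in>V. q w = r `` {s w})"
      using q by (auto simp: pointed_plots_def quotient_diffeology_def)
    then obtain V s where s: "(m, V, s) \<in> standard_diffeology M" "0 \<in> V" "V \<subseteq> U" "\<And>w. w \<in> V \<Longrightarrow> q w = r `` {s w}"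
      by metis
    have "s 0 \<in> mcarrier M" using standard_diffeologyD(2)[OF s(1)] s(2) by auto
    moreover have "r `` {s 0} = r `` {x}" using s(2,4) \<open>q 0 = r `` {x}\<close> by simp
    ultimately have "(s 0, x) \<in> r" using eq_equiv_class_iff[OF r _ x_carrier] by blast
    then obtain s' where s': "(m, V, s') \<in> standard_diffeology M" "s' 0 = x" "\<And>z. z \<in> V \<Longrightarrow> (s' z, s z) \<in> r"
      using move[OF s(1,2)] by blast
    define Z where "Z = {z \<in> V. s' z \<in> p ` W}"
    have "germ m Z n W (\<phi> \<circ> s')"
      unfolding germ_def
    proof (intro conjI)
      show "openin (Euclidean_space m) Z" unfolding Z_def by (rule open_preimage[OF s'(1)])
      show "0 \<in> Z" using s(2) s'(2) x_image by (simp add: Z_def)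
      show "smooth_on m Z n (\<phi> \<circ> s')" unfolding Z_def by (rule smooth_coordinates[OF s'(1)])
      show "(\<phi> \<circ> s') ` Z \<subseteq> W" using inverse'(1) by (auto simp: Z_def)
      show "(\<phi> \<circ> s') 0 = 0" using s'(2) phi_x by simp
    qed
    moreover have "q z = restrict (\<lambda>w. r `` {p w}) W ((\<phi> \<circ> s') z)" if "z \<in> Z" for z
    proof -
      have z: "z \<in> V" "s' z \<in> p ` W" using that by (auto simp: Z_def)
      have "q z = r `` {s' z}" using s(4)[OF z(1)] equiv_class_eq[OF r s'(3)[OF z(1)]] by simp
      then show ?thesis using inverse'[OF z(2)] by simp
    qed
    ultimately show ?thesis using s(3) by (intro exI[of _ Z] exI[of _ "\<phi> \<circ> s'"]) (auto simp: Z_def)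
  qed
  show "\<beta> (jacobian m g v) = \<beta> (jacobian m h v)"
    if "germ m Z n W g" "germ m Z n W h" "v \<in> Rn m"
      "\<And>z. z \<in> Z \<Longrightarrow> restrict (\<lambda>w. r `` {p w}) W (g z) = restrict (\<lambda>w. r `` {p w}) W (h z)" for m Z g h v
  proof (rule inv[OF that(1-3)])
    fix z assume z: "z \<in> Z"
    then have "g z \<in> W" "h z \<in> W" using that(1,2) by (auto simp: germ_def)
    then show "(p (g z), p (h z)) \<in> r" using that(4)[OF z] cls by (simp add: p'_def)
  qed
  show "w \<in> span (germ_pair_differences (\<lambda>a b. restrict (\<lambda>w. r `` {p w}) W a = restrict (\<lambda>w. r `` {p w}) W b) n W)"
    if "w \<in> Rn n" "\<beta> w = 0" for w
  proof (rule subsetD[OF span_mono ker[OF that]])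
    show "germ_pair_differences (\<lambda>a b. (p a, p b) \<in> r) n W
        \<subseteq> germ_pair_differences (\<lambda>a b. restrict (\<lambda>w. r `` {p w}) W a = restrict (\<lambda>w. r `` {p w}) W b) n W"
    proof
      fix y assume "y \<in> germ_pair_differences (\<lambda>a b. (p a, p b) \<in> r) n W"
      then obtain m Z g h v where y: "y = jacobian m g v - jacobian m h v" "germ m Z n W g" "germ m Z n W h"
        "v \<in> Rn m" "\<And>z. z \<in> Z \<Longrightarrow> (p (g z), p (h z)) \<in> r"
        unfolding germ_pair_differences_def by blast
      have "restrict (\<lambda>w. r `` {p w}) W (g z) = restrict (\<lambda>w. r `` {p w}) W (h z)" if "z \<in> Z" for z
        using cls[of "g z" "h z"] y(2,3,5) that by (auto simp: germ_def p'_def)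
      then show "y \<in> germ_pair_differences (\<lambda>a b. restrict (\<lambda>w. r `` {p w}) W a = restrict (\<lambda>w. r `` {p w}) W b) n W"
        unfolding germ_pair_differences_def using y by blast
    qed
  qed
qed

section \<open>Tangent vectors in a centred chart\<close>

text \<open>Tangent vectors are compared at all indices; from \<open>m\<close> on, the curve and the
  derivative both vanish.\<close>

lemma jacobian_curve_all:
  assumes U: "openin (Euclidean_space n) U" and z: "0 \<in> U" and g: "smooth_on n U m g"
    and c0: "c 0 = 0" and c: "\<forall>\<^sub>F s in at 0. c s \<in> Rn n"
    and w: "\<And>i. i < n \<Longrightarrow> ((\<lambda>s. c s i) has_real_derivative w i) (at 0)"
  shows "((\<lambda>s. g (c s) j) has_real_derivative jacobian n g w j) (at (0::real))"
proof (cases "j < m")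
  case True
  show ?thesis by (rule jacobian_curve[where c = c, OF assms True])
next
  case False
  have "\<forall>\<^sub>F s in at 0. c s \<in> U"
  proof (rule eventually_in_open[OF U z c])
    fix i assume "i < n"
    then show "((\<lambda>s. c s i) \<longlongrightarrow> 0 i) (at 0)"
      using DERIV_isCont[OF w] c0 by (simp add: isCont_def)
  qed
  then have ev: "\<forall>\<^sub>F s in at 0. 0 = g (c s) j"
    by (rule eventually_mono) (use smooth_on_in_Rn[OF g] False in \<open>auto simp: topspace_Euclidean_space\<close>)
  have 1: "0 = g (c 0) j"
    using smooth_on_in_Rn[OF g z] False c0 by (simp add: topspace_Euclidean_space)
  have "jacobian n g w \<in> Rn m"
    by (rule jacobian_Rn[OF U z smooth_on_in_Rn[OF g]])
  then have 2: "jacobian n g w j = 0"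
    using False by (simp add: topspace_Euclidean_space)
  have "\<forall>\<^sub>F s in nhds 0. 0 = g (c s) j"
    using ev 1 by (simp add: eventually_nhds_conv_at)
  from iffD1[OF DERIV_cong_ev[OF refl this refl] DERIV_const] show ?thesis
    by (simp add: 2)
qed

lemma jacobian_shift:
  assumes U: "openin (Euclidean_space n) U" and z: "0 \<in> U" and f: "smooth_on n U m f"
  shows "jacobian n (\<lambda>w. f w - b) v = jacobian n f v"
proof -
  have "partial i (\<lambda>w. (f w - b) j) 0 = partial i (\<lambda>w. f w j) 0" if i: "i < n" for i j
  proof (cases "j < m")
    case True
    have "((\<lambda>t. f (0(i := t)) j) has_real_derivative partial i (\<lambda>w. f w j) 0) (at (0 i))"
      using has_real_derivative_partial[of "\<lambda>w. f w j", OF smooth_fun_differentiable[OF smooth_on_component[OF f True] i z]] .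
    from DERIV_diff[OF this DERIV_const[of "b j"]]
    have "((\<lambda>t. (f (0(i := t)) - b) j) has_real_derivative partial i (\<lambda>w. f w j) 0) (at (0 i))"
      by (simp only: fun_diff_def diff_0_right)
    then show ?thesis by (rule partial_eqI)
  next
    case False
    have "f w j = 0" if "w \<in> U" for w
      using smooth_on_in_Rn[OF f that] False by (simp add: topspace_Euclidean_space)
    then have "partial i (\<lambda>w. (f w - b) j) 0 = 0" "partial i (\<lambda>w. f w j) 0 = 0"
      by (auto intro!: partial_const[OF U z i])
    then show ?thesis by simp
  qed
  then show ?thesis by (simp add: jacobian_def)
qed

context centred_chart
begin

text \<open>The velocity of the curve with coordinates \<open>t *\<^sub>R w\<close>, in the encoding
  of \<open>velocity\<close>; expressed by \<open>jacobian\<close> it is visibly linear in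
  \<open>w\<close>.\<close>

definition tangent_vector :: "(nat \<Rightarrow> real) \<Rightarrow> 'a chart \<Rightarrow> nat \<Rightarrow> real"
  where "tangent_vector w = (\<lambda>(m, U, \<psi>) i.
    if (m, U, \<psi>) \<in> atlas M \<and> x \<in> U then jacobian n (\<psi> \<circ> p) w i else 0)"

lemma linear_tangent_vector: "linear tangent_vector"
proof (rule linearI)
  show "tangent_vector (v + w) = tangent_vector v + tangent_vector w" for v w
  proof (intro ext)
    fix e :: "'a chart" and i show "tangent_vector (v + w) e i = (tangent_vector v + tangent_vector w) e i"
      by (cases e) (simp add: tangent_vector_def jacobian_add)
  qed
  show "tangent_vector (c *\<^sub>R v) = c *\<^sub>R tangent_vector v" for c v
  proof (intro ext)
    fix e :: "'a chart" and i show "tangent_vector (c *\<^sub>R v) e i = (c *\<^sub>R tangent_vector v) e i"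
      by (cases e) (simp add: tangent_vector_def jacobian_scaleR scaleR_fun_apply)
  qed
qed

text \<open>The point of R^1 with coordinate \<open>s\<close> is \<open>0(0 := s)\<close>. A
  derivative of \<open>c\<close> is assumed at 0 alone, which suits the straight lines of
  \<open>curve_exists\<close> as well as the image curve under a differential.\<close>

lemma velocity_eq_tangent_vector:
  assumes ev: "\<forall>\<^sub>F s in nhds 0. c s \<in> W \<and> \<gamma> (0(0 := s)) = p (c s)"
    and c0: "c 0 = 0" and w: "\<And>i. i < n \<Longrightarrow> ((\<lambda>s. c s i) has_real_derivative w i) (at 0)"
  shows "velocity M \<gamma> = tangent_vector w"
proof -
  have upd0: "(0::nat \<Rightarrow> real)(0 := 0) = 0" by auto
  have \<gamma>0: "\<gamma> 0 = x"
    using eventually_nhds_x_imp_x[OF ev] c0 p_zero unfolding upd0 by simp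
  have "partial 0 (\<lambda>t. \<psi> (\<gamma> t) i) 0 = jacobian n (\<psi> \<circ> p) w i"
    if e: "(m, U, \<psi>) \<in> atlas M" "x \<in> U" for m U \<psi> i
  proof -
    define Z where "Z = {w \<in> W. p w \<in> U}"
    have Z: "openin (Euclidean_space n) Z" unfolding Z_def
      by (rule openin_plot_preimage[OF plot_p chartedD(1)[OF charted e(1)]])
    have z: "0 \<in> Z" using zero_W p_zero e by (simp add: Z_def)
    have s: "smooth_on n Z m (\<psi> \<circ> p)"
      unfolding Z_def by (rule standard_diffeologyD(5)[OF plot_p e(1)])
    have cR: "\<forall>\<^sub>F s in at 0. c s \<in> Rn n"
      using ev unfolding eventually_nhds_conv_at by (auto elim!: eventually_mono intro: subsetD[OF W_Rn])
    have D: "((\<lambda>s. (\<psi> \<circ> p) (c s) i) has_real_derivative jacobian n (\<psi> \<circ> p) w i) (at 0)"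
      by (rule jacobian_curve_all[where c = c, OF Z z s c0 cR w])
    have ev': "\<forall>\<^sub>F s in nhds 0. (\<psi> \<circ> p) (c s) i = \<psi> (\<gamma> (0(0 := s))) i"
      by (rule eventually_mono[OF ev]) simp
    have "((\<lambda>s. \<psi> (\<gamma> (0(0 := s))) i) has_real_derivative jacobian n (\<psi> \<circ> p) w i) (at 0)"
      by (rule iffD1[OF DERIV_cong_ev[OF refl ev' refl] D])
    then show ?thesis
      by (intro partial_eqI) simp
  qed
  then show ?thesis
    unfolding velocity_def tangent_vector_def \<gamma>0 by (auto simp: fun_eq_iff)
qed

lemma curve_coordinates:
  assumes "\<gamma> \<in> curves_in M S x"
  obtains w where "\<forall>\<^sub>F s in nhds 0. \<gamma> (0(0 := s)) \<in> p ` W \<and> \<gamma> (0(0 := s)) \<in> S"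
    "\<And>j. ((\<lambda>s. \<phi> (\<gamma> (0(0 := s))) j) has_real_derivative w j) (at 0)"
    "w \<in> Rn n" "velocity M \<gamma> = tangent_vector w" "\<gamma> 0 = x"
proof -
  have upd0: "(0::nat \<Rightarrow> real)(0 := 0) = 0" by auto
  obtain U where U: "(1, U, \<gamma>) \<in> standard_diffeology M" "0 \<in> U" "\<gamma> 0 = x" "\<gamma> ` U \<subseteq> S"
    using assms by (auto simp: curves_in_def)
  define Z where "Z = {u \<in> U. \<gamma> u \<in> p ` W}"
  have Z: "openin (Euclidean_space 1) Z" unfolding Z_def by (rule open_preimage[OF U(1)])
  have z: "0 \<in> Z" using U x_image by (simp add: Z_def)
  have s: "smooth_on 1 Z n (\<phi> \<circ> \<gamma>)" unfolding Z_def by (rule smooth_coordinates[OF U(1)])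
  have "\<forall>\<^sub>F s in nhds ((0::nat \<Rightarrow> real) 0). (0::nat \<Rightarrow> real)(0 := s) \<in> Z"
    by (rule eventually_upd_in_open[OF Z z]) simp
  then have ev: "\<forall>\<^sub>F s in nhds 0. (0::nat \<Rightarrow> real)(0 := s) \<in> Z" by simp
  define w where "w j = partial 0 (\<lambda>t. (\<phi> \<circ> \<gamma>) t j) 0" for j
  define e where "e = unit_vec 0"
  have curve: "0(0 := s) = s *\<^sub>R e" for s
    by (auto simp: e_def fun_eq_iff unit_vec_def scaleR_fun_apply)
  have w: "w = jacobian 1 (\<phi> \<circ> \<gamma>) e"
    by (simp add: w_def fun_eq_iff jacobian_def e_def unit_vec_def)
  have D: "((\<lambda>s. \<phi> (\<gamma> (0(0 := s))) j) has_real_derivative w j) (at 0)" for j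
  proof -
    have "((\<lambda>s. (\<phi> \<circ> \<gamma>) (s *\<^sub>R e) j) has_real_derivative jacobian 1 (\<phi> \<circ> \<gamma>) e j) (at 0)"
    proof (rule jacobian_curve_all[where c = "\<lambda>s. s *\<^sub>R e", OF Z z s])
      show "\<forall>\<^sub>F s in at 0. s *\<^sub>R e \<in> Rn 1"
        by (intro always_eventually allI Rn_scaleR) (simp add: e_def unit_vec_Rn)
    qed (auto intro: has_real_derivative_scaleR_fun)
    then show ?thesis by (simp only: curve w comp_apply)
  qed
  have wR: "w \<in> Rn n"
    unfolding w by (rule jacobian_Rn[OF Z z smooth_on_in_Rn[OF s]])
  have ev1: "\<forall>\<^sub>F s in nhds 0. \<gamma> (0(0 := s)) \<in> p ` W \<and> \<gamma> (0(0 := s)) \<in> S"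
    by (rule eventually_mono[OF ev]) (use U(4) in \<open>auto simp: Z_def\<close>)
  have "velocity M \<gamma> = tangent_vector w"
  proof (rule velocity_eq_tangent_vector[where c = "\<lambda>s. \<phi> (\<gamma> (0(0 := s)))"])
    show "\<forall>\<^sub>F s in nhds 0. \<phi> (\<gamma> (0(0 := s))) \<in> W \<and> \<gamma> (0(0 := s)) = p (\<phi> (\<gamma> (0(0 := s))))"
      by (rule eventually_mono[OF ev1]) (use inverse' in auto)
    show "\<phi> (\<gamma> (0(0 := 0))) = 0"
      unfolding upd0 U(3) by (rule phi_x)
  qed (rule D)
  from that[OF ev1 D wR this U(3)] show ?thesis .
qed

lemma curve_exists:
  assumes w: "w \<in> Rn n" and S: "\<And>t. t *\<^sub>R w \<in> W \<Longrightarrow> p (t *\<^sub>R w) \<in> S"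
  shows "\<exists>\<gamma> \<in> curves_in M S x. velocity M \<gamma> = tangent_vector w"
proof -
  define f where "f = (\<lambda>t::nat \<Rightarrow> real. t 0 *\<^sub>R w)"
  have f: "smooth_on 1 (Rn 1) n f"
    unfolding f_def using smooth_on_scale_vec[OF openin_Rn w] by simp
  define U where "U = {t \<in> Rn 1. f t \<in> W}"
  have U: "openin (Euclidean_space 1) U"
    unfolding U_def by (rule openin_smooth_preimage[OF openin_Rn f open_W])
  define \<gamma> where "\<gamma> = restrict (p \<circ> f) U"
  have \<gamma>: "(1, U, \<gamma>) \<in> standard_diffeology M"
    unfolding \<gamma>_def
    by (rule plot_precompose[OF charted plot_p U smooth_on_subset[OF f]]) (auto simp: U_def)
  have z: "0 \<in> U" using zero_W by (simp add: U_def f_def)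
  have \<gamma>0: "\<gamma> 0 = x" using z p_zero by (simp add: \<gamma>_def f_def)
  have "\<gamma> \<in> curves_in M S x"
    unfolding curves_in_def using \<gamma> z \<gamma>0 S by (auto simp: \<gamma>_def U_def f_def)
  moreover have "velocity M \<gamma> = tangent_vector w"
  proof (rule velocity_eq_tangent_vector[where c = "\<lambda>s. s *\<^sub>R w"])
    have "\<forall>\<^sub>F s in nhds ((0::nat \<Rightarrow> real) 0). (0::nat \<Rightarrow> real)(0 := s) \<in> U"
      by (rule eventually_upd_in_open[OF U z]) simp
    then have "\<forall>\<^sub>F s in nhds 0. (0::nat \<Rightarrow> real)(0 := s) \<in> U" by simp
    then show "\<forall>\<^sub>F s in nhds 0. s *\<^sub>R w \<in> W \<and> \<gamma> (0(0 := s)) = p (s *\<^sub>R w)"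
      by (rule eventually_mono) (auto simp: \<gamma>_def U_def f_def)
    show "((\<lambda>s. (s *\<^sub>R w) i) has_real_derivative w i) (at 0)" for i
      by (rule has_real_derivative_scaleR_fun)
  qed simp
  ultimately show ?thesis by blast
qed

text \<open>Along a curve in \<open>S\<close> the coordinates from \<open>k\<close> on vanish
  identically, hence so do their derivatives; conversely, a straight line in R^k stays in
  \<open>S\<close>.\<close>

lemma tangent_space_slice:
  assumes k: "k \<le> n" and S: "\<And>w. w \<in> W \<Longrightarrow> p w \<in> S \<longleftrightarrow> w \<in> Rn k"
  shows "tangent_space M S x = tangent_vector ` Rn k"
proof
  show "tangent_space M S x \<subseteq> tangent_vector ` Rn k"
  proof
    fix v assume "v \<in> tangent_space M S x"
    then obtain \<gamma> where \<gamma>: "\<gamma> \<in> curves_in M S x" "v = velocity M \<gamma>"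
      by (auto simp: tangent_space_def)
    obtain w where w: "\<forall>\<^sub>F s in nhds 0. \<gamma> (0(0 := s)) \<in> p ` W \<and> \<gamma> (0(0 := s)) \<in> S"
      "\<And>j. ((\<lambda>s. \<phi> (\<gamma> (0(0 := s))) j) has_real_derivative w j) (at 0)"
      "w \<in> Rn n" "velocity M \<gamma> = tangent_vector w"
      using curve_coordinates[OF \<gamma>(1)] by metis
    have "w j = 0" if "j \<ge> k" for j
    proof -
      have "\<forall>\<^sub>F s in nhds 0. \<phi> (\<gamma> (0(0 := s))) j = 0"
      proof (rule eventually_mono[OF w(1)])
        fix s assume s: "\<gamma> (0(0 := s)) \<in> p ` W \<and> \<gamma> (0(0 := s)) \<in> S"
        then have "\<phi> (\<gamma> (0(0 := s))) \<in> Rn k"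
          using S inverse' by metis
        then show "\<phi> (\<gamma> (0(0 := s))) j = 0" using that by (simp add: topspace_Euclidean_space)
      qed
      from iffD1[OF DERIV_cong_ev[OF refl this refl] w(2)] show ?thesis
        using DERIV_unique DERIV_const by blast
    qed
    then have "w \<in> Rn k" by (simp add: topspace_Euclidean_space)
    then show "v \<in> tangent_vector ` Rn k" using \<gamma>(2) w(4) by blast
  qed
  show "tangent_vector ` Rn k \<subseteq> tangent_space M S x"
  proof
    fix v assume "v \<in> tangent_vector ` Rn k"
    then obtain w where w: "w \<in> Rn k" "v = tangent_vector w" by blast
    have "w \<in> Rn n" using w k subset_Euclidean_space by blast
    then obtain \<gamma> where "\<gamma> \<in> curves_in M S x" "velocity M \<gamma> = tangent_vector w"
      using curve_exists[of w S] S Rn_scaleR[OF w(1)] by blast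
    then have "v = velocity M \<gamma>" "\<gamma> \<in> curves_in M S x" using w by simp_all
    then show "v \<in> tangent_space M S x" unfolding tangent_space_def by (rule image_eqI)
  qed
qed

lemma tangent_space_full: "tangent_space M (mcarrier M) x = tangent_vector ` Rn n"
  by (rule tangent_space_slice) (use p_carrier W_Rn in auto)

text \<open>The component at one atlas chart recovers \<open>w\<close>: apply the derivative of the
  coordinate change back to the given chart. Exhibiting this derivative, rather than mere
  injectivity, also yields continuity of the inverse in \<open>J_coordinates\<close>.\<close>

lemma tangent_vector_left_inverse:
  assumes M: "is_manifold M"
  obtains c m f where "c \<in> atlas M" "\<And>w. w \<in> Rn n \<Longrightarrow> jacobian m f (tangent_vector w c) = w"
proof -
  obtain m U \<psi> where c: "(m, U, \<psi>) \<in> atlas M" "x \<in> U"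
    using chartedD(3)[OF charted x_carrier] by blast
  obtain r p' where r: "r > 0" "centred_chart M x m (cube m 0 r) p' (\<lambda>y. \<psi> y - \<psi> x)"
    using centred_chart_exists[OF M atlas_smooth_chart[OF M c(1)] c(2)] by metis
  interpret A: centred_chart M x m "cube m 0 r" p' "\<lambda>y. \<psi> y - \<psi> x" by fact
  have "jacobian m (\<phi> \<circ> p') (tangent_vector w (m, U, \<psi>)) = w" if w: "w \<in> Rn n" for w
  proof -
    define Z where "Z = {w \<in> W. p w \<in> p' ` cube m 0 r}"
    define T where "T = {z \<in> cube m 0 r. p' z \<in> p ` W}"
    define f where "f = (\<lambda>y. \<psi> y - \<psi> x) \<circ> p"
    have Z: "openin (Euclidean_space n) Z" "0 \<in> Z" "smooth_on n Z m f"
      unfolding Z_def f_def using A.open_preimage[OF plot_p] A.smooth_coordinates[OF plot_p] zero_W p_zero A.x_image by auto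
    have T: "openin (Euclidean_space m) T" "smooth_on m T n (\<phi> \<circ> p')"
      unfolding T_def using open_preimage[OF A.plot_p] smooth_coordinates[OF A.plot_p] by auto
    have pf: "f z \<in> cube m 0 r" "p' (f z) = p z" if "z \<in> Z" for z
      using that A.inverse'[of "p z"] unfolding Z_def f_def by auto
    have fT: "f ` Z \<subseteq> T" unfolding T_def using pf by (auto simp: Z_def)
    have f0: "f 0 = 0" by (simp add: f_def p_zero)
    have "jacobian n ((\<phi> \<circ> p') \<circ> f) w = jacobian m (\<phi> \<circ> p') (jacobian n f w)"
      by (rule jacobian_comp[OF Z(1,3) fT T Z(2) f0])
    moreover have "jacobian n ((\<phi> \<circ> p') \<circ> f) w = jacobian n (\<lambda>w. w) w"
      by (rule jacobian_cong[OF Z(1,2)]) (use pf inverse in \<open>auto simp: Z_def\<close>)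
    \<comment> \<open>\<open>tangent_vector\<close> uses the uncentred chart \<open>\<psi>\<close>;
      subtracting \<open>\<psi> x\<close> does not change the derivative.\<close>
    moreover have "jacobian n f w = jacobian n (\<psi> \<circ> p) w"
    proof -
      define Z' where "Z' = {w \<in> W. p w \<in> U}"
      have Z': "openin (Euclidean_space n) Z'" unfolding Z'_def
        by (rule openin_plot_preimage[OF plot_p chartedD(1)[OF charted c(1)]])
      have "0 \<in> Z'" using zero_W p_zero c by (simp add: Z'_def)
      from jacobian_shift[OF Z' this, of m "\<psi> \<circ> p" "\<psi> x" w] standard_diffeologyD(5)[OF plot_p c(1)]
      show ?thesis by (simp add: Z'_def f_def comp_def)
    qed
    moreover have "tangent_vector w (m, U, \<psi>) = jacobian n (\<psi> \<circ> p) w"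
      using c by (simp add: tangent_vector_def fun_eq_iff)
    ultimately show ?thesis using jacobian_id[OF w] by simp
  qed
  then show ?thesis using that c by blast
qed

lemma inj_tangent_vector: "is_manifold M \<Longrightarrow> inj_on tangent_vector (Rn n)"
  using tangent_vector_left_inverse by (metis inj_onI)

end

text \<open>\<open>differential\<close> picks some curve with the given velocity. Injectivity of
  \<open>tangent_vector\<close> forces the coordinate velocity of that curve to be
  \<open>\<xi>\<close>, so the chain rule gives the same result for every choice.\<close>

lemma differential_tangent_vector:
  assumes "centred_chart N y m W' p' \<phi>'" "centred_chart M x n W p \<phi>" and N: "is_manifold N"
    and f: "\<And>d Z q. (d, Z, q) \<in> standard_diffeology N \<Longrightarrow> (d, Z, restrict (f \<circ> q) Z) \<in> standard_diffeology M"
    and fy: "f y = x" and \<xi>: "\<xi> \<in> Rn m"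
  shows "differential N M f y (centred_chart.tangent_vector N y m p' \<xi>)
    = centred_chart.tangent_vector M x n p (jacobian m (\<phi> \<circ> f \<circ> p') \<xi>)"
proof -
  interpret B: centred_chart N y m W' p' \<phi>' by fact
  interpret A: centred_chart M x n W p \<phi> by fact
  have upd0: "(0::nat \<Rightarrow> real)(0 := 0) = 0" by auto
  define \<gamma> where "\<gamma> = (SOME \<gamma>. \<gamma> \<in> curves_in N (mcarrier N) y \<and> velocity N \<gamma> = B.tangent_vector \<xi>)"
  have "\<exists>\<gamma>. \<gamma> \<in> curves_in N (mcarrier N) y \<and> velocity N \<gamma> = B.tangent_vector \<xi>"
    using B.curve_exists[OF \<xi>, of "mcarrier N"] B.p_carrier by blast
  then have \<gamma>: "\<gamma> \<in> curves_in N (mcarrier N) y" "velocity N \<gamma> = B.tangent_vector \<xi>"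
    unfolding \<gamma>_def by (metis (mono_tags, lifting) someI_ex)+
  obtain w where w: "\<forall>\<^sub>F s in nhds 0. \<gamma> (0(0 := s)) \<in> p' ` W' \<and> \<gamma> (0(0 := s)) \<in> mcarrier N"
      "\<And>j. ((\<lambda>s. \<phi>' (\<gamma> (0(0 := s))) j) has_real_derivative w j) (at 0)"
      "w \<in> Rn m" "velocity N \<gamma> = B.tangent_vector w" "\<gamma> 0 = y"
    using B.curve_coordinates[OF \<gamma>(1)] by metis
  have w\<xi>: "w = \<xi>"
    using inj_onD[OF B.inj_tangent_vector[OF N] _ w(3) \<xi>] w(4) \<gamma>(2) by simp
  define c where "c s = \<phi>' (\<gamma> (0(0 := s)))" for s
  have c0: "c 0 = 0" unfolding c_def upd0 w(5) by (rule B.phi_x)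
  have cD: "((\<lambda>s. c s j) has_real_derivative \<xi> j) (at 0)" for j
    using w(2) unfolding c_def w\<xi> .
  have fp: "(m, W', restrict (f \<circ> p') W') \<in> standard_diffeology M"
    by (rule f[OF B.plot_p])
  define Z where "Z = {z \<in> W'. restrict (f \<circ> p') W' z \<in> p ` W}"
  have Z: "openin (Euclidean_space m) Z" unfolding Z_def by (rule A.open_preimage[OF fp])
  have z: "0 \<in> Z" using B.zero_W B.p_zero fy A.x_image by (simp add: Z_def)
  have s: "smooth_on m Z n (\<phi> \<circ> f \<circ> p')"
    by (rule smooth_on_cong[OF Z, of n "\<phi> \<circ> restrict (f \<circ> p') W'"])
      (use A.smooth_coordinates[OF fp] in \<open>auto simp: Z_def\<close>)
  have cW: "\<forall>\<^sub>F s in nhds 0. c s \<in> W' \<and> p' (c s) = \<gamma> (0(0 := s))"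
    by (rule eventually_mono[OF w(1)]) (use B.inverse' in \<open>auto simp: c_def\<close>)
  then have cR: "\<forall>\<^sub>F s in at 0. c s \<in> Rn m"
    unfolding eventually_nhds_conv_at by (auto elim!: eventually_mono intro: subsetD[OF B.W_Rn])
  have "\<forall>\<^sub>F s in at 0. c s \<in> Z"
  proof (rule eventually_in_open[OF Z z cR])
    show "((\<lambda>s. c s i) \<longlongrightarrow> 0 i) (at 0)" for i
      using DERIV_isCont[OF cD] c0 by (simp add: isCont_def)
  qed
  then have cZ: "\<forall>\<^sub>F s in nhds 0. c s \<in> Z"
    using z c0 by (simp add: eventually_nhds_conv_at)
  have "velocity M (f \<circ> \<gamma>) = A.tangent_vector (jacobian m (\<phi> \<circ> f \<circ> p') \<xi>)"
  proof (rule A.velocity_eq_tangent_vector[where c = "\<lambda>s. (\<phi> \<circ> f \<circ> p') (c s)"])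
    show "\<forall>\<^sub>F s in nhds 0. (\<phi> \<circ> f \<circ> p') (c s) \<in> W \<and> (f \<circ> \<gamma>) (0(0 := s)) = p ((\<phi> \<circ> f \<circ> p') (c s))"
      using cZ cW
    proof eventually_elim
      case (elim s)
      then have "f (p' (c s)) \<in> p ` W" by (simp add: Z_def)
      with elim show ?case using A.inverse' by simp
    qed
    show "(\<phi> \<circ> f \<circ> p') (c 0) = 0"
      by (simp add: c0 B.p_zero fy A.phi_x)
    show "((\<lambda>s. (\<phi> \<circ> f \<circ> p') (c s) i) has_real_derivative jacobian m (\<phi> \<circ> f \<circ> p') \<xi> i) (at 0)" for i
      by (rule jacobian_curve_all[where c = c, OF Z z s c0 cR cD])
  qed
  then show ?thesis
    unfolding differential_def \<gamma>_def .
qed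

text \<open>A basis of \<open>span T\<close> stays independent when \<open>y\<close> is added, so
  the values 0 on the basis and 1 at \<open>y\<close> extend linearly.\<close>

lemma linear_functional_separation:
  fixes y :: "'v::real_vector"
  assumes "y \<notin> span T"
  obtains f :: "'v \<Rightarrow> real" where "linear f" "\<And>x. x \<in> T \<Longrightarrow> f x = 0" "f y = 1"
proof -
  obtain B where B: "B \<subseteq> T" "independent B" "T \<subseteq> span B"
    using maximal_independent_subset by blast
  then have yB: "y \<notin> span B"
    using assms span_mono by blast
  have "independent (insert y B)"
    using independent_insertI[OF yB B(2)] .
  from linear_independent_extend[OF this, of "\<lambda>x. if x = y then 1 else (0::real)"]
  obtain f where f: "linear f" "\<And>x. x \<in> insert y B \<Longrightarrow> f x = (if x = y then 1 else (0::real))"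
    by blast
  have fB: "f b = 0" if "b \<in> B" for b
    using f(2)[of b] that yB span_base by auto
  have "f x = 0" if "x \<in> T" for x
  proof -
    have "x \<in> span B" using B(3) that by blast
    then show ?thesis
      using linear_eq_0_on_span[OF f(1)] fB by blast
  qed
  then show ?thesis using that f by auto
qed

section \<open>Finite-dimensional vector spaces as manifolds\<close>

lemma continuous_on_linear_Rn:
  fixes f :: "(nat \<Rightarrow> real) \<Rightarrow> 'i \<Rightarrow> nat \<Rightarrow> real"
  assumes "linear_on (Rn n) f"
  shows "continuous_on (Rn n) f"
proof (intro continuous_on_coordinatewise_then_product)
  fix c j
  have "continuous_on (Rn n) (\<lambda>w. \<Sum>i<n. w i * f (unit_vec i) c j)"
    by (intro continuous_on_sum continuous_on_mult continuous_on_const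
        continuous_on_subset[OF continuous_on_product_coordinates]) auto
  moreover have "f w c j = (\<Sum>i<n. w i * f (unit_vec i) c j)" if "w \<in> Rn n" for w
    by (subst linear_on_Rn_expand[OF assms that]) (simp add: sum_fun_apply scaleR_fun_apply)
  ultimately show "continuous_on (Rn n) (\<lambda>w. f w c j)"
    by (metis (no_types, lifting) continuous_on_cong)
qed

text \<open>The inverse \<open>J'\<close> of the linear map \<open>J\<close> is linear on
  \<open>V\<close>, hence itself a chart of the atlas, and its smoothness along plots is part of the
  definition of the standard diffeology.\<close>

lemma centred_chart_vector_manifold:
  fixes J :: "(nat \<Rightarrow> real) \<Rightarrow> 'i \<Rightarrow> nat \<Rightarrow> real"
  assumes J: "linear_on (Rn k) J" and V: "V = J ` Rn k"
    and inv: "\<And>w. w \<in> Rn k \<Longrightarrow> J' (J w) = w" and cont: "continuous_on V J'"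
  shows "centred_chart (vector_manifold V) 0 k (Rn k) (restrict J (Rn k)) J'"
proof
  have lin': "linear_on V J'"
    unfolding linear_on_def V
  proof (intro conjI ballI allI)
    fix a b assume "a \<in> J ` Rn k" "b \<in> J ` Rn k"
    then obtain u w where uw: "u \<in> Rn k" "w \<in> Rn k" "a = J u" "b = J w" by blast
    then have "a + b = J (u + w)" using J by (simp add: linear_on_def)
    then show "J' (a + b) = J' a + J' b" using uw inv Rn_add by simp
  next
    fix c a assume "a \<in> J ` Rn k"
    then obtain u where u: "u \<in> Rn k" "a = J u" by blast
    then have "c *\<^sub>R a = J (c *\<^sub>R u)" using J by (simp add: linear_on_def)
    then show "J' (c *\<^sub>R a) = c *\<^sub>R J' a" using u inv Rn_scaleR by simp
  qed
  have img: "J' ` V = Rn k" unfolding V using inv by force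
  have inj: "inj_on J' V" unfolding V using inv by (auto simp: inj_on_def)
  have c: "(k, V, J') \<in> atlas (vector_manifold V)"
    using lin' img inj by (simp add: vector_manifold_def bij_betw_def)
  have atl: "W = V \<and> linear_on V L \<and> inj_on L V \<and> L ` V = Rn m" if "(m, W, L) \<in> atlas (vector_manifold V)" for m W L
    using that by (auto simp: vector_manifold_def bij_betw_def)
  have top: "mtop (vector_manifold V) = top_of_set V" by (simp add: vector_manifold_def)
  show "charted (vector_manifold V)"
    unfolding charted_def top
  proof (intro conjI ballI)
    fix e assume "e \<in> atlas (vector_manifold V)"
    then show "case e of (m, W, L) \<Rightarrow> openin (top_of_set V) W \<and> inj_on L W \<and> L ` W \<subseteq> Rn m"
      by (cases e) (use atl in force)
  next
    show "(\<Union>(n, U, \<phi>)\<in>atlas (vector_manifold V). U) = topspace (top_of_set V)"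
    proof
      show "(\<Union>(n, U, \<phi>)\<in>atlas (vector_manifold V). U) \<subseteq> topspace (top_of_set V)"
        using atl by force
      show "topspace (top_of_set V) \<subseteq> (\<Union>(n, U, \<phi>)\<in>atlas (vector_manifold V). U)"
        using UN_upper[OF c, of "\<lambda>(n, U, \<phi>). U"] by simp
    qed
  qed
  show "connected (Rn k)" by (rule connected_Rn)
  show "0 \<in> Rn k" by simp
  show "restrict J (Rn k) 0 = 0" using linear_on_zero[OF J] by simp
  have im: "restrict J (Rn k) ` Rn k = V" by (auto simp: V)
  have JV: "J w \<in> V" if "w \<in> Rn k" for w using V that by blast
  show "(k, Rn k, restrict J (Rn k)) \<in> standard_diffeology (vector_manifold V)"
  proof (rule standard_diffeologyI[OF openin_Rn])
    show "restrict J (Rn k) \<in> Rn k \<rightarrow>\<^sub>E mcarrier (vector_manifold V)"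
      unfolding top using JV by auto
    have "continuous_on (Rn k) (restrict J (Rn k))"
      using continuous_on_linear_Rn[OF J] by (metis (no_types, lifting) continuous_on_cong restrict_apply')
    then show "continuous_map (top_of_set (Rn k)) (mtop (vector_manifold V)) (restrict J (Rn k))"
      unfolding top using JV by (auto simp: continuous_map_in_subtopology)
    fix m W L assume "(m, W, L) \<in> atlas (vector_manifold V)"
    note L = atl[OF this]
    have eq: "{u \<in> Rn k. restrict J (Rn k) u \<in> W} = Rn k" using L JV by auto
    have "linear_on (Rn k) (\<lambda>w. L (J w))"
      by (rule linear_on_comp[OF J, of V]) (use L V in auto)
    then have "smooth_on k (Rn k) m (\<lambda>w. L (J w))"
      by (rule smooth_on_linear) (use L V in auto)
    then show "smooth_on k {u \<in> Rn k. restrict J (Rn k) u \<in> W} m (L \<circ> restrict J (Rn k))"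
      unfolding eq by (rule smooth_on_cong[OF openin_Rn]) simp
  qed
  show "openin (mtop (vector_manifold V)) (restrict J (Rn k) ` Rn k)"
    unfolding im top by simp
  show "J' (restrict J (Rn k) w) = w" if "w \<in> Rn k" for w using inv that by simp
  show "smooth_on d {z \<in> Z. q z \<in> restrict J (Rn k) ` Rn k} k (J' \<circ> q)"
    if "(d, Z, q) \<in> standard_diffeology (vector_manifold V)" for d Z q
    unfolding im by (rule standard_diffeologyD(5)[OF that c])
  show "continuous_map (subtopology (mtop (vector_manifold V)) (restrict J (Rn k) ` Rn k)) (Euclidean_space k) J'"
    unfolding im top using cont img by (auto simp: continuous_map_Euclidean_space subtopology_subtopology)
qed

section \<open>Derivatives of germs along lines\<close>

lemma germ_line_eventually:
  assumes "germ d Z n' W' g" "v \<in> Rn d"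
  shows "\<forall>\<^sub>F t in nhds 0. t *\<^sub>R v \<in> Z"
proof -
  have Z: "openin (Euclidean_space d) Z" "0 \<in> Z" using assms(1) by (auto simp: germ_def)
  have "\<forall>\<^sub>F t in at 0. t *\<^sub>R v \<in> Z"
  proof (rule eventually_in_open[OF Z])
    show "\<forall>\<^sub>F t in at 0. t *\<^sub>R v \<in> Rn d" by (intro always_eventually allI Rn_scaleR assms(2))
    show "((\<lambda>t. (t *\<^sub>R v) i) \<longlongrightarrow> 0 i) (at 0)" for i
      using DERIV_isCont[OF has_real_derivative_scaleR_fun[of v i]] by (simp add: isCont_def)
  qed
  then show ?thesis using Z(2) by (simp add: eventually_nhds_conv_at)
qed

lemma functional_derivative:
  fixes f :: "(nat \<Rightarrow> real) \<Rightarrow> real"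
  assumes f: "linear f" and g: "germ m Z n W g" and v: "v \<in> Rn m"
  shows "((\<lambda>t. f (g (t *\<^sub>R v))) has_real_derivative f (jacobian m g v)) (at 0)"
proof -
  have exp: "f y = (\<Sum>i<n. y i * f (unit_vec i))" if "y \<in> Rn n" for y
    using linear_on_Rn_expand[OF linear_linear_on[OF f] that] by simp
  have Z: "openin (Euclidean_space m) Z" "0 \<in> Z" "smooth_on m Z n g" using g by (auto simp: germ_def)
  have "((\<lambda>t. \<Sum>i<n. g (t *\<^sub>R v) i * f (unit_vec i)) has_real_derivative
      (\<Sum>i<n. jacobian m g v i * f (unit_vec i))) (at 0)"
    by (intro DERIV_sum DERIV_cmult_right jacobian_line[OF Z v]) simp
  then have D: "((\<lambda>t. \<Sum>i<n. g (t *\<^sub>R v) i * f (unit_vec i)) has_real_derivative f (jacobian m g v)) (at 0)"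
    using exp[OF germ_jacobian_Rn[OF g]] by simp
  have ev: "\<forall>\<^sub>F t in nhds 0. (\<Sum>i<n. g (t *\<^sub>R v) i * f (unit_vec i)) = f (g (t *\<^sub>R v))"
    by (rule eventually_mono[OF germ_line_eventually[OF g v]]) (use exp smooth_on_in_Rn[OF Z(3)] in simp)
  show ?thesis
    by (rule iffD1[OF DERIV_cong_ev[OF refl ev refl] D])
qed

lemma germ_line_derivative:
  assumes "germ d Z n' W' g" "v \<in> Rn d"
  shows "((\<lambda>t. g (t *\<^sub>R v) j) has_real_derivative jacobian d g v j) (at 0)"
proof -
  have "linear (\<lambda>y::nat \<Rightarrow> real. y j)"
    by (rule linearI) (simp_all add: scaleR_fun_apply)
  from functional_derivative[OF this assms] show ?thesis .
qed

section \<open>Quantitative local surjectivity\<close>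

text \<open>The l^1 norm on R^n, chosen because it is the error term in
  \<open>strict_differentiability\<close>.\<close>

definition norm1 :: "nat \<Rightarrow> (nat \<Rightarrow> real) \<Rightarrow> real"
  where "norm1 n w = (\<Sum>i<n. \<bar>w i\<bar>)"

lemma norm1_nonneg: "0 \<le> norm1 n w"
  by (simp add: norm1_def sum_nonneg)

lemma abs_le_norm1: "i < n \<Longrightarrow> \<bar>w i\<bar> \<le> norm1 n w"
  unfolding norm1_def by (rule member_le_sum) auto

lemma norm1_triangle_diff: "norm1 n (u - w) \<le> norm1 n u + norm1 n w"
  unfolding norm1_def sum.distrib[symmetric] by (rule sum_mono) (simp add: abs_triangle_ineq4)

lemma norm1_commute: "norm1 n (u - w) = norm1 n (w - u)"
  by (simp add: norm1_def abs_minus_commute)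

lemma norm1_zero [simp]: "norm1 n 0 = 0"
  by (simp add: norm1_def)

lemma norm1_less_cube: "w \<in> Rn n \<Longrightarrow> norm1 n w < r \<Longrightarrow> w \<in> cube n 0 r"
  using abs_le_norm1[of _ n w] by (force simp: cube_def)

lemma cube_norm1: "w \<in> cube n 0 r \<Longrightarrow> norm1 n w \<le> n * r"
  unfolding norm1_def cube_def using sum_bounded_above[of "{..<n}" "\<lambda>i. \<bar>w i\<bar>" r] by fastforce

lemma functional_bound:
  fixes f :: "(nat \<Rightarrow> real) \<Rightarrow> real"
  assumes "linear f"
  obtains C where "C > 0" "\<And>w. w \<in> Rn n \<Longrightarrow> \<bar>f w\<bar> \<le> C * norm1 n w"
proof -
  define C where "C = (\<Sum>i<n. \<bar>f (unit_vec i)\<bar>) + 1"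
  have "C > 0" by (simp add: C_def sum_nonneg add_nonneg_pos)
  moreover have "\<bar>f w\<bar> \<le> C * norm1 n w" if "w \<in> Rn n" for w
  proof -
    have "f w = (\<Sum>i<n. w i * f (unit_vec i))"
      using linear_on_Rn_expand[OF linear_linear_on[OF assms] that] by simp
    also have "\<bar>\<dots>\<bar> \<le> (\<Sum>i<n. \<bar>w i * f (unit_vec i)\<bar>)" by (rule sum_abs)
    also have "\<dots> \<le> (\<Sum>i<n. \<bar>w i\<bar> * C)"
    proof (rule sum_mono)
      fix i assume "i \<in> {..<n}"
      then have "\<bar>f (unit_vec i)\<bar> \<le> (\<Sum>i<n. \<bar>f (unit_vec i)\<bar>)"
        by (intro member_le_sum) auto
      then have "\<bar>f (unit_vec i)\<bar> \<le> C" by (simp add: C_def)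
      then show "\<bar>w i * f (unit_vec i)\<bar> \<le> \<bar>w i\<bar> * C"
        by (simp add: abs_mult mult_left_mono)
    qed
    also have "\<dots> = C * norm1 n w" by (simp add: norm1_def sum_distrib_left mult.commute)
    finally show ?thesis .
  qed
  ultimately show ?thesis using that by blast
qed

lemma linear_norm1_bound:
  fixes L :: "(nat \<Rightarrow> real) \<Rightarrow> nat \<Rightarrow> real"
  assumes "linear L"
  obtains C where "C > 0" "\<And>w. w \<in> Rn n \<Longrightarrow> norm1 m (L w) \<le> C * norm1 n w"
proof -
  have "linear (\<lambda>w. L w j)" for j
    using assms by (auto simp: linear_iff scaleR_fun_apply)
  then have "\<exists>C. C > 0 \<and> (\<forall>w\<in>Rn n. \<bar>L w j\<bar> \<le> C * norm1 n w)" for j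
    using functional_bound by metis
  then obtain C where C: "\<And>j. C j > 0" "\<And>j w. w \<in> Rn n \<Longrightarrow> \<bar>L w j\<bar> \<le> C j * norm1 n w"
    by metis
  have "norm1 m (L w) \<le> ((\<Sum>j<m. C j) + 1) * norm1 n w" if "w \<in> Rn n" for w
  proof -
    have "norm1 m (L w) \<le> (\<Sum>j<m. C j * norm1 n w)"
      unfolding norm1_def[of m] by (rule sum_mono) (rule C(2)[OF that])
    also have "\<dots> \<le> ((\<Sum>j<m. C j) + 1) * norm1 n w"
      using norm1_nonneg[of n w] by (simp add: sum_distrib_right[symmetric] distrib_right)
    finally show ?thesis .
  qed
  moreover have "(\<Sum>j<m. C j) + 1 > 0"
    using C(1) by (simp add: sum_nonneg add_nonneg_pos less_imp_le)
  ultimately show ?thesis using that by blast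
qed

lemma strict_jacobian:
  assumes U: "openin (Euclidean_space n) U" and z: "0 \<in> U" and g: "smooth_on n U m g" and e: "e > 0"
  obtains r where "r > 0" "cube n 0 r \<subseteq> U"
    "\<And>a b. a \<in> cube n 0 r \<Longrightarrow> b \<in> cube n 0 r \<Longrightarrow> norm1 m (g b - g a - jacobian n g (b - a)) \<le> e * norm1 n (b - a)"
proof -
  \<comment> \<open>The error is shared among the \<open>m\<close> components; the 1 avoids a
    division by zero for \<open>m = 0\<close>.\<close>
  define e' where "e' = e / (m + 1)"
  have e': "e' > 0" using e by (simp add: e'_def)
  have "\<exists>r>0. cube n 0 r \<subseteq> U \<and> (\<forall>a\<in>cube n 0 r. \<forall>b\<in>cube n 0 r.
      \<bar>g b j - g a j - jacobian n g (b - a) j\<bar> \<le> e' * norm1 n (b - a))" if "j < m" for j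
    using strict_differentiability[OF U smooth_on_component[OF g that] z e'] by (simp add: jacobian_def norm1_def)
  then obtain \<rho> where \<rho>: "\<And>j. j < m \<Longrightarrow> \<rho> j > 0"
    "\<And>j a b. j < m \<Longrightarrow> a \<in> cube n 0 (\<rho> j) \<Longrightarrow> b \<in> cube n 0 (\<rho> j) \<Longrightarrow>
      \<bar>g b j - g a j - jacobian n g (b - a) j\<bar> \<le> e' * norm1 n (b - a)"
    by metis
  obtain r0 where r0: "r0 > 0" "cube n 0 r0 \<subseteq> U"
    using cube_in_open[OF U z] by blast
  define r where "r = Min (insert r0 (\<rho> ` {..<m}))"
  have r: "r > 0" "r \<le> r0" "\<And>j. j < m \<Longrightarrow> r \<le> \<rho> j"
    using \<rho> r0 by (auto simp: r_def)
  have "norm1 m (g b - g a - jacobian n g (b - a)) \<le> e * norm1 n (b - a)"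
    if ab: "a \<in> cube n 0 r" "b \<in> cube n 0 r" for a b
  proof -
    have "norm1 m (g b - g a - jacobian n g (b - a)) \<le> (\<Sum>j<m. e' * norm1 n (b - a))"
      unfolding norm1_def[of m]
    proof (rule sum_mono)
      fix j assume "j \<in> {..<m}"
      then show "\<bar>(g b - g a - jacobian n g (b - a)) j\<bar> \<le> e' * norm1 n (b - a)"
        using \<rho>(2)[of j a b] ab cube_mono[OF r(3), of j n 0] by (auto simp: fun_diff_def)
    qed
    also have "\<dots> = (m * e') * norm1 n (b - a)" by simp
    also have "\<dots> \<le> e * norm1 n (b - a)"
      using e by (intro mult_right_mono norm1_nonneg) (simp add: e'_def field_simps)
    finally show ?thesis .
  qed
  moreover have "cube n 0 r \<subseteq> U" using r0(2) cube_mono[OF r(2)] by blast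
  ultimately show ?thesis using that r(1) by blast
qed

text \<open>Picard iteration \<open>w \<mapsto> y - E w\<close>.\<close>

lemma small_perturbation_surjective:
  fixes E :: "(nat \<Rightarrow> real) \<Rightarrow> nat \<Rightarrow> real"
  assumes ER: "\<And>a. a \<in> cube n 0 r \<Longrightarrow> E a \<in> Rn n" and E0: "E 0 = 0" and r: "r > 0"
    and contr: "\<And>a b. a \<in> cube n 0 r \<Longrightarrow> b \<in> cube n 0 r \<Longrightarrow> norm1 n (E b - E a) \<le> norm1 n (b - a) / 2"
    and y: "y \<in> Rn n" "2 * norm1 n y < r"
  shows "\<exists>w\<in>cube n 0 r. w + E w = y \<and> norm1 n w \<le> 2 * norm1 n y"
proof -
  define w where "w j = ((\<lambda>u. y - E u) ^^ j) 0" for j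
  have w0: "w 0 = 0" and wS: "w (Suc j) = y - E (w j)" for j by (simp_all add: w_def)
  have 0: "0 \<in> cube n 0 r" using r by (simp add: centre_in_cube)
  \<comment> \<open>The iterates stay in the ball of radius \<open>2 * norm1 n y\<close>:
    \<open>norm1 n y\<close> plus half of that radius is the radius again. By \<open>y(2)\<close>
    this ball lies in the cube, where \<open>E\<close> is controlled.\<close>
  have w: "w j \<in> Rn n \<and> norm1 n (w j) \<le> 2 * norm1 n y" for j
  proof (induction j)
    case 0
    have "0 \<le> 2 * norm1 n y" using norm1_nonneg[of n y] by simp
    then show ?case unfolding w0 norm1_zero using zero_in_Rn by blast
  next
    case (Suc j)
    then have c: "w j \<in> cube n 0 r" using norm1_less_cube y(2) by force
    have "norm1 n (E (w j)) \<le> norm1 n (w j) / 2"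
      using contr[OF 0 c] E0 by simp
    then have "norm1 n (w (Suc j)) \<le> 2 * norm1 n y"
      unfolding wS using norm1_triangle_diff[of n y "E (w j)"] Suc by linarith
    moreover have "w (Suc j) \<in> Rn n" unfolding wS by (rule Rn_diff[OF y(1) ER[OF c]])
    ultimately show ?case by blast
  qed
  have wc: "w j \<in> cube n 0 r" for j using w[of j] norm1_less_cube y(2) by force
  \<comment> \<open>The contraction constant 1/2 makes successive distances decay geometrically, so
    every coordinate is the limit of an absolutely convergent telescoping series.\<close>
  have step: "norm1 n (w (Suc j) - w j) \<le> norm1 n y * (1/2) ^ j" for j
  proof (induction j)
    case 0
    show ?case unfolding wS w0 E0 by simp
  next
    case (Suc j)
    have "w (Suc (Suc j)) - w (Suc j) = E (w j) - E (w (Suc j))"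
      unfolding wS[of "Suc j"] wS[of j] by simp
    then have "norm1 n (w (Suc (Suc j)) - w (Suc j)) \<le> norm1 n (w j - w (Suc j)) / 2"
      using contr[OF wc wc] by simp
    moreover have "norm1 n y * (1/2) ^ Suc j = norm1 n y * (1/2) ^ j / 2" by simp
    ultimately show ?case using Suc norm1_commute[of n "w j" "w (Suc j)"] by linarith
  qed
  have "\<exists>l. (\<lambda>j. w j i) \<longlonglongrightarrow> l" if i: "i < n" for i
  proof -
    have "norm (w (Suc j) i - w j i) \<le> norm1 n y * (1/2) ^ j" for j
      using order_trans[OF abs_le_norm1[OF i] step[of j]] by simp
    moreover have "summable (\<lambda>j. norm1 n y * (1/2::real) ^ j)"
      by (intro summable_mult summable_geometric) simp
    ultimately have "summable (\<lambda>j. w (Suc j) i - w j i)"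
      by (rule summable_comparison_test'[rotated])
    then have "(\<lambda>N. \<Sum>j<N. w (Suc j) i - w j i) \<longlonglongrightarrow> (\<Sum>j. w (Suc j) i - w j i)"
      by (rule summable_LIMSEQ)
    moreover have "(\<Sum>j<N. w (Suc j) i - w j i) = w N i" for N
      using sum_lessThan_telescope[of "\<lambda>j. w j i" N] by (simp add: w0)
    ultimately show ?thesis by auto
  qed
  then obtain l where l: "\<And>i. i < n \<Longrightarrow> (\<lambda>j. w j i) \<longlonglongrightarrow> l i" by metis
  \<comment> \<open>Coordinates from \<open>n\<close> on are set to 0, so that the limit lies in
    R^n.\<close>
  define v where "v i = (if i < n then l i else 0)" for i
  have v: "(\<lambda>j. w j i) \<longlonglongrightarrow> v i" if "i < n" for i using l[OF that] that by (simp add: v_def)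
  have vR: "v \<in> Rn n" by (simp add: v_def topspace_Euclidean_space)
  have "(\<lambda>j. norm1 n (w j)) \<longlonglongrightarrow> norm1 n v"
    unfolding norm1_def by (intro tendsto_sum tendsto_rabs v) auto
  then have vn: "norm1 n v \<le> 2 * norm1 n y"
    by (rule LIMSEQ_le_const2) (use w in auto)
  then have vc: "v \<in> cube n 0 r" by (intro norm1_less_cube[OF vR]) (use y(2) in linarith)
  have vlim: "(\<lambda>j. norm1 n (w j - v)) \<longlonglongrightarrow> 0"
  proof -
    have "(\<lambda>j. \<Sum>i<n. \<bar>w j i - v i\<bar>) \<longlonglongrightarrow> (\<Sum>i<n. \<bar>v i - v i\<bar>)"
      by (intro tendsto_sum tendsto_rabs tendsto_diff v tendsto_const) auto
    then show ?thesis by (simp add: norm1_def)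
  qed
  have "(v + E v) i = y i" for i
  proof (cases "i < n")
    case True
    have "(\<lambda>j. E (w j) i - E v i) \<longlonglongrightarrow> 0"
    proof (rule Lim_null_comparison[OF _ vlim])
      have "norm (E (w j) i - E v i) \<le> norm1 n (w j - v)" for j
      proof -
        have "\<bar>(E (w j) - E v) i\<bar> \<le> norm1 n (w j - v)"
          using order_trans[OF abs_le_norm1[OF True, of "E (w j) - E v"] contr[OF vc wc]] norm1_nonneg[of n "w j - v"]
          by linarith
        then show ?thesis by (simp only: fun_diff_def real_norm_def)
      qed
      then show "\<forall>\<^sub>F j in sequentially. norm (E (w j) i - E v i) \<le> norm1 n (w j - v)" by simp
    qed
    then have "(\<lambda>j. E (w j) i) \<longlonglongrightarrow> E v i" by (simp add: LIM_zero_iff)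
    with LIMSEQ_Suc[OF v[OF True]] have "(\<lambda>j. w (Suc j) i + E (w j) i) \<longlonglongrightarrow> v i + E v i"
      by (rule tendsto_add)
    then have "(\<lambda>j. y i) \<longlonglongrightarrow> v i + E v i" by (simp add: wS)
    from LIMSEQ_unique[OF this tendsto_const] show ?thesis by simp
  next
    case False
    then show ?thesis using vR ER[OF vc] y(1) by (simp add: topspace_Euclidean_space)
  qed
  then have "v + E v = y" by (rule ext)
  with vc vn show ?thesis by blast
qed


section \<open>Actions in coordinates\<close>

text \<open>\<open>left_part\<close>, \<open>right_part\<close> and \<open>join\<close> identify
  R^(m+n) with a product, by the index convention of the charts in
  \<open>product_manifold\<close>.\<close>

definition left_part :: "nat \<Rightarrow> (nat \<Rightarrow> real) \<Rightarrow> nat \<Rightarrow> real"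
  where "left_part m u = (\<lambda>i. if i < m then u i else 0)"

definition right_part :: "nat \<Rightarrow> (nat \<Rightarrow> real) \<Rightarrow> nat \<Rightarrow> real"
  where "right_part m u = (\<lambda>i. u (i + m))"

definition join :: "nat \<Rightarrow> (nat \<Rightarrow> real) \<Rightarrow> (nat \<Rightarrow> real) \<Rightarrow> nat \<Rightarrow> real"
  where "join m \<xi> y = (\<lambda>i. if i < m then \<xi> i else y (i - m))"

lemma left_part_join: "\<xi> \<in> Rn m \<Longrightarrow> left_part m (join m \<xi> y) = \<xi>"
  by (auto simp: left_part_def join_def fun_eq_iff topspace_Euclidean_space)

lemma right_part_join: "right_part m (join m \<xi> y) = y"
  by (auto simp: right_part_def join_def fun_eq_iff)

lemma join_Rn: "\<xi> \<in> Rn m \<Longrightarrow> y \<in> Rn n \<Longrightarrow> join m \<xi> y \<in> Rn (m + n)"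
  by (auto simp: join_def topspace_Euclidean_space)

lemma left_part_Rn: "left_part m u \<in> Rn m"
  by (auto simp: left_part_def topspace_Euclidean_space)

lemma right_part_Rn: "u \<in> Rn (m + n) \<Longrightarrow> right_part m u \<in> Rn n"
  by (auto simp: right_part_def topspace_Euclidean_space)

lemma linear_left_part: "linear (left_part m)"
  by (rule linearI) (auto simp: left_part_def fun_eq_iff scaleR_fun_apply)

lemma linear_right_part: "linear (right_part m)"
  by (rule linearI) (auto simp: right_part_def fun_eq_iff scaleR_fun_apply)

lemma join_add: "join m (\<xi> + \<xi>') (y + y') = join m \<xi> y + join m \<xi>' y'"
  by (auto simp: join_def fun_eq_iff)

lemma join_scaleR: "join m (c *\<^sub>R \<xi>) (c *\<^sub>R y) = c *\<^sub>R join m \<xi> y"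
  by (auto simp: join_def fun_eq_iff scaleR_fun_apply)

lemma join_diff: "join m \<xi> y - join m \<xi> y' = join m 0 (y - y')"
  by (auto simp: join_def fun_eq_iff)

lemma norm1_join_zero: "norm1 (m + n) (join m 0 y) = norm1 n y"
proof -
  have "norm1 (m + n) (join m 0 y) = (\<Sum>i\<in>{m..<m+n}. \<bar>join m 0 y i\<bar>)"
    unfolding norm1_def by (rule sum.mono_neutral_right) (auto simp: join_def)
  also have "\<dots> = (\<Sum>i\<in>{0..<n}. \<bar>join m 0 y (i + m)\<bar>)"
    using sum.shift_bounds_nat_ivl[of "\<lambda>i. \<bar>join m 0 y i\<bar>" 0 m n] by (simp add: add.commute)
  also have "\<dots> = norm1 n y" by (simp add: join_def norm1_def atLeast0LessThan)
  finally show ?thesis .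
qed

locale lie_group_action =
  fixes G :: "('g, 'c) monoid_scheme" and \<G> :: "'g manifold" and M :: "'a manifold"
    and A :: "'g \<Rightarrow> 'a \<Rightarrow> 'a"
  assumes lie_group: "lie_group G \<G>" and manifold: "is_manifold M" and action: "smooth_action G \<G> M A"
begin

lemma group_manifold: "is_manifold \<G>" and group_carrier: "mcarrier \<G> = carrier G" and group: "group G"
  using lie_group by (auto simp: lie_group_def)

sublocale group_action G "mcarrier M" A
  using action by (simp add: smooth_action_def)

sublocale grp: group G
  by (rule group)

lemma A_one: "x \<in> mcarrier M \<Longrightarrow> A \<one>\<^bsub>G\<^esub> x = x"
  using id_eq_one by (metis restrict_apply')

lemma plot_action:
  assumes q: "(d, Z, q) \<in> standard_diffeology \<G>" and s: "(d, Z, s) \<in> standard_diffeology M"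
  shows "(d, Z, restrict (\<lambda>z. A (q z) (s z)) Z) \<in> standard_diffeology M"
proof -
  have f: "smooth_map (product_manifold \<G> M) M (\<lambda>(g, x). A g x)"
    using action by (simp add: smooth_action_def)
  note c = is_manifold_charted[OF group_manifold] is_manifold_charted[OF manifold]
  from plot_smooth_map[OF charted_product[OF c] c(2) f plot_pair[OF c q s]]
  have "(d, Z, restrict ((\<lambda>(g, x). A g x) \<circ> restrict (\<lambda>u. (q u, s u)) Z) Z) \<in> standard_diffeology M" .
  moreover have "restrict ((\<lambda>(g, x). A g x) \<circ> restrict (\<lambda>u. (q u, s u)) Z) Z = restrict (\<lambda>z. A (q z) (s z)) Z"
    by (auto simp: restrict_def fun_eq_iff)
  ultimately show ?thesis by simp
qed

lemma plot_translate:
  assumes "g \<in> carrier G" and s: "(d, Z, s) \<in> standard_diffeology M"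
  shows "(d, Z, restrict (A g \<circ> s) Z) \<in> standard_diffeology M"
proof -
  have q: "(d, Z, restrict (\<lambda>z. g) Z) \<in> standard_diffeology \<G>"
    by (rule plot_const[OF is_manifold_charted[OF group_manifold] standard_diffeologyD(1)[OF s]])
      (simp add: group_carrier assms(1))
  from plot_action[OF q s] show ?thesis
    by (simp add: restrict_def cong: if_cong)
qed

lemma plot_orbit:
  assumes x: "x \<in> mcarrier M" and q: "(d, Z, q) \<in> standard_diffeology \<G>"
  shows "(d, Z, restrict ((\<lambda>g. A g x) \<circ> q) Z) \<in> standard_diffeology M"
proof -
  have s: "(d, Z, restrict (\<lambda>z. x) Z) \<in> standard_diffeology M"
    by (rule plot_const[OF is_manifold_charted[OF manifold] standard_diffeologyD(1)[OF q] x])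
  from plot_action[OF q s] show ?thesis
    by (simp add: restrict_def cong: if_cong)
qed

lemma orbit_rel_iff: "(x, y) \<in> orbit_rel G (mcarrier M) A \<longleftrightarrow> x \<in> mcarrier M \<and> (\<exists>g\<in>carrier G. y = A g x)"
  by (auto simp: orbit_rel_def orbit_def)

end

lemma equiv_orbit_rel:
  assumes "group_action H X B"
  shows "equiv X (orbit_rel H X B)"
proof -
  interpret group_action H X B by fact
  have sub: "orbit_rel H X B \<subseteq> X \<times> X"
    unfolding orbit_rel_def orbit_def using element_image by blast
  show ?thesis
  proof (rule equivI)
    show "refl_on X (orbit_rel H X B)"
      using sub orbit_refl by (auto simp: refl_on_def orbit_rel_def)
    show "sym (orbit_rel H X B)"
      using sub orbit_sym by (auto intro!: symI simp: orbit_rel_def)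
    show "trans (orbit_rel H X B)"
      using sub orbit_trans by (auto intro!: transI simp: orbit_rel_def)
  qed (use sub in auto)
qed

lemma orbit_rel_Image: "x \<in> X \<Longrightarrow> orbit_rel H X B `` {x} = orbit H B x"
  by (auto simp: orbit_rel_def)

section \<open>The slice representation\<close>

text \<open>The chart at \<open>x\<^sub>0\<close> flattens \<open>S\<close> to R^k; R^m, the
  coordinates at the identity of the group, stands for the Lie algebra.\<close>

locale slice_chart = lie_group_action G \<G> M A
    + C: centred_chart M x\<^sub>0 n W p \<phi> + B: centred_chart \<G> "\<one>\<^bsub>G\<^esub>" m WG pG \<phi>G
  for G :: "('g, 'c) monoid_scheme" and \<G> :: "'g manifold" and M :: "'a manifold"
    and A :: "'g \<Rightarrow> 'a \<Rightarrow> 'a" and x\<^sub>0 n W p \<phi> m WG pG \<phi>G +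
  fixes S :: "'a set" and k :: nat
  assumes proper: "proper_action \<G> M A" and slice: "slice G \<G> M A x\<^sub>0 S"
    and k_le: "k \<le> n" and S_iff: "\<And>w. w \<in> W \<Longrightarrow> p w \<in> S \<longleftrightarrow> w \<in> Rn k"
begin

abbreviation "K \<equiv> stabilizer G A x\<^sub>0"
abbreviation "V \<equiv> tangent_space M S x\<^sub>0"
abbreviation "\<rho> \<equiv> tangent_action M A S x\<^sub>0"
abbreviation "J \<equiv> C.tangent_vector"

lemma K_carrier: "g \<in> K \<Longrightarrow> g \<in> carrier G" and K_fixes: "g \<in> K \<Longrightarrow> A g x\<^sub>0 = x\<^sub>0"
  by (auto simp: stabilizer_def)

lemma K_subgroup: "subgroup K G"
  by (rule stabilizer_subgroup[OF C.x_carrier])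

lemma Rk_Rn: "w \<in> Rn k \<Longrightarrow> w \<in> Rn n"
  using k_le subset_Euclidean_space by blast

lemma V_eq: "V = J ` Rn k"
  by (rule C.tangent_space_slice[OF k_le S_iff])

lemma J_inj: "u \<in> Rn n \<Longrightarrow> w \<in> Rn n \<Longrightarrow> J u = J w \<Longrightarrow> u = w"
  using C.inj_tangent_vector[OF manifold] by (auto dest: inj_onD)

lemma J_add: "J (u + w) = J u + J w"
  by (rule linear_add[OF C.linear_tangent_vector])

lemma J_scaleR: "J (c *\<^sub>R w) = c *\<^sub>R J w"
  by (rule linear_scale[OF C.linear_tangent_vector])

text \<open>Fibres of a proper map are compact; the fibre over the pair with both entries
  \<open>x\<^sub>0\<close> projects onto the stabilizer.\<close>

lemma compact_K: "compactin (mtop \<G>) K"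
proof -
  have c: "compactin (prod_topology (mtop M) (mtop M)) {(x\<^sub>0, x\<^sub>0)}"
    using C.x_carrier by (simp add: finite_imp_compactin)
  have "compactin (prod_topology (mtop \<G>) (mtop M))
      {z \<in> topspace (prod_topology (mtop \<G>) (mtop M)). (\<lambda>(g, x). (A g x, x)) z \<in> {(x\<^sub>0, x\<^sub>0)}}"
    using compactin_proper_map_preimage[OF proper[unfolded proper_action_def] c] by simp
  from image_compactin[OF this continuous_map_fst]
  have "compactin (mtop \<G>) (fst ` {z \<in> topspace (prod_topology (mtop \<G>) (mtop M)). (\<lambda>(g, x). (A g x, x)) z \<in> {(x\<^sub>0, x\<^sub>0)}})" .
  moreover have "fst ` {z \<in> topspace (prod_topology (mtop \<G>) (mtop M)). (\<lambda>(g, x). (A g x, x)) z \<in> {(x\<^sub>0, x\<^sub>0)}} = K"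
    using C.x_carrier by (auto simp: stabilizer_def group_carrier image_iff)
  ultimately show ?thesis by simp
qed

definition action_domain :: "'g \<Rightarrow> (nat \<Rightarrow> real) set"
  where "action_domain g = {w \<in> W. A g (p w) \<in> p ` W}"

text \<open>The isotropy representation in coordinates, on the whole of R^n. By
  \<open>\<rho>_J\<close> its restriction to R^k is the tangent action.\<close>

definition D :: "'g \<Rightarrow> (nat \<Rightarrow> real) \<Rightarrow> nat \<Rightarrow> real"
  where "D g = jacobian n (\<phi> \<circ> A g \<circ> p)"

lemma germ_translate:
  assumes g: "g \<in> K"
  shows "germ n (action_domain g) n W (\<phi> \<circ> A g \<circ> p)"
  unfolding germ_def
proof (intro conjI)
  note q = plot_translate[OF K_carrier[OF g] C.plot_p]
  have eq: "action_domain g = {w \<in> W. restrict (A g \<circ> p) W w \<in> p ` W}"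
    by (auto simp: action_domain_def)
  show o: "openin (Euclidean_space n) (action_domain g)"
    unfolding eq by (rule C.open_preimage[OF q])
  show "0 \<in> action_domain g"
    using C.zero_W C.p_zero C.x_image K_fixes[OF g] by (simp add: action_domain_def)
  show "smooth_on n (action_domain g) n (\<phi> \<circ> A g \<circ> p)"
    by (rule smooth_on_cong[OF o, of n "\<phi> \<circ> restrict (A g \<circ> p) W"])
      (use C.smooth_coordinates[OF q] in \<open>auto simp: eq\<close>)
  show "(\<phi> \<circ> A g \<circ> p) ` action_domain g \<subseteq> W"
    using C.inverse'(1) by (auto simp: action_domain_def)
  show "(\<phi> \<circ> A g \<circ> p) 0 = 0"
    by (simp add: C.p_zero K_fixes[OF g] C.phi_x)
qed

lemma action_domain: "w \<in> action_domain g \<Longrightarrow> w \<in> W" "w \<in> action_domain g \<Longrightarrow> A g (p w) \<in> p ` W"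
    "w \<in> action_domain g \<Longrightarrow> p ((\<phi> \<circ> A g \<circ> p) w) = A g (p w)"
  using C.inverse' by (auto simp: action_domain_def)

lemma linear_D: "linear (D g)"
  unfolding D_def by (rule linear_jacobian)

lemma D_Rn: "g \<in> K \<Longrightarrow> D g w \<in> Rn n"
  unfolding D_def by (rule germ_jacobian_Rn[OF germ_translate])

lemma S_invariant: "g \<in> K \<Longrightarrow> y \<in> S \<Longrightarrow> A g y \<in> S"
  using slice by (auto simp: slice_def)

lemma S_stabilizer: "g \<in> carrier G \<Longrightarrow> y \<in> S \<Longrightarrow> A g y \<in> S \<Longrightarrow> g \<in> K"
  using slice by (auto simp: slice_def)

lemma translate_slice:
  assumes g: "g \<in> K" and w: "w \<in> action_domain g" "w \<in> Rn k"
  shows "(\<phi> \<circ> A g \<circ> p) w \<in> Rn k"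
proof -
  have "A g (p w) \<in> S"
    using S_iff[OF action_domain(1)[OF w(1)]] w(2) S_invariant[OF g] by simp
  moreover have "(\<phi> \<circ> A g \<circ> p) w \<in> W"
    using C.inverse'(1)[OF action_domain(2)[OF w(1)]] by simp
  ultimately show ?thesis
    using S_iff action_domain(3)[OF w(1)] by metis
qed

text \<open>\<open>K\<close> preserves \<open>S\<close>, so the coordinates from \<open>k\<close> on
  vanish along the translate of a line in R^k, and so do their derivatives.\<close>

lemma D_slice:
  assumes g: "g \<in> K" and w: "w \<in> Rn k"
  shows "D g w \<in> Rn k"
proof -
  have "D g w j = 0" if j: "j \<ge> k" for j
  proof -
    have ev: "\<forall>\<^sub>F t in nhds 0. (\<phi> \<circ> A g \<circ> p) (t *\<^sub>R w) j = 0"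
    proof (rule eventually_mono[OF germ_line_eventually[OF germ_translate[OF g] Rk_Rn[OF w]]])
      fix t assume "t *\<^sub>R w \<in> action_domain g"
      from translate_slice[OF g this Rn_scaleR[OF w]] show "(\<phi> \<circ> A g \<circ> p) (t *\<^sub>R w) j = 0"
        using j by (simp add: topspace_Euclidean_space)
    qed
    from iffD1[OF DERIV_cong_ev[OF refl ev refl] germ_line_derivative[OF germ_translate[OF g] Rk_Rn[OF w]]]
    show ?thesis unfolding D_def using DERIV_unique DERIV_const by blast
  qed
  then show ?thesis by (simp add: topspace_Euclidean_space)
qed

lemma D_one: "w \<in> Rn n \<Longrightarrow> D \<one>\<^bsub>G\<^esub> w = w"
proof -
  assume w: "w \<in> Rn n"
  have "jacobian n (\<phi> \<circ> A \<one>\<^bsub>G\<^esub> \<circ> p) w = jacobian n (\<lambda>w. w) w"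
    by (rule jacobian_cong[OF C.open_W C.zero_W]) (simp add: A_one C.p_carrier C.inverse)
  then show ?thesis by (simp add: D_def jacobian_id[OF w])
qed

lemma D_mult:
  assumes g: "g \<in> K" and h: "h \<in> K"
  shows "D (g \<otimes>\<^bsub>G\<^esub> h) w = D g (D h w)"
proof -
  note gg = germ_translate[OF g] and gh = germ_translate[OF h]
  define Z where "Z = {w \<in> action_domain h. (\<phi> \<circ> A h \<circ> p) w \<in> action_domain g}"
  have Z: "openin (Euclidean_space n) Z"
    unfolding Z_def
    by (rule openin_smooth_preimage[where g = "\<phi> \<circ> A h \<circ> p" and m = n])
      (use gg gh in \<open>simp_all only: germ_def\<close>)
  have z: "0 \<in> Z" using gg gh by (simp add: Z_def germ_def)
  have s: "smooth_on n Z n (\<phi> \<circ> A h \<circ> p)"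
    by (rule smooth_on_subset[of _ "action_domain h"]) (use gh in \<open>auto simp: Z_def germ_def\<close>)
  have "jacobian n ((\<phi> \<circ> A g \<circ> p) \<circ> (\<phi> \<circ> A h \<circ> p)) w = D g (D h w)"
    unfolding D_def
    by (rule jacobian_comp[OF Z s, where V = "action_domain g"]) (use gg gh z in \<open>auto simp: Z_def germ_def\<close>)
  moreover have "jacobian n (\<phi> \<circ> A (g \<otimes>\<^bsub>G\<^esub> h) \<circ> p) w = jacobian n ((\<phi> \<circ> A g \<circ> p) \<circ> (\<phi> \<circ> A h \<circ> p)) w"
  proof (rule jacobian_cong[OF Z z])
    fix w assume w: "w \<in> Z"
    then have h': "w \<in> action_domain h" by (simp add: Z_def)
    have "p ((\<phi> \<circ> A h \<circ> p) w) = A h (p w)" by (rule action_domain(3)[OF h'])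
    then show "(\<phi> \<circ> A (g \<otimes>\<^bsub>G\<^esub> h) \<circ> p) w = ((\<phi> \<circ> A g \<circ> p) \<circ> (\<phi> \<circ> A h \<circ> p)) w"
      using composition_rule[OF C.p_carrier[OF action_domain(1)[OF h']] K_carrier[OF g] K_carrier[OF h]]
      by simp
  qed
  ultimately show ?thesis by (simp add: D_def)
qed

lemma \<rho>_J:
  assumes g: "g \<in> K" and w: "w \<in> Rn k"
  shows "\<rho> g (J w) = J (D g w)"
proof -
  have "differential M M (A g) x\<^sub>0 (J w) = J (D g w)"
    unfolding D_def
    by (rule differential_tangent_vector[OF C.centred_chart_axioms C.centred_chart_axioms manifold
          plot_translate[OF K_carrier[OF g]] K_fixes[OF g] Rk_Rn[OF w]])
  moreover have "J w \<in> V" using w by (simp add: V_eq)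
  ultimately show ?thesis by (simp add: tangent_action_def)
qed

lemma V_cases:
  assumes "v \<in> V" obtains w where "w \<in> Rn k" "v = J w"
  using assms V_eq by blast

lemma \<rho>_V: "g \<in> K \<Longrightarrow> v \<in> V \<Longrightarrow> \<rho> g v \<in> V"
  by (elim V_cases) (simp add: \<rho>_J V_eq D_slice)

lemma subspace_V: "subspace V"
  unfolding V_eq by (rule linear_subspace_image[OF C.linear_tangent_vector subspace_Rn])

lemma \<rho>_linear: "g \<in> K \<Longrightarrow> linear_on V (\<rho> g)"
  unfolding linear_on_def
proof (intro conjI ballI allI)
  fix a b assume g: "g \<in> K" and "a \<in> V" "b \<in> V"
  then obtain u w where "u \<in> Rn k" "w \<in> Rn k" "a = J u" "b = J w" using V_cases by metis
  then show "\<rho> g (a + b) = \<rho> g a + \<rho> g b"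
    using \<rho>_J[OF g] Rn_add by (simp add: linear_add[OF linear_D] flip: J_add)
next
  fix c a assume g: "g \<in> K" and "a \<in> V"
  then obtain u where "u \<in> Rn k" "a = J u" using V_cases by metis
  then show "\<rho> g (c *\<^sub>R a) = c *\<^sub>R \<rho> g a"
    using \<rho>_J[OF g] Rn_scaleR by (simp add: linear_scale[OF linear_D] flip: J_scaleR)
qed

lemma \<rho>_mult:
  assumes "g \<in> K" "h \<in> K" "v \<in> V"
  shows "\<rho> (g \<otimes>\<^bsub>G\<^esub> h) v = \<rho> g (\<rho> h v)"
proof -
  obtain w where w: "w \<in> Rn k" "v = J w" using assms(3) V_cases by metis
  then show ?thesis
    using \<rho>_J D_slice[OF assms(2) w(1)] subgroup.m_closed[OF K_subgroup assms(1,2)] assms D_mult by simp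
qed

lemma \<rho>_one: "v \<in> V \<Longrightarrow> \<rho> \<one>\<^bsub>G\<^esub> v = v"
  by (elim V_cases) (simp add: \<rho>_J subgroup.one_closed[OF K_subgroup] D_one Rk_Rn)

lemma \<rho>_Bij: "g \<in> K \<Longrightarrow> \<rho> g \<in> Bij V"
proof -
  assume g: "g \<in> K"
  have i: "inv\<^bsub>G\<^esub> g \<in> K" by (rule subgroup.m_inv_closed[OF K_subgroup g])
  have 1: "inv\<^bsub>G\<^esub> g \<otimes>\<^bsub>G\<^esub> g = \<one>\<^bsub>G\<^esub>" "g \<otimes>\<^bsub>G\<^esub> inv\<^bsub>G\<^esub> g = \<one>\<^bsub>G\<^esub>"
    using K_carrier[OF g] by simp_all
  have "bij_betw (\<rho> g) V V"
  proof (rule bij_betwI[where g = "\<rho> (inv\<^bsub>G\<^esub> g)"])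
    show "\<rho> (inv\<^bsub>G\<^esub> g) (\<rho> g v) = v" if "v \<in> V" for v
      using \<rho>_mult[OF i g that] 1 \<rho>_one[OF that] by simp
    show "\<rho> g (\<rho> (inv\<^bsub>G\<^esub> g) v) = v" if "v \<in> V" for v
      using \<rho>_mult[OF g i that] 1 \<rho>_one[OF that] by simp
  qed (use \<rho>_V g i in auto)
  then show ?thesis by (simp add: Bij_def tangent_action_def)
qed

lemma \<rho>_group_action: "group_action (stabilizer_group G A x\<^sub>0) V \<rho>"
proof (unfold group_action_def, rule group_hom.intro)
  show "group (stabilizer_group G A x\<^sub>0)"
    unfolding stabilizer_group_def by (rule subgroup.subgroup_is_group[OF K_subgroup group])
  show "group (BijGroup V)" by (rule group_BijGroup)
  show "group_hom_axioms (stabilizer_group G A x\<^sub>0) (BijGroup V) \<rho>"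
  proof (rule group_hom_axioms.intro, rule homI)
    fix g assume "g \<in> carrier (stabilizer_group G A x\<^sub>0)"
    then show "\<rho> g \<in> carrier (BijGroup V)"
      using \<rho>_Bij by (simp add: stabilizer_group_def BijGroup_def)
  next
    fix g h assume "g \<in> carrier (stabilizer_group G A x\<^sub>0)" "h \<in> carrier (stabilizer_group G A x\<^sub>0)"
    then have gh: "g \<in> K" "h \<in> K" by (simp_all add: stabilizer_group_def)
    \<comment> \<open>Outside \<open>V\<close> both sides are \<open>undefined\<close>, because
      \<open>tangent_action\<close> and \<open>compose\<close> restrict to \<open>V\<close>; hence
      an equality of functions.\<close>
    have "\<rho> (g \<otimes>\<^bsub>G\<^esub> h) = compose V (\<rho> g) (\<rho> h)"
    proof
      fix v show "\<rho> (g \<otimes>\<^bsub>G\<^esub> h) v = compose V (\<rho> g) (\<rho> h) v"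
        using \<rho>_mult[OF gh, of v] by (cases "v \<in> V") (simp_all add: compose_def tangent_action_def)
    qed
    then show "\<rho> (g \<otimes>\<^bsub>stabilizer_group G A x\<^sub>0\<^esub> h) = \<rho> g \<otimes>\<^bsub>BijGroup V\<^esub> \<rho> h"
      using \<rho>_Bij gh by (simp add: stabilizer_group_def BijGroup_def)
  qed
qed

text \<open>As \<open>l\<close> fixes \<open>x\<^sub>0\<close>, the action can be read in charts
  around \<open>l\<close> and \<open>x\<^sub>0\<close> near the origin. The identity in place of
  \<open>l\<close> leads to tube coordinates; an arbitrary \<open>l\<close> leads to estimates and
  continuity near \<open>l\<close> within the compact group \<open>K\<close>.\<close>

lemma joint_coordinates:
  assumes l: "centred_chart \<G> l d WL pL \<phi>L" and lK: "l \<in> K"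
    and F: "F = (\<lambda>u. \<phi> (A (pL (left_part d u)) (p (right_part d u))))"
  shows "\<exists>Z. openin (Euclidean_space (d + n)) Z \<and> 0 \<in> Z \<and> smooth_on (d + n) Z n F \<and>
    (\<forall>u\<in>Z. left_part d u \<in> WL \<and> right_part d u \<in> W \<and> A (pL (left_part d u)) (p (right_part d u)) \<in> p ` W)"
proof -
  interpret L: centred_chart \<G> l d WL pL \<phi>L by fact
  have sl: "smooth_on (d + n) (Rn (d + n)) d (left_part d)"
    by (rule smooth_on_linear[OF linear_linear_on[OF linear_left_part] _ openin_Rn]) (use left_part_Rn in auto)
  have sr: "smooth_on (d + n) (Rn (d + n)) n (right_part d)"
    by (rule smooth_on_linear[OF linear_linear_on[OF linear_right_part] _ openin_Rn]) (use right_part_Rn in auto)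
  define Y where "Y = {u \<in> Rn (d + n). left_part d u \<in> WL} \<inter> {u \<in> Rn (d + n). right_part d u \<in> W}"
  have Y: "openin (Euclidean_space (d + n)) Y"
    unfolding Y_def
    by (rule openin_Int[OF openin_smooth_preimage[OF openin_Rn sl L.open_W] openin_smooth_preimage[OF openin_Rn sr C.open_W]])
  have q: "(d + n, Y, restrict (pL \<circ> left_part d) Y) \<in> standard_diffeology \<G>"
    by (rule plot_precompose[OF L.charted L.plot_p Y smooth_on_subset[OF sl]]) (auto simp: Y_def)
  have s: "(d + n, Y, restrict (p \<circ> right_part d) Y) \<in> standard_diffeology M"
    by (rule plot_precompose[OF C.charted C.plot_p Y smooth_on_subset[OF sr]]) (auto simp: Y_def)
  define H where "H = restrict (\<lambda>u. A (restrict (pL \<circ> left_part d) Y u) (restrict (p \<circ> right_part d) Y u)) Y"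
  have H: "(d + n, Y, H) \<in> standard_diffeology M"
    unfolding H_def by (rule plot_action[OF q s])
  have Hu: "H u = A (pL (left_part d u)) (p (right_part d u))" if "u \<in> Y" for u
    using that by (simp add: H_def)
  define Z where "Z = {u \<in> Y. H u \<in> p ` W}"
  have Z: "openin (Euclidean_space (d + n)) Z" unfolding Z_def by (rule C.open_preimage[OF H])
  have "left_part d 0 = 0" "right_part d 0 = 0"
    by (rule linear_0[OF linear_left_part], rule linear_0[OF linear_right_part])
  then have "0 \<in> Y" "H 0 = x\<^sub>0"
    using L.zero_W C.zero_W Hu[of 0] L.p_zero C.p_zero K_fixes[OF lK] by (simp_all add: Y_def)
  then have z: "0 \<in> Z" using C.x_image by (simp add: Z_def)
  have ZY: "u \<in> Y" if "u \<in> Z" for u using that by (simp add: Z_def)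
  have "smooth_on (d + n) Z n (\<phi> \<circ> H)"
    unfolding Z_def by (rule C.smooth_coordinates[OF H])
  then have s: "smooth_on (d + n) Z n F"
  proof (rule smooth_on_cong[OF Z])
    show "(\<phi> \<circ> H) u = F u" if "u \<in> Z" for u
      using Hu[OF ZY[OF that]] by (simp add: F)
  qed
  have l: "left_part d u \<in> WL" if "u \<in> Z" for u using ZY[OF that] by (simp add: Y_def)
  have r: "right_part d u \<in> W" if "u \<in> Z" for u using ZY[OF that] by (simp add: Y_def)
  have h: "A (pL (left_part d u)) (p (right_part d u)) \<in> p ` W" if "u \<in> Z" for u
    using that Hu[OF ZY[OF that]] by (simp add: Z_def)
  show ?thesis
    by (intro exI[of _ Z] conjI ballI Z z s l r h)
qed

lemma linear_join_left: "linear (\<lambda>\<xi>. join d \<xi> 0)" and linear_join_right: "linear (\<lambda>y. join d 0 y)"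
  by (rule linearI; metis join_add join_scaleR add_0 scaleR_zero_right)+

lemma joint_jacobian_right:
  assumes L: "centred_chart \<G> l d WL pL \<phi>L"
    and Z: "openin (Euclidean_space (d + n)) Z" "0 \<in> Z"
    and F: "F = (\<lambda>u. \<phi> (A (pL (left_part d u)) (p (right_part d u)))) \<and> smooth_on (d + n) Z n F"
    and y: "y \<in> Rn n"
  shows "jacobian (d + n) F (join d 0 y) = D l y"
proof -
  interpret L: centred_chart \<G> l d WL pL \<phi>L by fact
  note lin = linear_join_right[of d]
  have sm: "smooth_on n (Rn n) (d + n) (\<lambda>y. join d 0 y)"
    by (rule smooth_on_linear[OF linear_linear_on[OF lin] _ openin_Rn]) (auto intro: join_Rn)
  define T where "T = {y \<in> Rn n. join d 0 y \<in> Z}"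
  have T: "openin (Euclidean_space n) T" unfolding T_def by (rule openin_smooth_preimage[OF openin_Rn sm Z(1)])
  have j0: "join d 0 0 = 0" using linear_0[OF lin] .
  have t: "0 \<in> T" using Z(2) j0 by (simp add: T_def)
  have "jacobian n (F \<circ> join d 0) y = jacobian (d + n) F (jacobian n (join d 0) y)"
  proof (rule jacobian_comp[OF T smooth_on_subset[OF sm] _ Z(1) conjunct2[OF F] t j0])
    show "T \<subseteq> Rn n" unfolding T_def by (rule Collect_restrict)
    show "join d 0 ` T \<subseteq> Z" by (rule image_subsetI) (simp only: T_def mem_Collect_eq)
  qed
  also have "jacobian n (join d 0) y = join d 0 y"
    by (rule jacobian_linear[OF linear_linear_on[OF lin] openin_Rn _ y]) simp
  also have "F \<circ> join d 0 = \<phi> \<circ> A l \<circ> p"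
    by (simp add: conjunct1[OF F] fun_eq_iff left_part_join right_part_join L.p_zero)
  finally show ?thesis unfolding D_def by (rule sym)
qed

lemma joint_jacobian_left:
  assumes Z: "openin (Euclidean_space (d + n)) Z" "0 \<in> Z"
    and F: "F = (\<lambda>u. \<phi> (A (pL (left_part d u)) (p (right_part d u)))) \<and> smooth_on (d + n) Z n F"
    and \<xi>: "\<xi> \<in> Rn d"
  shows "jacobian (d + n) F (join d \<xi> 0) = jacobian d (\<phi> \<circ> (\<lambda>g. A g x\<^sub>0) \<circ> pL) \<xi>"
proof -
  note lin = linear_join_left[of d]
  have sm: "smooth_on d (Rn d) (d + n) (\<lambda>\<xi>. join d \<xi> 0)"
    by (rule smooth_on_linear[OF linear_linear_on[OF lin] _ openin_Rn]) (auto intro: join_Rn)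
  define T where "T = {\<xi> \<in> Rn d. join d \<xi> 0 \<in> Z}"
  have T: "openin (Euclidean_space d) T" unfolding T_def by (rule openin_smooth_preimage[OF openin_Rn sm Z(1)])
  have j0: "join d 0 0 = 0" using linear_0[OF lin] .
  have t: "0 \<in> T" using Z(2) j0 by (simp add: T_def)
  have "jacobian d (F \<circ> (\<lambda>\<xi>. join d \<xi> 0)) \<xi> = jacobian (d + n) F (jacobian d (\<lambda>\<xi>. join d \<xi> 0) \<xi>)"
  proof (rule jacobian_comp[OF T smooth_on_subset[OF sm] _ Z(1) conjunct2[OF F] t j0])
    show "T \<subseteq> Rn d" unfolding T_def by (rule Collect_restrict)
    show "(\<lambda>\<xi>. join d \<xi> 0) ` T \<subseteq> Z" by (rule image_subsetI) (simp only: T_def mem_Collect_eq)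
  qed
  also have "jacobian d (\<lambda>\<xi>. join d \<xi> 0) \<xi> = join d \<xi> 0"
    by (rule jacobian_linear[OF linear_linear_on[OF lin] openin_Rn _ \<xi>]) simp
  also have "jacobian d (F \<circ> (\<lambda>\<xi>. join d \<xi> 0)) \<xi> = jacobian d (\<phi> \<circ> (\<lambda>g. A g x\<^sub>0) \<circ> pL) \<xi>"
  proof (rule jacobian_cong[OF openin_Rn zero_in_Rn])
    fix \<xi> assume "\<xi> \<in> Rn d"
    then show "(F \<circ> (\<lambda>\<xi>. join d \<xi> 0)) \<xi> = (\<phi> \<circ> (\<lambda>g. A g x\<^sub>0) \<circ> pL) \<xi>"
      by (simp only: o_apply conjunct1[OF F] left_part_join right_part_join C.p_zero)
  qed
  finally show ?thesis by (rule sym)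
qed

section \<open>Uniform first-order estimates over the stabilizer\<close>

lemma chart_at: "l \<in> carrier G \<Longrightarrow> \<exists>d WL pL \<phi>L. centred_chart \<G> l d WL pL \<phi>L"
proof -
  assume "l \<in> carrier G"
  then obtain d U \<psi> where "(d, U, \<psi>) \<in> atlas \<G>" "l \<in> U"
    using chartedD(3)[OF is_manifold_charted[OF group_manifold]] group_carrier by blast
  from centred_chart_exists[OF group_manifold atlas_smooth_chart[OF group_manifold this(1)] this(2)]
  show ?thesis by metis
qed

text \<open>The joint map is strictly differentiable at the origin. Comparing the points with
  coordinates (g, 0) and (g, y) cancels the group direction: the increment is
  \<open>join d 0 y\<close>, on which the derivative is \<open>D l y\<close>, and the value at (g,
  0) is 0 because \<open>g\<close> fixes \<open>x\<^sub>0\<close>. So one cube serves all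
  \<open>g\<close> in \<open>K\<close> near \<open>l\<close>.\<close>

lemma translate_estimate_local:
  assumes lK: "l \<in> K" and e: "e > 0"
  shows "\<exists>N \<delta>. openin (mtop \<G>) N \<and> l \<in> N \<and> \<delta> > 0 \<and> (\<forall>g\<in>N \<inter> K. \<forall>y\<in>cube n 0 \<delta>.
    norm1 n (\<phi> (A g (p y)) - D l y) \<le> e * norm1 n y)"
proof -
  obtain d WL pL \<phi>L where L: "centred_chart \<G> l d WL pL \<phi>L"
    using chart_at[OF K_carrier[OF lK]] by metis
  interpret L: centred_chart \<G> l d WL pL \<phi>L by fact
  define F where "F = (\<lambda>u. \<phi> (A (pL (left_part d u)) (p (right_part d u))))"
  obtain Z where Z: "openin (Euclidean_space (d + n)) Z" "0 \<in> Z" "smooth_on (d + n) Z n F"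
    using joint_coordinates[OF L lK F_def] by blast
  obtain r where r: "r > 0" "cube (d + n) 0 r \<subseteq> Z"
    "\<And>a b. a \<in> cube (d + n) 0 r \<Longrightarrow> b \<in> cube (d + n) 0 r \<Longrightarrow>
      norm1 n (F b - F a - jacobian (d + n) F (b - a)) \<le> e * norm1 (d + n) (b - a)"
    using strict_jacobian[OF Z(1-3) e] by metis
  define N where "N = {g \<in> pL ` WL. \<phi>L g \<in> cube d 0 r}"
  have N: "openin (mtop \<G>) N"
  proof -
    have "openin (subtopology (mtop \<G>) (pL ` WL)) {g \<in> topspace (subtopology (mtop \<G>) (pL ` WL)). \<phi>L g \<in> cube d 0 r}"
      by (rule openin_continuous_map_preimage[OF L.continuous_coordinates openin_cube])
    moreover have "{g \<in> topspace (subtopology (mtop \<G>) (pL ` WL)). \<phi>L g \<in> cube d 0 r} = N"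
      using openin_subset[OF L.open_image] by (auto simp: N_def)
    ultimately show ?thesis using openin_trans_full[OF _ L.open_image] by metis
  qed
  have lN: "l \<in> N" using L.x_image L.phi_x r(1) by (simp add: N_def centre_in_cube)
  have joinc: "join d \<xi> y \<in> cube (d + n) 0 r" if "\<xi> \<in> cube d 0 r" "y \<in> cube n 0 r" for \<xi> y
    using that by (auto simp: cube_def join_Rn) (auto simp: join_def)
  have jac: "jacobian (d + n) F (join d 0 y) = D l y" if "y \<in> Rn n" for y
    by (rule joint_jacobian_right[OF L Z(1,2) _ that, where F = F]) (use Z(3) F_def in auto)
  have "norm1 n (\<phi> (A g (p y)) - D l y) \<le> e * norm1 n y" if g: "g \<in> N \<inter> K" and y: "y \<in> cube n 0 r" for g y
  proof -
    have \<xi>: "\<phi>L g \<in> cube d 0 r" and pg: "pL (\<phi>L g) = g"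
      using g L.inverse'(2) by (auto simp: N_def)
    have \<xi>R: "\<phi>L g \<in> Rn d" using \<xi> cube_subset_Rn by blast
    have yR: "y \<in> Rn n" using y cube_subset_Rn by blast
    have c0: "0 \<in> cube n 0 r" using r(1) by (simp add: centre_in_cube)
    have F1: "F (join d (\<phi>L g) y') = \<phi> (A g (p y'))" for y'
      by (simp only: F_def left_part_join[OF \<xi>R] right_part_join pg)
    have F0: "F (join d (\<phi>L g) 0) = 0"
      unfolding F1 C.p_zero using K_fixes[of g] g C.phi_x by simp
    have "norm1 n (F (join d (\<phi>L g) y) - F (join d (\<phi>L g) 0) - jacobian (d + n) F (join d (\<phi>L g) y - join d (\<phi>L g) 0))
      \<le> e * norm1 (d + n) (join d (\<phi>L g) y - join d (\<phi>L g) 0)"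
      by (rule r(3)[OF joinc[OF \<xi> c0] joinc[OF \<xi> y]])
    then show ?thesis
      unfolding F0 unfolding join_diff F1 diff_0_right jac[OF yR] norm1_join_zero .
  qed
  then show ?thesis using N lN r(1) by blast
qed

definition invariant_functional :: "((nat \<Rightarrow> real) \<Rightarrow> real) \<Rightarrow> bool"
  where "invariant_functional f \<longleftrightarrow> linear f \<and> (\<forall>g\<in>K. \<forall>w\<in>Rn k. f (D g w) = f w)"

text \<open>For \<open>g\<close> near \<open>l\<close> the value is close to
  \<open>f (D l y)\<close>, which equals \<open>f y\<close> by invariance. The reference element
  \<open>l\<close> thus disappears from the bound, and finitely many neighbourhoods covering
  \<open>K\<close> give a common cube. Membership in R^n is assumed because \<open>\<phi>\<close> is
  arbitrary outside the chart.\<close>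

lemma invariant_functional_estimate:
  assumes f: "invariant_functional f" and e: "e > 0"
  obtains \<delta> where "\<delta> > 0" "\<And>g y. g \<in> K \<Longrightarrow> y \<in> cube n 0 \<delta> \<Longrightarrow> y \<in> Rn k \<Longrightarrow>
    \<phi> (A g (p y)) \<in> Rn n \<Longrightarrow> \<bar>f (\<phi> (A g (p y))) - f y\<bar> \<le> e * norm1 n y"
proof -
  have lf: "linear f" using f by (simp add: invariant_functional_def)
  obtain C where C: "C > 0" "\<And>w. w \<in> Rn n \<Longrightarrow> \<bar>f w\<bar> \<le> C * norm1 n w"
    using functional_bound[OF lf] by metis
  have eC: "e / C > 0" using e C by simp
  define good where "good N \<longleftrightarrow> openin (mtop \<G>) N \<and> (\<exists>\<delta>>0. \<forall>g\<in>N \<inter> K. \<forall>y\<in>cube n 0 \<delta>. y \<in> Rn k \<longrightarrow>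
    \<phi> (A g (p y)) \<in> Rn n \<longrightarrow> \<bar>f (\<phi> (A g (p y))) - f y\<bar> \<le> e * norm1 n y)" for N
  have loc: "\<exists>N. good N \<and> l \<in> N" if l: "l \<in> K" for l
  proof -
    obtain N \<delta> where N: "openin (mtop \<G>) N" "l \<in> N" "\<delta> > 0"
      "\<And>g y. g \<in> N \<inter> K \<Longrightarrow> y \<in> cube n 0 \<delta> \<Longrightarrow> norm1 n (\<phi> (A g (p y)) - D l y) \<le> e / C * norm1 n y"
      using translate_estimate_local[OF l eC] by metis
    have "\<bar>f (\<phi> (A g (p y))) - f y\<bar> \<le> e * norm1 n y"
      if g: "g \<in> N \<inter> K" and y: "y \<in> cube n 0 \<delta>" "y \<in> Rn k" and R: "\<phi> (A g (p y)) \<in> Rn n" for g y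
    proof -
      have "f (\<phi> (A g (p y))) - f y = f (\<phi> (A g (p y)) - D l y)"
        using f l y(2) by (simp only: linear_diff[OF lf] invariant_functional_def)
      also have "\<bar>\<dots>\<bar> \<le> C * norm1 n (\<phi> (A g (p y)) - D l y)"
        by (rule C(2)[OF Rn_diff[OF R D_Rn[OF l]]])
      also have "\<dots> \<le> C * (e / C * norm1 n y)"
        using N(4)[OF g y(1)] C(1) by (intro mult_left_mono) auto
      also have "\<dots> = e * norm1 n y" using C(1) by simp
      finally show ?thesis .
    qed
    then show ?thesis using N unfolding good_def by blast
  qed
  have "K \<subseteq> \<Union>{N. good N}" using loc by blast
  moreover have "openin (mtop \<G>) N" if "N \<in> {N. good N}" for N
    using that by (simp add: good_def)
  ultimately have "\<exists>\<F>. finite \<F> \<and> \<F> \<subseteq> {N. good N} \<and> K \<subseteq> \<Union>\<F>"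
    using compactinD[OF compact_K, of "{N. good N}"] by simp
  then obtain \<F> where \<F>: "finite \<F>" "\<And>N. N \<in> \<F> \<Longrightarrow> good N" "K \<subseteq> \<Union>\<F>" by blast
  have "\<forall>N\<in>\<F>. \<exists>\<delta>. \<delta> > 0 \<and> (\<forall>g\<in>N \<inter> K. \<forall>y\<in>cube n 0 \<delta>. y \<in> Rn k \<longrightarrow>
    \<phi> (A g (p y)) \<in> Rn n \<longrightarrow> \<bar>f (\<phi> (A g (p y))) - f y\<bar> \<le> e * norm1 n y)"
    using \<F>(2) unfolding good_def by blast
  then obtain \<Delta> where \<Delta>: "\<And>N. N \<in> \<F> \<Longrightarrow> \<Delta> N > 0"
    "\<And>N g y. N \<in> \<F> \<Longrightarrow> g \<in> N \<inter> K \<Longrightarrow> y \<in> cube n 0 (\<Delta> N) \<Longrightarrow> y \<in> Rn k \<Longrightarrow>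
      \<phi> (A g (p y)) \<in> Rn n \<Longrightarrow> \<bar>f (\<phi> (A g (p y))) - f y\<bar> \<le> e * norm1 n y"
    by (metis (no_types, lifting))
  define \<delta> where "\<delta> = Min (insert 1 (\<Delta> ` \<F>))"
  have \<delta>: "\<delta> > 0" "\<And>N. N \<in> \<F> \<Longrightarrow> \<delta> \<le> \<Delta> N"
    using \<Delta>(1) \<F>(1) by (auto simp: \<delta>_def)
  show ?thesis
  proof (rule that[OF \<delta>(1)])
    fix g y assume g: "g \<in> K" and y: "y \<in> cube n 0 \<delta>" "y \<in> Rn k" "\<phi> (A g (p y)) \<in> Rn n"
    obtain N where N: "N \<in> \<F>" "g \<in> N" using g \<F>(3) by blast
    show "\<bar>f (\<phi> (A g (p y))) - f y\<bar> \<le> e * norm1 n y"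
      by (rule \<Delta>(2)[OF N(1) _ _ y(2,3)]) (use N g y(1) cube_mono[OF \<delta>(2)[OF N(1)], of n 0] in auto)
  qed
qed

section \<open>The orbit direction and the splitting of the tangent space\<close>

definition d_orbit :: "(nat \<Rightarrow> real) \<Rightarrow> nat \<Rightarrow> real"
  where "d_orbit = jacobian m (\<phi> \<circ> (\<lambda>g. A g x\<^sub>0) \<circ> pG)"

definition orbit_domain :: "(nat \<Rightarrow> real) set"
  where "orbit_domain = {z \<in> WG. A (pG z) x\<^sub>0 \<in> p ` W}"

lemma germ_orbit: "germ m orbit_domain n W (\<phi> \<circ> (\<lambda>g. A g x\<^sub>0) \<circ> pG)"
  unfolding germ_def
proof (intro conjI)
  note q = plot_orbit[OF C.x_carrier B.plot_p]
  have eq: "orbit_domain = {z \<in> WG. restrict ((\<lambda>g. A g x\<^sub>0) \<circ> pG) WG z \<in> p ` W}"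
    by (auto simp: orbit_domain_def)
  show o: "openin (Euclidean_space m) orbit_domain"
    unfolding eq by (rule C.open_preimage[OF q])
  show "0 \<in> orbit_domain"
    using B.zero_W B.p_zero C.x_image A_one[OF C.x_carrier] by (simp add: orbit_domain_def)
  show "smooth_on m orbit_domain n (\<phi> \<circ> (\<lambda>g. A g x\<^sub>0) \<circ> pG)"
    by (rule smooth_on_cong[OF o, of n "\<phi> \<circ> restrict ((\<lambda>g. A g x\<^sub>0) \<circ> pG) WG"])
      (use C.smooth_coordinates[OF q] in \<open>auto simp: eq\<close>)
  show "(\<phi> \<circ> (\<lambda>g. A g x\<^sub>0) \<circ> pG) ` orbit_domain \<subseteq> W"
    using C.inverse'(1) by (auto simp: orbit_domain_def)
  show "(\<phi> \<circ> (\<lambda>g. A g x\<^sub>0) \<circ> pG) 0 = 0"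
    by (simp add: B.p_zero A_one[OF C.x_carrier] C.phi_x)
qed

lemma linear_d_orbit: "linear d_orbit"
  unfolding d_orbit_def by (rule linear_jacobian)

lemma d_orbit_Rn: "d_orbit \<xi> \<in> Rn n"
  unfolding d_orbit_def by (rule germ_jacobian_Rn[OF germ_orbit])

lemma orbit_tangent: "orbit_tangent_space G \<G> M A x\<^sub>0 = J ` d_orbit ` Rn m"
proof -
  have "differential \<G> M (\<lambda>g. A g x\<^sub>0) \<one>\<^bsub>G\<^esub> (B.tangent_vector \<xi>) = J (d_orbit \<xi>)" if "\<xi> \<in> Rn m" for \<xi>
    unfolding d_orbit_def
    by (rule differential_tangent_vector[OF B.centred_chart_axioms C.centred_chart_axioms group_manifold
          plot_orbit[OF C.x_carrier] A_one[OF C.x_carrier] that])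
  then show ?thesis
    unfolding orbit_tangent_space_def B.tangent_space_full image_image by (intro image_cong) auto
qed

text \<open>Directness of the sum in the slice condition, transported by the injective map
  \<open>J\<close>.\<close>

lemma orbit_slice_zero:
  assumes "\<xi> \<in> Rn m" "d_orbit \<xi> \<in> Rn k"
  shows "d_orbit \<xi> = 0"
proof -
  have "orbit_tangent_space G \<G> M A x\<^sub>0 \<inter> V = {0}"
    using slice by (simp add: slice_def)
  then have "J (d_orbit \<xi>) = 0"
    using assms unfolding orbit_tangent V_eq by blast
  also have "0 = J 0" using linear_0[OF C.linear_tangent_vector] by simp
  finally show ?thesis using J_inj[OF d_orbit_Rn zero_in_Rn] by blast
qed

lemma orbit_slice_decompose:
  assumes w: "w \<in> Rn n"
  shows "\<exists>\<xi>\<in>Rn m. \<exists>y\<in>Rn k. w = d_orbit \<xi> + y"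
proof -
  have x0S: "x\<^sub>0 \<in> S" using slice by (simp add: slice_def)
  have "tangent_space M (mcarrier M) x\<^sub>0 = {a + b | a b. a \<in> orbit_tangent_space G \<G> M A x\<^sub>0 \<and> b \<in> V}"
    using slice x0S unfolding slice_def by blast
  moreover have "J w \<in> tangent_space M (mcarrier M) x\<^sub>0"
    unfolding C.tangent_space_full using w by blast
  ultimately obtain \<xi> y where y: "\<xi> \<in> Rn m" "y \<in> Rn k" "J w = J (d_orbit \<xi>) + J y"
    unfolding orbit_tangent V_eq by blast
  then have "w = d_orbit \<xi> + y"
    using J_inj[OF w Rn_add[OF d_orbit_Rn Rk_Rn[OF y(2)]]] by (simp only: J_add)
  then show ?thesis using y by blast
qed

text \<open>Decompositions of the unit vectors are chosen and extended linearly. \<open>L1\<close>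
  is a choice, since \<open>d_orbit\<close> kills the Lie algebra of the stabilizer, whereas
  \<open>L2\<close> is the projection along the orbit direction; directness of the sum forces it to
  fix R^k.\<close>

lemma linear_splitting:
  obtains L1 L2 where "linear L1" "linear L2" "\<And>w. w \<in> Rn n \<Longrightarrow> L1 w \<in> Rn m" "\<And>w. w \<in> Rn n \<Longrightarrow> L2 w \<in> Rn k"
    "\<And>w. w \<in> Rn n \<Longrightarrow> d_orbit (L1 w) + L2 w = w" "\<And>w. w \<in> Rn k \<Longrightarrow> L2 w = w"
proof -
  have "\<forall>i. \<exists>\<xi> y. i < n \<longrightarrow> \<xi> \<in> Rn m \<and> y \<in> Rn k \<and> unit_vec i = d_orbit \<xi> + y"
    using orbit_slice_decompose[OF unit_vec_Rn] by blast
  then obtain X Y where XY: "\<And>i. i < n \<Longrightarrow> X i \<in> Rn m" "\<And>i. i < n \<Longrightarrow> Y i \<in> Rn k"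
    "\<And>i. i < n \<Longrightarrow> unit_vec i = d_orbit (X i) + Y i" by metis
  define L1 where "L1 w = (\<Sum>i<n. w i *\<^sub>R X i)" for w
  define L2 where "L2 w = (\<Sum>i<n. w i *\<^sub>R Y i)" for w
  have lin: "linear (\<lambda>w. \<Sum>i<n. w i *\<^sub>R (X i :: nat \<Rightarrow> real))" for X :: "nat \<Rightarrow> nat \<Rightarrow> real"
    by (rule linearI) (simp_all add: scaleR_add_left sum.distrib scaleR_sum_right scaleR_fun_apply)
  have l1: "linear L1" and l2: "linear L2" unfolding L1_def[abs_def] L2_def[abs_def] by (rule lin)+
  have R1: "L1 w \<in> Rn m" and R2: "L2 w \<in> Rn k" for w
    unfolding L1_def L2_def using XY by (auto intro!: Rn_sum Rn_scaleR)
  have split: "d_orbit (L1 w) + L2 w = w" if "w \<in> Rn n" for w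
  proof -
    have "d_orbit (L1 w) + L2 w = (\<Sum>i<n. w i *\<^sub>R (d_orbit (X i) + Y i))"
      by (simp add: L1_def L2_def linear_sum[OF linear_d_orbit] linear_scale[OF linear_d_orbit] scaleR_add_right sum.distrib)
    also have "\<dots> = (\<Sum>i<n. w i *\<^sub>R unit_vec i)" using XY(3) by simp
    also have "\<dots> = w" using Rn_decompose[OF that] by simp
    finally show ?thesis .
  qed
  have "L2 w = w" if w: "w \<in> Rn k" for w
  proof -
    have "d_orbit (L1 w) = w - L2 w" using split[OF Rk_Rn[OF w]] by (metis add_diff_cancel_right')
    then have "d_orbit (L1 w) \<in> Rn k"
      using Rn_diff[OF w R2[of w]] by (simp only:)
    then have "d_orbit (L1 w) = 0"
      by (rule orbit_slice_zero[OF R1])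
    then show ?thesis using split[OF Rk_Rn[OF w]] by simp
  qed
  from that[OF l1 l2 R1 R2 split this] show ?thesis .
qed


text \<open>As there are no quotient types at hand, the quotient of \<open>\<real>\<^sup>k\<close> by the span of all \<open>D g w - w\<close> is
  realized as the image of \<open>\<real>\<^sup>k\<close> in the space of functions on its annihilator.\<close>

definition coinvariants :: "(nat \<Rightarrow> real) \<Rightarrow> ((nat \<Rightarrow> real) \<Rightarrow> real) \<Rightarrow> real"
  where "coinvariants w = (\<lambda>f. if invariant_functional f then f w else 0)"

lemma linear_coinvariants: "linear coinvariants"
proof (rule linearI)
  show "coinvariants (u + w) = coinvariants u + coinvariants w" for u w
  proof
    fix f show "coinvariants (u + w) f = (coinvariants u + coinvariants w) f"
    proof (cases "invariant_functional f")
      case True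
      then have "linear f" by (simp add: invariant_functional_def)
      from linear_add[OF this, of u w] True show ?thesis
        by (simp only: coinvariants_def plus_fun_apply if_True)
    next
      case False
      then show ?thesis
        by (simp only: coinvariants_def plus_fun_apply if_False add_0_right)
    qed
  qed
  show "coinvariants (c *\<^sub>R w) = c *\<^sub>R coinvariants w" for c w
  proof
    fix f show "coinvariants (c *\<^sub>R w) f = (c *\<^sub>R coinvariants w) f"
    proof (cases "invariant_functional f")
      case True
      then have "linear f" by (simp add: invariant_functional_def)
      from linear_scale[OF this, of c w] True show ?thesis
        by (simp only: coinvariants_def scaleR_fun_apply if_True)
    next
      case False
      then show ?thesis
        by (simp only: coinvariants_def scaleR_fun_apply if_False scaleR_zero_right)
    qed
  qed
qed

text \<open>Otherwise some functional vanishes on the span and is 1 at \<open>y\<close>. Vanishing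
  on all \<open>D g w - w\<close> is invariance, so \<open>coinvariants y\<close> would take the
  value 1 at this functional.\<close>

lemma coinvariants_kernel:
  assumes y: "y \<in> Rn k" "coinvariants y = 0"
  shows "y \<in> span {D g w - w | g w. g \<in> K \<and> w \<in> Rn k}"
proof (rule ccontr)
  assume "\<not> ?thesis"
  then show False
  proof (rule linear_functional_separation)
    fix f :: "(nat \<Rightarrow> real) \<Rightarrow> real"
    assume f: "linear f" "\<And>x. x \<in> {D g w - w | g w. g \<in> K \<and> w \<in> Rn k} \<Longrightarrow> f x = 0" "f y = 1"
    have "f (D g w) = f w" if "g \<in> K" "w \<in> Rn k" for g w
    proof -
      have "f (D g w - w) = 0" using that by (intro f(2)) blast
      then show ?thesis by (simp add: linear_diff[OF f(1)])
    qed
    then have "invariant_functional f" using f(1) by (simp add: invariant_functional_def)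
    then have "coinvariants y f = 1" using f(3) by (simp add: coinvariants_def)
    then show False using y(2) by simp
  qed
qed

text \<open>In a chart of the group around \<open>l\<close> the entry is a partial derivative of the
  smooth joint map in a direction of the point variable, evaluated at (g, 0); partial derivatives of
  smooth maps are continuous.\<close>

lemma D_continuous:
  assumes i: "i < n"
  shows "continuous_map (subtopology (mtop \<G>) K) euclideanreal (\<lambda>g. D g (unit_vec i) j)"
proof (cases "j < n")
  case False
  then have "0 = D g (unit_vec i) j" if "g \<in> K" for g
    using D_Rn[OF that] by (simp add: topspace_Euclidean_space)
  then show ?thesis
    using continuous_map_eq[of "subtopology (mtop \<G>) K" euclideanreal "\<lambda>g. 0" "\<lambda>g. D g (unit_vec i) j"] by simp
next
  case True
  show ?thesis
  proof (rule continuous_map_locally)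
    fix l assume "l \<in> topspace (subtopology (mtop \<G>) K)"
    then have lK: "l \<in> K" by simp
    obtain d WL pL \<phi>L where L: "centred_chart \<G> l d WL pL \<phi>L"
      using chart_at[OF K_carrier[OF lK]] by metis
    interpret L: centred_chart \<G> l d WL pL \<phi>L by fact
    define F where "F = (\<lambda>u. \<phi> (A (pL (left_part d u)) (p (right_part d u))))"
    obtain Z where Z: "openin (Euclidean_space (d + n)) Z" "0 \<in> Z" "smooth_on (d + n) Z n F"
      using joint_coordinates[OF L lK F_def] by blast
    define h where "h g = join d (\<phi>L g) 0" for g
    have hcont: "continuous_map (subtopology (mtop \<G>) (pL ` WL)) (Euclidean_space (d + n)) h"
    proof -
      have sm: "smooth_on d (Rn d) (d + n) (\<lambda>\<xi>. join d \<xi> 0)"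
        by (rule smooth_on_linear[OF linear_linear_on[OF linear_join_left] _ openin_Rn]) (auto intro: join_Rn)
      have "continuous_map (Euclidean_space d) (Euclidean_space (d + n)) (\<lambda>\<xi>. join d \<xi> 0)"
        using continuous_on_smooth_on[OF sm] smooth_on_in_Rn[OF sm]
        by (auto simp: continuous_map_Euclidean_space continuous_map_Euclidean_space_iff)
      from continuous_map_compose[OF L.continuous_coordinates this] show ?thesis
        by (simp add: h_def[abs_def] comp_def)
    qed
    define N where "N = {g \<in> pL ` WL. h g \<in> Z}"
    have N: "openin (mtop \<G>) N"
    proof -
      have "openin (subtopology (mtop \<G>) (pL ` WL)) {g \<in> topspace (subtopology (mtop \<G>) (pL ` WL)). h g \<in> Z}"
        by (rule openin_continuous_map_preimage[OF hcont Z(1)])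
      moreover have "{g \<in> topspace (subtopology (mtop \<G>) (pL ` WL)). h g \<in> Z} = N"
        using openin_subset[OF L.open_image] by (auto simp: N_def)
      ultimately show ?thesis using openin_trans_full[OF _ L.open_image] by metis
    qed
    have j0: "join d 0 0 = 0" using linear_0[OF linear_join_left] .
    have lN: "l \<in> N" unfolding N_def h_def mem_Collect_eq L.phi_x j0 using L.x_image Z(2) by blast
    \<comment> \<open>The first \<open>d\<close> indices belong to the group, so
      \<open>d + i\<close> is the index of the \<open>i\<close>-th coordinate of the point.\<close>
    define P where "P = partial (d + i) (\<lambda>u. F u j)"
    have Pc: "continuous_on Z P"
      unfolding P_def using i
      by (intro smooth_fun_continuous[OF smooth_fun_partial[OF smooth_on_component[OF Z(3) True]]]) simp
    have eq: "(P \<circ> h) g = D g (unit_vec i) j" if g: "g \<in> N" for g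
    proof -
      have \<xi>: "\<phi>L g \<in> Rn d" "pL (\<phi>L g) = g"
        using g L.inverse' L.W_Rn by (auto simp: N_def)
      have upd: "(join d (\<phi>L g) 0)(d + i := t) = join d (\<phi>L g) (0(i := t))" for t
        by (auto simp: join_def fun_eq_iff)
      have "F (join d (\<phi>L g) y) j = (\<phi> \<circ> A g \<circ> p) y j" for y
        by (simp only: F_def left_part_join[OF \<xi>(1)] right_part_join \<xi>(2) o_apply)
      moreover have "(join d (\<phi>L g) 0) (d + i) = (0::nat \<Rightarrow> real) i" by (simp add: join_def)
      ultimately have "P (h g) = partial i (\<lambda>y. (\<phi> \<circ> A g \<circ> p) y j) 0"
        unfolding P_def h_def partial_def upd by simp
      also have "\<dots> = (\<Sum>i'<n. if i' = i then partial i (\<lambda>y. (\<phi> \<circ> A g \<circ> p) y j) 0 else 0)"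
        using i by simp
      also have "\<dots> = D g (unit_vec i) j"
        unfolding D_def jacobian_def by (intro sum.cong) (auto simp: unit_vec_def)
      finally show ?thesis by simp
    qed
    have "continuous_map (subtopology (mtop \<G>) N) (top_of_set Z) h"
      using continuous_map_from_subtopology_mono[OF hcont, of N]
      by (auto simp: N_def continuous_map_Euclidean_space continuous_map_in_subtopology)
    from continuous_map_compose[OF this, of euclideanreal P] Pc
    have "continuous_map (subtopology (mtop \<G>) N) euclideanreal (P \<circ> h)" by simp
    then have "continuous_map (subtopology (mtop \<G>) N) euclideanreal (\<lambda>g. D g (unit_vec i) j)"
      by (rule continuous_map_eq) (use eq in auto)
    then have "continuous_map (subtopology (subtopology (mtop \<G>) K) (K \<inter> N)) euclideanreal (\<lambda>g. D g (unit_vec i) j)"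
      unfolding subtopology_subtopology by (rule continuous_map_from_subtopology_mono) auto
    moreover have "openin (subtopology (mtop \<G>) K) (K \<inter> N)"
      by (rule openin_subtopology_Int2[OF N])
    ultimately show "\<exists>N. openin (subtopology (mtop \<G>) K) N \<and> l \<in> N \<and>
        continuous_map (subtopology (subtopology (mtop \<G>) K) N) euclideanreal (\<lambda>g. D g (unit_vec i) j)"
      using lK lN by blast
  qed
qed

text \<open>The left inverse reads only the component \<open>v c\<close> and is a finite linear
  combination of its entries, hence continuous for the product topology.\<close>

lemma J_coordinates:
  obtains J' where "\<And>w. w \<in> Rn n \<Longrightarrow> J' (J w) = w" "continuous_on V J'"
proof -
  obtain c d f where c: "\<And>w. w \<in> Rn n \<Longrightarrow> jacobian d f (J w c) = w"
    using C.tangent_vector_left_inverse[OF manifold] by metis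
  have "continuous_on V (\<lambda>v. jacobian d f (v c))"
  proof (rule continuous_on_coordinatewise_then_product)
    fix j
    show "continuous_on V (\<lambda>v. jacobian d f (v c) j)"
      unfolding jacobian_def
      by (intro continuous_on_sum continuous_on_mult continuous_on_const
          continuous_on_subset[OF continuous_on_product_then_coordinatewise[OF continuous_on_product_coordinates]]) auto
  qed
  from that[of "\<lambda>v. jacobian d f (v c)", OF c this] show ?thesis .
qed

text \<open>In coordinates \<open>\<rho> g v\<close> is a finite sum of products of coordinates of
  \<open>v\<close>, matrix entries of \<open>D g\<close> and constants.\<close>

lemma \<rho>_continuous:
  "continuous_map (prod_topology (subtopology (mtop \<G>) K) (top_of_set V)) (top_of_set V) (\<lambda>(g, v). \<rho> g v)"
proof -
  obtain J' where J': "\<And>w. w \<in> Rn n \<Longrightarrow> J' (J w) = w" "continuous_on V J'"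
    using J_coordinates by metis
  define X where "X = prod_topology (subtopology (mtop \<G>) K) (top_of_set V)"
  have X: "topspace X = K \<times> V"
    using compactin_subset_topspace[OF compact_K] by (auto simp: X_def)
  have c1: "continuous_map X euclideanreal (\<lambda>z. J' (snd z) i)" for i
  proof -
    have "continuous_map (top_of_set V) euclideanreal (\<lambda>v. J' v i)"
      using continuous_on_product_then_coordinatewise[OF J'(2)] by simp
    from continuous_map_compose[OF continuous_map_snd this, of "subtopology (mtop \<G>) K"] show ?thesis
      by (simp add: X_def comp_def)
  qed
  have c2: "continuous_map X euclideanreal (\<lambda>z. D (fst z) (unit_vec i) j)" if "i < n" for i j
    using continuous_map_compose[OF continuous_map_fst D_continuous[OF that, of j], of "top_of_set V"]
    by (simp add: X_def comp_def)
  have "continuous_map X euclideanreal (\<lambda>z. (\<lambda>(g, v). \<rho> g v) z c q)" for c q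
  proof (rule continuous_map_eq)
    show "continuous_map X euclideanreal
        (\<lambda>z. \<Sum>i<n. J' (snd z) i * (\<Sum>j<n. D (fst z) (unit_vec i) j * J (unit_vec j) c q))"
      by (intro continuous_map_sum continuous_map_real_mult c1 c2 continuous_map_const[THEN iffD2]) auto
    fix z assume "z \<in> topspace X"
    then obtain g v where z: "z = (g, v)" "g \<in> K" "v \<in> V" using X by auto
    obtain w where w: "w \<in> Rn k" "v = J w" using z(3) V_cases by metis
    note wn = Rk_Rn[OF w(1)]
    have "\<rho> g v = J (\<Sum>i<n. w i *\<^sub>R D g (unit_vec i))"
      using \<rho>_J[OF z(2) w(1)] linear_on_Rn_expand[OF linear_linear_on[OF linear_D] wn, of g] w(2) by simp
    also have "\<dots> = (\<Sum>i<n. w i *\<^sub>R J (D g (unit_vec i)))"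
      by (simp add: linear_sum[OF C.linear_tangent_vector] J_scaleR)
    also have "\<dots> = (\<Sum>i<n. w i *\<^sub>R (\<Sum>j<n. D g (unit_vec i) j *\<^sub>R J (unit_vec j)))"
      using linear_on_Rn_expand[OF linear_linear_on[OF C.linear_tangent_vector] D_Rn[OF z(2)]] by simp
    finally show "(\<Sum>i<n. J' (snd z) i * (\<Sum>j<n. D (fst z) (unit_vec i) j * J (unit_vec j) c q)) = (\<lambda>(g, v). \<rho> g v) z c q"
      using w(2) J'(1)[OF wn] z(1) by (simp add: sum_fun_apply scaleR_fun_apply)
  qed
  then have "continuous_map X euclidean (\<lambda>(g, v). \<rho> g v)"
    unfolding euclidean_product_topology[symmetric] continuous_map_componentwise_UNIV by blast
  then show ?thesis
    using \<rho>_V X by (auto simp: continuous_map_in_subtopology X_def)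
qed

lemma \<rho>_compact_linear: "compact_linear_action (stabilizer_group G A x\<^sub>0) (mtop \<G>) V \<rho>"
  using compact_K subspace_V \<rho>_group_action \<rho>_linear \<rho>_continuous
  by (simp add: compact_linear_action_def stabilizer_group_def)

text \<open>\<open>K\<close> acts linearly here, so an invariant functional takes exactly the same
  value at two points of one orbit, and derivatives agree without any estimate. For the kernel,
  \<open>D g\<close> and the identity are germs on R^k that agree in the quotient.\<close>

lemma covering_plot_slice:
  obtains W' p' where "covering_plot (quotient_diffeology (standard_diffeology (vector_manifold V))
    (orbit_rel (stabilizer_group G A x\<^sub>0) V \<rho>)) (orbit (stabilizer_group G A x\<^sub>0) \<rho> 0) k W' p' coinvariants"
proof -
  define r where "r = orbit_rel (stabilizer_group G A x\<^sub>0) V \<rho>"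
  obtain J' where J': "\<And>w. w \<in> Rn n \<Longrightarrow> J' (J w) = w" "continuous_on V J'"
    using J_coordinates by metis
  define p' where "p' = restrict J (Rn k)"
  have "centred_chart (vector_manifold V) 0 k (Rn k) p' J'"
    unfolding p'_def using J' Rk_Rn V_eq
    by (intro centred_chart_vector_manifold[OF linear_linear_on[OF C.linear_tangent_vector]]) auto
  then interpret Q: centred_chart "vector_manifold V" 0 k "Rn k" p' J' .
  have car: "mcarrier (vector_manifold V) = V" by (simp add: vector_manifold_def)
  have J0: "J 0 = 0" by (rule linear_0[OF C.linear_tangent_vector])
  have zV: "0 \<in> V" using subspace_0[OF subspace_V] .
  have \<rho>0: "\<rho> g 0 = 0" if "g \<in> K" for g
    using \<rho>_J[OF that, of 0] J0 linear_0[OF linear_D[of g]] by simp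
  have r: "equiv V r"
    unfolding r_def by (rule equiv_orbit_rel[OF \<rho>_group_action])
  have rI: "(v, \<rho> g v) \<in> r" if "v \<in> V" "g \<in> K" for v g
    using that by (auto simp: r_def orbit_rel_def orbit_def stabilizer_group_def)
  have rD: "\<exists>g\<in>K. w = D g u" if uw: "(p' u, p' w) \<in> r" "u \<in> Rn k" "w \<in> Rn k" for u w
  proof -
    obtain g where g: "g \<in> K" "J w = \<rho> g (J u)"
      using uw by (auto simp: r_def orbit_rel_def orbit_def stabilizer_group_def p'_def)
    then have "J w = J (D g u)" using \<rho>_J uw(2) by simp
    then show ?thesis using J_inj Rk_Rn uw(3) D_Rn g(1) by blast
  qed
  have "covering_plot (quotient_diffeology (standard_diffeology (vector_manifold V)) r) (r `` {0}) k (Rn k)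
    (restrict (\<lambda>w. r `` {p' w}) (Rn k)) coinvariants"
  proof (rule Q.covering_plot_quotient)
    show "equiv (mcarrier (vector_manifold V)) r" unfolding car by (rule r)
    show "\<exists>q'. (d, Z, q') \<in> standard_diffeology (vector_manifold V) \<and> q' 0 = 0 \<and> (\<forall>z\<in>Z. (q' z, q z) \<in> r)"
      if q: "(d, Z, q) \<in> standard_diffeology (vector_manifold V)" "0 \<in> Z" "(q 0, 0) \<in> r" for d Z q
    \<comment> \<open>The origin is fixed by \<open>K\<close>, so a plot starting in its orbit
      already starts at the origin and needs no change.\<close>
    proof (intro exI conjI ballI)
      show "(d, Z, q) \<in> standard_diffeology (vector_manifold V)" by (rule q)
      have "(0, q 0) \<in> r" using r q(3) by (meson equivE symE)
      then show "q 0 = 0" using \<rho>0 by (auto simp: r_def orbit_rel_def orbit_def stabilizer_group_def)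
      fix z assume "z \<in> Z"
      then have "q z \<in> V" using standard_diffeologyD(2)[OF q(1)] car by auto
      then show "(q z, q z) \<in> r" using r by (meson equivE refl_onD)
    qed
    show "linear_on (Rn k) coinvariants" by (rule linear_linear_on[OF linear_coinvariants])
    show "coinvariants (jacobian d g v) = coinvariants (jacobian d h v)"
      if g: "germ d Z k (Rn k) g" and h: "germ d Z k (Rn k) h" and v: "v \<in> Rn d"
        and gh: "\<And>z. z \<in> Z \<Longrightarrow> (p' (g z), p' (h z)) \<in> r" for d Z g h v
    proof
      fix f
      have "f (jacobian d g v) = f (jacobian d h v)" if f: "invariant_functional f"
      proof -
        have lf: "linear f" using f by (simp add: invariant_functional_def)
        have ev: "\<forall>\<^sub>F t in nhds 0. f (g (t *\<^sub>R v)) = f (h (t *\<^sub>R v))"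
        proof (rule eventually_mono[OF germ_line_eventually[OF g v]])
          fix t assume t: "t *\<^sub>R v \<in> Z"
          then have R: "g (t *\<^sub>R v) \<in> Rn k" "h (t *\<^sub>R v) \<in> Rn k" using g h by (auto simp: germ_def)
          obtain l where "l \<in> K" "h (t *\<^sub>R v) = D l (g (t *\<^sub>R v))" using rD[OF gh[OF t] R] by blast
          then show "f (g (t *\<^sub>R v)) = f (h (t *\<^sub>R v))"
            using f R(1) by (simp add: invariant_functional_def)
        qed
        from iffD1[OF DERIV_cong_ev[OF refl ev refl] functional_derivative[OF lf g v]]
        show ?thesis by (rule DERIV_unique[OF _ functional_derivative[OF lf h v]])
      qed
      then show "coinvariants (jacobian d g v) f = coinvariants (jacobian d h v) f"
        by (simp add: coinvariants_def)
    qed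
    show "y \<in> span (germ_pair_differences (\<lambda>a b. (p' a, p' b) \<in> r) k (Rn k))"
      if y: "y \<in> Rn k" "coinvariants y = 0" for y
    proof (rule subsetD[OF span_mono coinvariants_kernel[OF y]], rule subsetI)
      fix u assume "u \<in> {D g w - w | g w. g \<in> K \<and> w \<in> Rn k}"
      then obtain g w where gw: "g \<in> K" "w \<in> Rn k" "u = D g w - w" by blast
      have lin: "linear_on (Rn k) (D g)" by (rule linear_linear_on[OF linear_D])
      have "germ k (Rn k) k (Rn k) (D g)"
        using smooth_on_linear[OF lin _ openin_Rn] D_slice[OF gw(1)] linear_0[OF linear_D[of g]]
        by (auto simp: germ_def)
      moreover have "germ k (Rn k) k (Rn k) (\<lambda>w. w)"
        using smooth_on_id[OF openin_Rn] by (auto simp: germ_def)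
      moreover have "u = jacobian k (D g) w - jacobian k (\<lambda>w. w) w"
        using gw(3) jacobian_linear[OF lin openin_Rn zero_in_Rn gw(2)] jacobian_id[OF gw(2)] by simp
      moreover have "(p' (D g z), p' z) \<in> r" if z: "z \<in> Rn k" for z
      proof -
        have "(J z, J (D g z)) \<in> r"
          using rI[of "J z" g] z gw(1) \<rho>_J by (simp add: V_eq)
        then have "(J (D g z), J z) \<in> r" using r by (meson equivE symE)
        then show ?thesis using z D_slice[OF gw(1)] by (simp add: p'_def)
      qed
      ultimately show "u \<in> germ_pair_differences (\<lambda>a b. (p' a, p' b) \<in> r) k (Rn k)"
        unfolding germ_pair_differences_def using gw(2) by blast
    qed
  qed
  then show ?thesis
    using that unfolding r_def orbit_rel_Image[OF zV] by blast
qed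

end

section \<open>Tube coordinates around the orbit and the orbit space of \<open>M\<close>\<close>

locale slice_splitting = slice_chart +
  fixes L1 L2 :: "(nat \<Rightarrow> real) \<Rightarrow> nat \<Rightarrow> real"
  assumes L1: "linear L1" and L2: "linear L2"
    and L1_Rn: "\<And>w. w \<in> Rn n \<Longrightarrow> L1 w \<in> Rn m" and L2_Rk: "\<And>w. w \<in> Rn n \<Longrightarrow> L2 w \<in> Rn k"
    and L_split: "\<And>w. w \<in> Rn n \<Longrightarrow> d_orbit (L1 w) + L2 w = w" and L2_id: "\<And>w. w \<in> Rn k \<Longrightarrow> L2 w = w"
begin

lemma one_K: "\<one>\<^bsub>G\<^esub> \<in> K"
  by (rule subgroup.one_closed[OF K_subgroup])

text \<open>Let \<open>\<Theta> w\<close> be the translate of \<open>p (L2 w)\<close> by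
  \<open>pG (L1 w)\<close>, read in the chart. Its derivative at 0 is
  \<open>d_orbit (L1 w) + L2 w = w\<close>, so \<open>\<Theta>\<close> is the identity plus a map
  with small Lipschitz constant. Picard iteration then solves \<open>\<Theta> w = y\<close>, with
  \<open>y - w\<close> small compared to \<open>w\<close>; nothing is claimed on how
  \<open>w\<close> depends on \<open>y\<close>.\<close>

lemma tube_coordinates:
  assumes e: "e > 0"
  shows "\<exists>\<delta>>0. \<forall>y\<in>cube n 0 \<delta>. \<exists>w\<in>Rn n. norm1 n w \<le> 2 * norm1 n y \<and> norm1 n (y - w) \<le> e * norm1 n w \<and>
    L1 w \<in> WG \<and> L2 w \<in> W \<and> p y = A (pG (L1 w)) (p (L2 w))"
proof -
  define F where "F = (\<lambda>u. \<phi> (A (pG (left_part m u)) (p (right_part m u))))"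
  obtain Z where Z: "openin (Euclidean_space (m + n)) Z" "0 \<in> Z" "smooth_on (m + n) Z n F"
    and Zu: "\<And>u. u \<in> Z \<Longrightarrow> left_part m u \<in> WG \<and> right_part m u \<in> W \<and> A (pG (left_part m u)) (p (right_part m u)) \<in> p ` W"
    using joint_coordinates[OF B.centred_chart_axioms one_K F_def] by blast
  define \<Phi> where "\<Phi> w = join m (L1 w) (L2 w)" for w
  have lin: "linear \<Phi>"
    unfolding \<Phi>_def[abs_def]
    by (rule linearI) (simp_all only: linear_add[OF L1] linear_add[OF L2] linear_scale[OF L1] linear_scale[OF L2] join_add join_scaleR)
  have \<Phi>R: "\<Phi> w \<in> Rn (m + n)" if "w \<in> Rn n" for w
    unfolding \<Phi>_def using join_Rn L1_Rn L2_Rk Rk_Rn that by blast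
  have sm: "smooth_on n (Rn n) (m + n) \<Phi>"
    by (rule smooth_on_linear[OF linear_linear_on[OF lin] _ openin_Rn]) (use \<Phi>R in auto)
  define T where "T = {w \<in> Rn n. \<Phi> w \<in> Z}"
  have T: "openin (Euclidean_space n) T" unfolding T_def by (rule openin_smooth_preimage[OF openin_Rn sm Z(1)])
  have \<Phi>0: "\<Phi> 0 = 0" by (rule linear_0[OF lin])
  have t: "0 \<in> T" using Z(2) \<Phi>0 by (simp add: T_def)
  have TR: "T \<subseteq> Rn n" unfolding T_def by (rule Collect_restrict)
  have TZ: "\<Phi> ` T \<subseteq> Z" by (rule image_subsetI) (simp only: T_def mem_Collect_eq)
  define \<Theta> where "\<Theta> = F \<circ> \<Phi>"
  have \<Theta>: "smooth_on n T n \<Theta>"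
    unfolding \<Theta>_def by (rule smooth_on_comp[OF T Z(1) smooth_on_subset[OF sm TR] TZ Z(3)])
  have F': "F = (\<lambda>u. \<phi> (A (pG (left_part m u)) (p (right_part m u)))) \<and> smooth_on (m + n) Z n F"
    using F_def Z(3) by blast
  have jac: "jacobian n \<Theta> w = w" if w: "w \<in> Rn n" for w
  proof -
    have "jacobian n \<Theta> w = jacobian (m + n) F (jacobian n \<Phi> w)"
      unfolding \<Theta>_def by (rule jacobian_comp[OF T smooth_on_subset[OF sm TR] TZ Z(1) Z(3) t \<Phi>0])
    also have "jacobian n \<Phi> w = \<Phi> w"
      by (rule jacobian_linear[OF linear_linear_on[OF lin] openin_Rn zero_in_Rn w])
    also have "\<Phi> w = join m (L1 w) 0 + join m 0 (L2 w)"
      unfolding \<Phi>_def join_add[symmetric] by simp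
    also have "jacobian (m + n) F \<dots> = d_orbit (L1 w) + D \<one>\<^bsub>G\<^esub> (L2 w)"
      unfolding jacobian_add joint_jacobian_left[OF Z(1,2) F' L1_Rn[OF w]]
        joint_jacobian_right[OF B.centred_chart_axioms Z(1,2) F' Rk_Rn[OF L2_Rk[OF w]]] d_orbit_def ..
    also have "\<dots> = w" using L_split[OF w] D_one[OF Rk_Rn[OF L2_Rk[OF w]]] by simp
    finally show ?thesis .
  qed
  \<comment> \<open>The bound 1/2 gives the contraction; the bound \<open>e\<close> gives the
    estimate of \<open>y - w\<close>, which is the perturbation \<open>E w\<close>.\<close>
  define e' where "e' = min e (1/2)"
  have e': "e' > 0" "e' \<le> e" "e' \<le> 1/2" using e by (auto simp: e'_def)
  obtain r where r: "r > 0" "cube n 0 r \<subseteq> T"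
    "\<And>a b. a \<in> cube n 0 r \<Longrightarrow> b \<in> cube n 0 r \<Longrightarrow> norm1 n (\<Theta> b - \<Theta> a - jacobian n \<Theta> (b - a)) \<le> e' * norm1 n (b - a)"
    using strict_jacobian[OF T t \<Theta> e'(1)] by metis
  define E where "E w = \<Theta> w - w" for w
  have cR: "w \<in> Rn n" if "w \<in> cube n 0 r" for w using that cube_subset_Rn by blast
  have Eab: "norm1 n (E b - E a) \<le> e' * norm1 n (b - a)" if ab: "a \<in> cube n 0 r" "b \<in> cube n 0 r" for a b
  proof -
    have "E b - E a = \<Theta> b - \<Theta> a - jacobian n \<Theta> (b - a)"
      unfolding jac[OF Rn_diff[OF cR[OF ab(2)] cR[OF ab(1)]]] E_def by (simp add: algebra_simps)
    then show ?thesis using r(3)[OF ab] by (simp only:)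
  qed
  have \<Theta>0: "\<Theta> 0 = 0"
    using linear_0[OF linear_left_part] linear_0[OF linear_right_part]
    by (simp only: \<Theta>_def o_apply \<Phi>0 F_def B.p_zero C.p_zero A_one[OF C.x_carrier] C.phi_x)
  then have E0: "E 0 = 0" unfolding E_def \<Theta>0 by simp
  have c0: "0 \<in> cube n 0 r" using r(1) by (simp add: centre_in_cube)
  obtain \<delta>0 where \<delta>0: "\<delta>0 > 0" "cube n 0 \<delta>0 \<subseteq> W"
    using cube_in_open[OF C.open_W C.zero_W] .
  \<comment> \<open>On the cube \<open>norm1 n y\<close> is at most \<open>n * \<delta>\<close>, so
    twice the norm is at most \<open>r * (n / (n + 1))\<close>, which is strictly less than
    \<open>r\<close>.\<close>
  define \<delta> where "\<delta> = min \<delta>0 (r / (2 * (real n + 1)))"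
  have \<delta>: "\<delta> > 0" using \<delta>0 r(1) by (simp add: \<delta>_def)
  have "\<exists>w\<in>Rn n. norm1 n w \<le> 2 * norm1 n y \<and> norm1 n (y - w) \<le> e * norm1 n w \<and>
    L1 w \<in> WG \<and> L2 w \<in> W \<and> p y = A (pG (L1 w)) (p (L2 w))" if y: "y \<in> cube n 0 \<delta>" for y
  proof -
    have yR: "y \<in> Rn n" using y cube_subset_Rn by blast
    have yW: "y \<in> W" using y \<delta>0(2) cube_mono[of \<delta> \<delta>0 n 0] by (auto simp: \<delta>_def)
    have "norm1 n y \<le> real n * \<delta>" by (rule cube_norm1[OF y])
    also have "\<dots> \<le> real n * (r / (2 * (real n + 1)))"
      by (rule mult_left_mono) (simp_all add: \<delta>_def)
    finally have "2 * norm1 n y \<le> r * (real n / (real n + 1))" by (simp add: field_simps)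
    also have "\<dots> < r * 1" using r(1) by (intro mult_strict_left_mono) auto
    finally have y2: "2 * norm1 n y < r" by simp
    have "\<exists>w\<in>cube n 0 r. w + E w = y \<and> norm1 n w \<le> 2 * norm1 n y"
    proof (rule small_perturbation_surjective[where E = E, OF _ E0 r(1) _ yR y2])
      show "E w \<in> Rn n" if "w \<in> cube n 0 r" for w
        unfolding E_def using Rn_diff smooth_on_in_Rn[OF \<Theta>] r(2) cR that by blast
      show "norm1 n (E b - E a) \<le> norm1 n (b - a) / 2" if ab: "a \<in> cube n 0 r" "b \<in> cube n 0 r" for a b
        using Eab[OF ab] mult_right_mono[OF e'(3) norm1_nonneg[of n "b - a"]] by simp
    qed
    then obtain w where w: "w \<in> cube n 0 r" "w + E w = y" "norm1 n w \<le> 2 * norm1 n y" by blast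
    have wZ: "\<Phi> w \<in> Z" using w(1) r(2) by (auto simp: T_def)
    note R = L1_Rn[OF cR[OF w(1)]]
    have parts: "left_part m (\<Phi> w) = L1 w" "right_part m (\<Phi> w) = L2 w"
      unfolding \<Phi>_def left_part_join[OF R] right_part_join by (rule refl)+
    have "\<Theta> w = y" using w(2) by (simp add: E_def)
    then have "\<phi> (A (pG (L1 w)) (p (L2 w))) = y"
      by (simp only: \<Theta>_def o_apply F_def parts)
    moreover have "A (pG (L1 w)) (p (L2 w)) \<in> p ` W" "L1 w \<in> WG" "L2 w \<in> W"
      using Zu[OF wZ] unfolding parts by blast+
    ultimately have "p y = A (pG (L1 w)) (p (L2 w))" using C.inverse'(2) by metis
    moreover have "norm1 n (y - w) \<le> e * norm1 n w"
    proof -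
      have "y - w = E w" using w(2) by (metis add_diff_cancel_left')
      then have "norm1 n (y - w) \<le> e' * norm1 n w"
        using Eab[OF c0 w(1)] unfolding E0 diff_0_right by simp
      also have "\<dots> \<le> e * norm1 n w" by (rule mult_right_mono[OF e'(2) norm1_nonneg])
      finally show ?thesis .
    qed
    ultimately show ?thesis
      using w(3) cR[OF w(1)] \<open>L1 w \<in> WG\<close> \<open>L2 w \<in> W\<close> by blast
  qed
  then show ?thesis using \<delta> by blast
qed

text \<open>Write \<open>p y1\<close> and \<open>p y2\<close> as translates of slice points
  \<open>p z1\<close> and \<open>p z2\<close>. The group element carrying \<open>p z1\<close> to
  \<open>p z2\<close> lies in \<open>K\<close> by the slice property, so \<open>f z1\<close> and
  \<open>f z2\<close> differ by little, uniformly in that element. Each \<open>f (L2 y)\<close> is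
  close to the matching \<open>f z\<close>, because \<open>y\<close> is close to its tube coordinate
  \<open>w\<close> and \<open>L2 w = z\<close>.\<close>

lemma orbit_estimate:
  assumes f: "invariant_functional f" and e: "e > 0"
  shows "\<exists>\<delta>>0. \<forall>y1\<in>cube n 0 \<delta>. \<forall>y2\<in>cube n 0 \<delta>. (p y1, p y2) \<in> orbit_rel G (mcarrier M) A \<longrightarrow>
    \<bar>f (L2 y1) - f (L2 y2)\<bar> \<le> e * (norm1 n y1 + norm1 n y2)"
proof -
  have lf: "linear f" using f by (simp add: invariant_functional_def)
  define \<mu> where "\<mu> = f \<circ> L2"
  have l\<mu>: "linear \<mu>" unfolding \<mu>_def by (rule linear_compose[OF L2 lf])
  obtain C\<mu> where C\<mu>: "C\<mu> > 0" "\<And>w. w \<in> Rn n \<Longrightarrow> \<bar>\<mu> w\<bar> \<le> C\<mu> * norm1 n w"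
    using functional_bound[OF l\<mu>] by metis
  obtain C2 where C2: "C2 > 0" "\<And>w. w \<in> Rn n \<Longrightarrow> norm1 n (L2 w) \<le> C2 * norm1 n w"
    using linear_norm1_bound[OF L2] by metis
  \<comment> \<open>As \<open>norm1 n w\<close> is at most \<open>2 * norm1 n y\<close>, and
    \<open>norm1 n z1\<close> at most \<open>2 * C2 * norm1 n y1\<close>, these accuracies
    contribute \<open>e / 2\<close> for each passage from \<open>y\<close> to \<open>w\<close> and
    \<open>e / 2\<close> for the passage from \<open>z1\<close> to \<open>z2\<close>.\<close>
  have e1: "e / (4 * C\<mu>) > 0" and e2: "e / (4 * C2) > 0" using e C\<mu>(1) C2(1) by simp_all
  obtain \<delta>1 where \<delta>1: "\<delta>1 > 0" "\<And>y. y \<in> cube n 0 \<delta>1 \<Longrightarrow> \<exists>w\<in>Rn n. norm1 n w \<le> 2 * norm1 n y \<and>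
    norm1 n (y - w) \<le> e / (4 * C\<mu>) * norm1 n w \<and> L1 w \<in> WG \<and> L2 w \<in> W \<and> p y = A (pG (L1 w)) (p (L2 w))"
    using tube_coordinates[OF e1] by blast
  obtain \<delta>2 where \<delta>2: "\<delta>2 > 0" "\<And>g y. g \<in> K \<Longrightarrow> y \<in> cube n 0 \<delta>2 \<Longrightarrow> y \<in> Rn k \<Longrightarrow>
    \<phi> (A g (p y)) \<in> Rn n \<Longrightarrow> \<bar>f (\<phi> (A g (p y))) - f y\<bar> \<le> e / (4 * C2) * norm1 n y"
    using invariant_functional_estimate[OF f e2] by metis
  \<comment> \<open>The second entry ensures \<open>norm1 n z1 < \<delta>2\<close>, since passing to
    tube coordinates and applying \<open>L2\<close> costs at most the factor \<open>2 * C2\<close>,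
    and the cube bound on \<open>y1\<close> costs the factor \<open>n\<close>; with
    \<open>n + 1\<close> the inequality is strict.\<close>
  define \<delta> where "\<delta> = min \<delta>1 (\<delta>2 / (2 * C2 * (real n + 1)))"
  have \<delta>: "\<delta> > 0" using \<delta>1(1) \<delta>2(1) C2(1) by (simp add: \<delta>_def)
  have "\<bar>f (L2 y1) - f (L2 y2)\<bar> \<le> e * (norm1 n y1 + norm1 n y2)"
    if y: "y1 \<in> cube n 0 \<delta>" "y2 \<in> cube n 0 \<delta>" and orb: "(p y1, p y2) \<in> orbit_rel G (mcarrier M) A" for y1 y2
  proof -
    have c1: "cube n 0 \<delta> \<subseteq> cube n 0 \<delta>1" by (rule cube_mono) (simp add: \<delta>_def)
    obtain w1 where w1: "w1 \<in> Rn n" "norm1 n w1 \<le> 2 * norm1 n y1" "norm1 n (y1 - w1) \<le> e / (4 * C\<mu>) * norm1 n w1"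
      "L1 w1 \<in> WG" "L2 w1 \<in> W" "p y1 = A (pG (L1 w1)) (p (L2 w1))"
      using \<delta>1(2) y(1) c1 by blast
    obtain w2 where w2: "w2 \<in> Rn n" "norm1 n w2 \<le> 2 * norm1 n y2" "norm1 n (y2 - w2) \<le> e / (4 * C\<mu>) * norm1 n w2"
      "L1 w2 \<in> WG" "L2 w2 \<in> W" "p y2 = A (pG (L1 w2)) (p (L2 w2))"
      using \<delta>1(2) y(2) c1 by blast
    have yR: "y1 \<in> Rn n" "y2 \<in> Rn n" using y cube_subset_Rn by blast+
    have near: "\<bar>\<mu> y - \<mu> w\<bar> \<le> e / 2 * norm1 n y"
      if "y \<in> Rn n" "w \<in> Rn n" "norm1 n w \<le> 2 * norm1 n y" "norm1 n (y - w) \<le> e / (4 * C\<mu>) * norm1 n w" for y w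
    proof -
      have "\<bar>\<mu> y - \<mu> w\<bar> = \<bar>\<mu> (y - w)\<bar>" by (simp only: linear_diff[OF l\<mu>])
      also have "\<dots> \<le> C\<mu> * norm1 n (y - w)" by (rule C\<mu>(2)[OF Rn_diff[OF that(1,2)]])
      also have "\<dots> \<le> C\<mu> * (e / (4 * C\<mu>) * norm1 n w)"
        using that(4) C\<mu>(1) by (intro mult_left_mono) auto
      also have "\<dots> = e / 4 * norm1 n w" using C\<mu>(1) by simp
      also have "\<dots> \<le> e / 4 * (2 * norm1 n y)" using that(3) e by (intro mult_left_mono) auto
      finally show ?thesis by simp
    qed
    define z1 z2 where "z1 = L2 w1" and "z2 = L2 w2"
    have zk: "z1 \<in> Rn k" "z2 \<in> Rn k" unfolding z1_def z2_def using L2_Rk w1(1) w2(1) by blast+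
    have zW: "z1 \<in> W" "z2 \<in> W" unfolding z1_def z2_def using w1 w2 by blast+
    have zS: "p z1 \<in> S" "p z2 \<in> S" using S_iff zW zk by blast+
    have zM: "p z1 \<in> mcarrier M" "p z2 \<in> mcarrier M" using C.p_carrier zW by blast+
    define h1 h2 where "h1 = pG (L1 w1)" and "h2 = pG (L1 w2)"
    have h: "h1 \<in> carrier G" "h2 \<in> carrier G"
      unfolding h1_def h2_def using B.p_carrier w1(4) w2(4) group_carrier by blast+
    obtain g where g: "g \<in> carrier G" "p y2 = A g (p y1)" using orb orbit_rel_iff by blast
    \<comment> \<open>\<open>h1\<close> and \<open>h2\<close> carry the slice points to
      \<open>p y1\<close> and \<open>p y2\<close>, and \<open>g\<close> carries \<open>p y1\<close>
      to \<open>p y2\<close>.\<close>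
    define l where "l = inv\<^bsub>G\<^esub> h2 \<otimes>\<^bsub>G\<^esub> (g \<otimes>\<^bsub>G\<^esub> h1)"
    have lG: "l \<in> carrier G" using h g by (simp add: l_def)
    have "A h2 (p z2) = A g (A h1 (p z1))"
      using g(2) w1(6) w2(6) by (simp only: h1_def h2_def z1_def z2_def)
    also have "\<dots> = A (g \<otimes>\<^bsub>G\<^esub> h1) (p z1)" using composition_rule[OF zM(1) g(1) h(1)] by simp
    finally have "A (inv\<^bsub>G\<^esub> h2) (A (g \<otimes>\<^bsub>G\<^esub> h1) (p z1)) = p z2"
      by (rule orbit_sym_aux[OF h(2) zM(2)])
    moreover have "A l (p z1) = A (inv\<^bsub>G\<^esub> h2) (A (g \<otimes>\<^bsub>G\<^esub> h1) (p z1))"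
      unfolding l_def by (rule composition_rule) (use zM h g in auto)
    ultimately have lz: "A l (p z1) = p z2" by simp
    then have lK: "l \<in> K" using S_stabilizer[OF lG zS(1)] zS(2) by simp
    have \<phi>z: "\<phi> (A l (p z1)) = z2" unfolding lz by (rule C.inverse[OF zW(2)])
    have z1n: "norm1 n z1 \<le> 2 * C2 * norm1 n y1"
    proof -
      have "norm1 n z1 \<le> C2 * norm1 n w1" unfolding z1_def by (rule C2(2)[OF w1(1)])
      also have "\<dots> \<le> C2 * (2 * norm1 n y1)" using w1(2) C2(1) by (intro mult_left_mono) auto
      finally show ?thesis by simp
    qed
    have "norm1 n y1 \<le> real n * \<delta>" by (rule cube_norm1[OF y(1)])
    also have "\<dots> \<le> real n * (\<delta>2 / (2 * C2 * (real n + 1)))"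
      by (rule mult_left_mono) (simp_all add: \<delta>_def)
    finally have "2 * C2 * norm1 n y1 \<le> 2 * C2 * (real n * (\<delta>2 / (2 * C2 * (real n + 1))))"
      using C2(1) by (intro mult_left_mono) auto
    also have "\<dots> = (2 * C2) * (real n * \<delta>2) / ((2 * C2) * (real n + 1))"
      by (simp only: times_divide_eq_right)
    also have "\<dots> = real n * \<delta>2 / (real n + 1)"
      by (rule mult_divide_mult_cancel_left) (use C2(1) in simp)
    also have "\<dots> = \<delta>2 * (real n / (real n + 1))" by simp
    also have "\<dots> < \<delta>2 * 1" using \<delta>2(1) by (intro mult_strict_left_mono) auto
    finally have "norm1 n z1 < \<delta>2" using z1n by simp
    then have z1c: "z1 \<in> cube n 0 \<delta>2" by (rule norm1_less_cube[OF Rk_Rn[OF zk(1)]])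
    have "\<bar>f z2 - f z1\<bar> \<le> e / (4 * C2) * norm1 n z1"
      using \<delta>2(2)[OF lK z1c zk(1)] Rk_Rn[OF zk(2)] unfolding \<phi>z by simp
    also have "\<dots> \<le> e / (4 * C2) * (2 * C2 * norm1 n y1)"
      using z1n e2 by (intro mult_left_mono) auto
    also have "\<dots> = e / 2 * norm1 n y1" using C2(1) by simp
    finally have "\<bar>\<mu> w2 - \<mu> w1\<bar> \<le> e / 2 * norm1 n y1"
      by (simp add: \<mu>_def z1_def z2_def)
    moreover have "e / 2 * norm1 n y2 \<le> e * norm1 n y2"
      using e norm1_nonneg[of n y2] by (intro mult_right_mono) auto
    moreover have "e * (norm1 n y1 + norm1 n y2) = e / 2 * norm1 n y1 + e / 2 * norm1 n y1 + e * norm1 n y2"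
      by (simp add: algebra_simps)
    ultimately have "\<bar>\<mu> y1 - \<mu> y2\<bar> \<le> e * (norm1 n y1 + norm1 n y2)"
      using near[OF yR(1) w1(1-3)] near[OF yR(2) w2(1-3)] by linarith
    then show ?thesis by (simp add: \<mu>_def)
  qed
  then show ?thesis using \<delta> by blast
qed

text \<open>The difference \<open>q\<close> of the two values has derivative \<open>\<Delta>\<close>
  at 0. Both germs are of order \<open>t\<close> along the line, so \<open>orbit_estimate\<close>
  bounds the quotient \<open>q t / t\<close> by \<open>e\<close> times a quantity tending to
  \<open>B\<close>, and this for every \<open>e\<close>.\<close>

lemma orbit_germs_derivative:
  assumes f: "invariant_functional f" and g: "germ d Z n W g" and h: "germ d Z n W h" and v: "v \<in> Rn d"
    and gh: "\<And>z. z \<in> Z \<Longrightarrow> (p (g z), p (h z)) \<in> orbit_rel G (mcarrier M) A"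
  shows "f (L2 (jacobian d g v)) = f (L2 (jacobian d h v))"
proof -
  have lf: "linear f" using f by (simp add: invariant_functional_def)
  have l\<mu>: "linear (f \<circ> L2)" by (rule linear_compose[OF L2 lf])
  define \<Delta> where "\<Delta> = f (L2 (jacobian d g v)) - f (L2 (jacobian d h v))"
  define q where "q t = f (L2 (g (t *\<^sub>R v))) - f (L2 (h (t *\<^sub>R v)))" for t
  have g0: "g 0 = 0" and h0: "h 0 = 0" using g h by (auto simp: germ_def)
  have "(q has_real_derivative \<Delta>) (at 0)"
    unfolding q_def[abs_def] \<Delta>_def
    using DERIV_diff[OF functional_derivative[OF l\<mu> g v] functional_derivative[OF l\<mu> h v]] by simp
  moreover have "q 0 = 0" by (simp add: q_def g0 h0)
  ultimately have qlim: "((\<lambda>t. q t / t) \<longlongrightarrow> \<Delta>) (at 0)"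
    by (simp add: has_field_derivative_iff)
  have nlim: "((\<lambda>t. norm1 n (u (t *\<^sub>R v)) / \<bar>t\<bar>) \<longlongrightarrow> norm1 n (jacobian d u v)) (at 0)"
    if u: "germ d Z n W u" for u
  proof -
    have u0: "u 0 = 0" using u by (simp add: germ_def)
    have "((\<lambda>t. u (t *\<^sub>R v) i / t) \<longlongrightarrow> jacobian d u v i) (at 0)" for i
      using germ_line_derivative[OF u v, of i] by (simp add: has_field_derivative_iff u0)
    then have "((\<lambda>t. \<Sum>i<n. \<bar>u (t *\<^sub>R v) i / t\<bar>) \<longlongrightarrow> (\<Sum>i<n. \<bar>jacobian d u v i\<bar>)) (at 0)"
      by (intro tendsto_sum tendsto_rabs)
    then show ?thesis by (simp add: norm1_def sum_divide_distrib)
  qed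
  define B where "B = norm1 n (jacobian d g v) + norm1 n (jacobian d h v)"
  have bound: "\<bar>\<Delta>\<bar> \<le> e * B" if e: "e > 0" for e
  proof -
    obtain \<delta> where \<delta>: "\<delta> > 0" "\<And>y1 y2. y1 \<in> cube n 0 \<delta> \<Longrightarrow> y2 \<in> cube n 0 \<delta> \<Longrightarrow>
      (p y1, p y2) \<in> orbit_rel G (mcarrier M) A \<Longrightarrow> \<bar>f (L2 y1) - f (L2 y2)\<bar> \<le> e * (norm1 n y1 + norm1 n y2)"
      using orbit_estimate[OF f e] by blast
    have small: "\<forall>\<^sub>F t in at 0. u (t *\<^sub>R v) \<in> cube n 0 \<delta>" if u: "germ d Z n W u" for u
    proof (rule eventually_in_open[OF openin_cube])
      show "0 \<in> cube n 0 \<delta>" using \<delta>(1) by (simp add: centre_in_cube)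
      have "\<forall>\<^sub>F t in at 0. t *\<^sub>R v \<in> Z"
        using germ_line_eventually[OF u v] by (simp add: eventually_nhds_conv_at)
      then show "\<forall>\<^sub>F t in at 0. u (t *\<^sub>R v) \<in> Rn n"
        by (rule eventually_mono) (use u smooth_on_in_Rn in \<open>auto simp: germ_def\<close>)
      have u0: "u 0 = 0" using u by (simp add: germ_def)
      show "((\<lambda>t. u (t *\<^sub>R v) i) \<longlongrightarrow> 0 i) (at 0)" for i
        using DERIV_isCont[OF germ_line_derivative[OF u v, of i]] u0 by (simp add: isCont_def)
    qed
    have "\<forall>\<^sub>F t in at 0. t *\<^sub>R v \<in> Z"
      using germ_line_eventually[OF g v] by (simp add: eventually_nhds_conv_at)
    then have ev: "\<forall>\<^sub>F t in at 0. \<bar>q t / t\<bar> \<le> e * (norm1 n (g (t *\<^sub>R v)) / \<bar>t\<bar> + norm1 n (h (t *\<^sub>R v)) / \<bar>t\<bar>)"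
      using small[OF g] small[OF h]
    proof eventually_elim
      case (elim t)
      have "\<bar>q t\<bar> \<le> e * (norm1 n (g (t *\<^sub>R v)) + norm1 n (h (t *\<^sub>R v)))"
        unfolding q_def by (rule \<delta>(2)[OF elim(2,3) gh[OF elim(1)]])
      from divide_right_mono[OF this, of "\<bar>t\<bar>"] show ?case
        by (simp add: add_divide_distrib distrib_left)
    qed
    have lim: "((\<lambda>t. e * (norm1 n (g (t *\<^sub>R v)) / \<bar>t\<bar> + norm1 n (h (t *\<^sub>R v)) / \<bar>t\<bar>)) \<longlongrightarrow> e * B) (at 0)"
      unfolding B_def by (intro tendsto_mult tendsto_const tendsto_add nlim g h)
    show ?thesis
      by (rule tendsto_le[OF at_neq_bot lim tendsto_rabs[OF qlim] ev])
  qed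
  have B0: "0 \<le> B" by (simp add: B_def norm1_nonneg)
  have "\<bar>\<Delta>\<bar> \<le> 0 + e" if "e > 0" for e
  proof -
    \<comment> \<open>The denominator is \<open>B + 1\<close> because \<open>B\<close> may be
      0.\<close>
    have "\<bar>\<Delta>\<bar> \<le> e / (B + 1) * B" using bound[of "e / (B + 1)"] that B0 by simp
    also have "\<dots> \<le> e" using that B0 by (simp add: field_simps)
    finally show ?thesis by simp
  qed
  then have "\<bar>\<Delta>\<bar> \<le> 0" by (rule field_le_epsilon)
  then show ?thesis by (simp add: \<Delta>_def)
qed

text \<open>Two kinds of pairs of germs exhaust the kernel: the orbit map against the constant germ
  0 gives \<open>d_orbit (L1 w)\<close>, and translation by an element of \<open>K\<close> against
  the identity gives the generators whose span contains \<open>L2 w\<close>.\<close>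

lemma covering_plot_orbit_space:
  obtains W' p' where "covering_plot (quotient_diffeology (standard_diffeology M) (orbit_rel G (mcarrier M) A))
    (orbit G A x\<^sub>0) n W' p' (\<lambda>w. coinvariants (L2 w))"
proof -
  define r where "r = orbit_rel G (mcarrier M) A"
  have r: "equiv (mcarrier M) r"
    unfolding r_def by (rule equiv_orbit_rel) (rule group_action_axioms)
  have sym: "(y, x) \<in> r" if "(x, y) \<in> r" for x y using r that by (meson equivE symE)
  have rI: "(A g y, y) \<in> r" if "y \<in> mcarrier M" "g \<in> carrier G" for y g
    using that sym orbit_rel_iff unfolding r_def by blast
  have "covering_plot (quotient_diffeology (standard_diffeology M) r) (r `` {x\<^sub>0}) n W
    (restrict (\<lambda>w. r `` {p w}) W) (\<lambda>w. coinvariants (L2 w))"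
  proof (rule C.covering_plot_quotient[OF r])
    show "\<exists>q'. (d, Z, q') \<in> standard_diffeology M \<and> q' 0 = x\<^sub>0 \<and> (\<forall>z\<in>Z. (q' z, q z) \<in> r)"
      if q: "(d, Z, q) \<in> standard_diffeology M" "0 \<in> Z" "(q 0, x\<^sub>0) \<in> r" for d Z q
    proof -
      \<comment> \<open>Translating the whole lift by one group element makes it start at
        \<open>x\<^sub>0\<close> and leaves its orbits unchanged.\<close>
      obtain g where g: "g \<in> carrier G" "x\<^sub>0 = A g (q 0)" using q(3) orbit_rel_iff unfolding r_def by blast
      have "(restrict (A g \<circ> q) Z z, q z) \<in> r" if "z \<in> Z" for z
        using rI[OF _ g(1), of "q z"] standard_diffeologyD(2)[OF q(1)] that by auto
      moreover have "restrict (A g \<circ> q) Z 0 = x\<^sub>0" using g(2) q(2) by simp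
      ultimately show ?thesis using plot_translate[OF g(1) q(1)] by blast
    qed
    show "linear_on (Rn n) (\<lambda>w. coinvariants (L2 w))"
      using linear_linear_on[OF linear_compose[OF L2 linear_coinvariants]] by (simp add: comp_def)
    show "coinvariants (L2 (jacobian d g v)) = coinvariants (L2 (jacobian d h v))"
      if g: "germ d Z n W g" and h: "germ d Z n W h" and v: "v \<in> Rn d"
        and gh: "\<And>z. z \<in> Z \<Longrightarrow> (p (g z), p (h z)) \<in> r" for d Z g h v
    proof
      fix f show "coinvariants (L2 (jacobian d g v)) f = coinvariants (L2 (jacobian d h v)) f"
        using orbit_germs_derivative[OF _ g h v gh[unfolded r_def]] by (simp add: coinvariants_def)
    qed
    show "w \<in> span (germ_pair_differences (\<lambda>a b. (p a, p b) \<in> r) n W)" (is "_ \<in> span ?P")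
      if w: "w \<in> Rn n" "coinvariants (L2 w) = 0" for w
    proof -
      have "{D g u - u | g u. g \<in> K \<and> u \<in> Rn k} \<subseteq> ?P"
      proof
        fix y assume "y \<in> {D g u - u | g u. g \<in> K \<and> u \<in> Rn k}"
        then obtain g u where gu: "g \<in> K" "u \<in> Rn k" "y = D g u - u" by blast
        note gg = germ_translate[OF gu(1)]
        have gi: "germ n (action_domain g) n W (\<lambda>w. w)"
          using gg smooth_on_id action_domain(1) by (auto simp: germ_def)
        have "y = jacobian n (\<phi> \<circ> A g \<circ> p) u - jacobian n (\<lambda>w. w) u"
          using gu(3) jacobian_id[OF Rk_Rn[OF gu(2)]] by (simp add: D_def)
        moreover have "(p ((\<phi> \<circ> A g \<circ> p) z), p z) \<in> r" if "z \<in> action_domain g" for z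
          unfolding action_domain(3)[OF that]
          by (rule rI[OF C.p_carrier[OF action_domain(1)[OF that]] K_carrier[OF gu(1)]])
        ultimately show "y \<in> ?P"
          unfolding germ_pair_differences_def using gg gi Rk_Rn[OF gu(2)] by blast
      qed
      then have 1: "L2 w \<in> span ?P"
        using coinvariants_kernel[OF L2_Rk[OF w(1)] w(2)] span_mono by blast
      have "d_orbit (L1 w) \<in> ?P"
      proof -
        note go = germ_orbit
        have gz: "germ m orbit_domain n W (\<lambda>z. 0)"
          using go smooth_fun_const C.zero_W by (auto simp: germ_def smooth_on_def)
        have "jacobian m (\<lambda>z. 0 :: nat \<Rightarrow> real) (L1 w) = 0"
        proof -
          have "partial i (\<lambda>z. (0 :: nat \<Rightarrow> real) j) 0 = 0" for i j
            by (rule partial_eqI) simp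
          then show ?thesis by (simp add: jacobian_def fun_eq_iff)
        qed
        then have "d_orbit (L1 w) = jacobian m (\<phi> \<circ> (\<lambda>g. A g x\<^sub>0) \<circ> pG) (L1 w) - jacobian m (\<lambda>z. 0) (L1 w)"
          by (simp only: d_orbit_def diff_0_right)
        moreover have "(p ((\<phi> \<circ> (\<lambda>g. A g x\<^sub>0) \<circ> pG) z), p 0) \<in> r" if z: "z \<in> orbit_domain" for z
        proof -
          have "p ((\<phi> \<circ> (\<lambda>g. A g x\<^sub>0) \<circ> pG) z) = A (pG z) x\<^sub>0"
            using z C.inverse'(2) by (simp add: orbit_domain_def)
          moreover have "pG z \<in> carrier G"
            using z B.p_carrier group_carrier by (auto simp: orbit_domain_def)
          ultimately show ?thesis using rI[OF C.x_carrier] C.p_zero by metis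
        qed
        ultimately show ?thesis
          unfolding germ_pair_differences_def using go gz L1_Rn[OF w(1)] by blast
      qed
      then have "d_orbit (L1 w) + L2 w \<in> span ?P"
        using span_add[OF span_base 1] by blast
      then show ?thesis using L_split[OF w(1)] by (simp only:)
    qed
  qed
  then show ?thesis
    using that unfolding r_def orbit_rel_Image[OF C.x_carrier] by blast
qed

lemma tangent_spaces_iso_splitting:
  "vec_space_iso
      (internal_tangent_space (quotient_diffeology (standard_diffeology M) (orbit_rel G (mcarrier M) A)) (orbit G A x\<^sub>0))
      (internal_tangent_space
        (quotient_diffeology (standard_diffeology (vector_manifold V)) (orbit_rel (stabilizer_group G A x\<^sub>0) V \<rho>))
        (orbit (stabilizer_group G A x\<^sub>0) \<rho> 0))"
proof -
  obtain W1 p1 where 1: "covering_plot (quotient_diffeology (standard_diffeology M) (orbit_rel G (mcarrier M) A))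
    (orbit G A x\<^sub>0) n W1 p1 (\<lambda>w. coinvariants (L2 w))"
    using covering_plot_orbit_space by metis
  obtain W2 p2 where 2: "covering_plot (quotient_diffeology (standard_diffeology (vector_manifold V))
    (orbit_rel (stabilizer_group G A x\<^sub>0) V \<rho>)) (orbit (stabilizer_group G A x\<^sub>0) \<rho> 0) k W2 p2 coinvariants"
    using covering_plot_slice by metis
  \<comment> \<open>\<open>L2\<close> projects onto R^k, so the two maps into the space of
    coinvariants have the same image, which is all that remains to be compared.\<close>
  have "L2 ` Rn n = Rn k"
    using L2_Rk L2_id Rk_Rn by force
  then have "(\<lambda>w. coinvariants (L2 w)) ` Rn n = coinvariants ` Rn k"
    by (metis image_image)
  from internal_tangent_space_iso[OF 1 2 this] show ?thesis .
qed

end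

lemma (in slice_chart) tangent_spaces_iso:
  "vec_space_iso
      (internal_tangent_space (quotient_diffeology (standard_diffeology M) (orbit_rel G (mcarrier M) A)) (orbit G A x\<^sub>0))
      (internal_tangent_space
        (quotient_diffeology (standard_diffeology (vector_manifold V)) (orbit_rel (stabilizer_group G A x\<^sub>0) V \<rho>))
        (orbit (stabilizer_group G A x\<^sub>0) \<rho> 0))"
proof (rule linear_splitting)
  fix L1 L2 assume L: "linear L1" "linear L2" "\<And>w. w \<in> Rn n \<Longrightarrow> L1 w \<in> Rn m" "\<And>w. w \<in> Rn n \<Longrightarrow> L2 w \<in> Rn k"
    "\<And>w. w \<in> Rn n \<Longrightarrow> d_orbit (L1 w) + L2 w = w" "\<And>w. w \<in> Rn k \<Longrightarrow> L2 w = w"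
  have "slice_splitting G \<G> M A x\<^sub>0 n W p \<phi> m WG pG \<phi>G S k L1 L2"
    by (rule slice_splitting.intro[OF slice_chart_axioms slice_splitting_axioms.intro[OF L]])
  then show ?thesis by (rule slice_splitting.tangent_spaces_iso_splitting)
qed

theorem corollary4p5:
  fixes G :: "('g, 'c) monoid_scheme" and \<G> :: "'g manifold" and M :: "'a manifold"
    and A :: "'g \<Rightarrow> 'a \<Rightarrow> 'a" and x\<^sub>0 :: 'a and S :: "'a set"
  defines "K \<equiv> stabilizer_group G A x\<^sub>0"
    and "V \<equiv> tangent_space M S x\<^sub>0"
    and "\<rho> \<equiv> tangent_action M A S x\<^sub>0"
  assumes "lie_group G \<G>"
    and "is_manifold M"
    and "smooth_action G \<G> M A"
    and "proper_action \<G> M A"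
    and "x\<^sub>0 \<in> mcarrier M"
    and "slice G \<G> M A x\<^sub>0 S"
  shows "vec_space_iso
      (internal_tangent_space
        (quotient_diffeology (standard_diffeology M) (orbit_rel G (mcarrier M) A))
        (orbit G A x\<^sub>0))
      (internal_tangent_space
        (quotient_diffeology (standard_diffeology (vector_manifold V)) (orbit_rel K V \<rho>))
        (orbit K \<rho> 0)) \<and>
    compact_linear_action K (mtop \<G>) V \<rho>"
proof -
  note hyps = assms(4-)
  interpret lie_group_action G \<G> M A
    by unfold_locales (use hyps in auto)
  have x0S: "x\<^sub>0 \<in> S" and "submanifold M S"
    using hyps(6) by (auto simp: slice_def)
  then obtain n U \<psi> k where c: "smooth_chart M (n, U, \<psi>)" "x\<^sub>0 \<in> U" "k \<le> n" "\<psi> ` (U \<inter> S) = \<psi> ` U \<inter> Rn k"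
    unfolding submanifold_def by blast
  obtain r p where p: "centred_chart M x\<^sub>0 n (cube n 0 r) p (\<lambda>y. \<psi> y - \<psi> x\<^sub>0)"
    "\<And>w. w \<in> cube n 0 r \<Longrightarrow> p w \<in> U" "\<And>w. w \<in> cube n 0 r \<Longrightarrow> \<psi> (p w) = w + \<psi> x\<^sub>0"
    using centred_chart_exists[OF hyps(2) c(1,2)] by metis
  have S_iff: "y \<in> S \<longleftrightarrow> \<psi> y \<in> Rn k" if "y \<in> U" for y
  proof
    show "\<psi> y \<in> Rn k" if "y \<in> S" using c(4) that \<open>y \<in> U\<close> by blast
    assume "\<psi> y \<in> Rn k"
    then have "\<psi> y \<in> \<psi> ` (U \<inter> S)" using c(4) that by blast
    then show "y \<in> S"
      using chart_onD(3)[OF smooth_chartD(1)[OF c(1)]] that by (auto dest: inj_onD)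
  qed
  \<comment> \<open>Since \<open>\<psi> x\<^sub>0\<close> lies in R^k, centring the chart at
    \<open>x\<^sub>0\<close> is a translation within R^k, and the centred chart still flattens
    \<open>S\<close>.\<close>
  have aR: "\<psi> x\<^sub>0 \<in> Rn k" using S_iff[OF c(2)] x0S by simp
  have slice_iff: "p w \<in> S \<longleftrightarrow> w \<in> Rn k" if w: "w \<in> cube n 0 r" for w
  proof -
    have "w + \<psi> x\<^sub>0 \<in> Rn k \<longleftrightarrow> w \<in> Rn k"
      using Rn_add[OF _ aR] Rn_diff[OF _ aR, of "w + \<psi> x\<^sub>0"] by auto
    then show ?thesis using S_iff[OF p(2)[OF w]] p(3)[OF w] by simp
  qed
  obtain m WG pG \<phi>G where G: "centred_chart \<G> \<one>\<^bsub>G\<^esub> m WG pG \<phi>G"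
  proof -
    obtain m U \<kappa> where u: "(m, U, \<kappa>) \<in> atlas \<G>" "\<one>\<^bsub>G\<^esub> \<in> U"
      using chartedD(3)[OF is_manifold_charted[OF group_manifold]] group_carrier grp.one_closed by blast
    from centred_chart_exists[OF group_manifold atlas_smooth_chart[OF group_manifold u(1)] u(2)]
    show ?thesis using that by metis
  qed
  have sc: "slice_chart G \<G> M A x\<^sub>0 n (cube n 0 r) p (\<lambda>y. \<psi> y - \<psi> x\<^sub>0) m WG pG \<phi>G S k"
    by (rule slice_chart.intro[OF lie_group_action_axioms p(1) G
          slice_chart_axioms.intro[OF hyps(4,6) c(3) slice_iff]])
  show ?thesis
    unfolding K_def V_def \<rho>_def
    by (rule conjI[OF slice_chart.tangent_spaces_iso[OF sc] slice_chart.\<rho>_compact_linear[OF sc]])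
qed

end
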